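(* Let $C$ be a PD-code. Then the reconstruction procedure described in the context, applied to $C$, is well-defined and produces a labeled, oriented link diagram on an orientable (closed, not necessarily connected) surface $S$.
   Context: PD-codes. Let $\mu\ge 1$ and $n_1,\dots,n_\mu\ge 1$, and consider the labels $(c,k)$ with $1\le c\le\mu$, $1\le k\le n_c$. A signed label is $+\lambda$ or $-\lambda$ with $\lambda$ a label. A PD-code is a finite (unordered) collection of ordered quadruples of signed labels such that: (1) each label appears exactly twice in the collection, once with sign $+$ and once with sign $-$; (2) each quadruple contains two positive and two negative entries and begins with a positive entry; (3) in each quadruple, the first and third entries have the same first coordinate $c$ and their second coordinates are consecutive modulo $n_c$; the same holds for the second and fourth entries; (4) in each quadruple, the first and third entries have opposite signs, and the lesser label in the cyclic order is the positive one, i.e. the positive entry is $+(c,k)$ and the negative entry is $-(c,k+1)$ for some $k$, with second coordinates read modulo $n_c$; the same holds for the second and fourth entries. Link diagrams. Let $S$ be a smooth, closed, oriented, not necessarily connected surface. A labeled, oriented link diagram on $S$ is a smooth oriented immersion $d:\sqcup_n S^1\to S$ of $n$ ordered circles with finitely many transverse double self-intersections (vertices, or crossings) and no other self-intersections; the arcs between vertices are called edges, so that the image is an embedded $4$-regular graph covered by oriented circuits. The edges are labeled by pairs $(i,j)$, where $i$ is the index of the circle containing the edge and $j$ gives the cyclic ordering of the edges along that oriented circle. Each crossing is colored by a sign in $\{1,-1\}$, which determines which strand is over and which is under: sign $+1$ means that (direction of the over-strand, direction of the under-strand) is a positively oriented frame, and $-1$ means that it is negatively oriented. Diagrams are considered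 up to isotopy of $S$ respecting labels and crossing signs. Reconstruction procedure for a PD-code $C$. (i) Form the oriented $4$-regular graph whose edges are the labels and whose vertices are the quadruples of $C$; the entry $+\lambda$ is the incoming end of edge $\lambda$ and $-\lambda$ is its outgoing end. The order of entries in a quadruple is the cyclic ordering $(e^0,e^1,e^2,e^3)$ of ends at that vertex. (ii) Let $s$ be the successor map on signed labels, $s(e^j)=-e^{\,j+1\bmod 4}$ (where $-(-\lambda)=+\lambda$). For each orbit of $s$ of length $m$ take an $m$-gon in the plane (with $m=1,2$ allowed), oriented by the plane, with sides labeled clockwise by the successive elements of the orbit; orient negatively labeled sides counterclockwise and positively labeled sides clockwise. Identify, for each label $\lambda$, the side $+\lambda$ with the side $-\lambda$ respecting side orientations. The resulting surface (smoothed) is $S$, in which the graph of (i) is embedded as the $1$-skeleton. (iii) Starting with edge $(1,1)$, traverse the $1$-skeleton, passing at each vertex to the non-adjacent edge end (two positions away in the quadruple), and orient each edge from its negative end to its positive end; repeat until every edge is contained in a cycle. This gives an oriented immersion of ordered circles, with edges labeled by the labels of $C$. (iv) Color a vertex $+1$ if its quadruple has the sign pattern $[+,-,-,+]$ and $-1$ if its quadruple has the sign pattern $[+,+,-,-]$. *)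

theory Defs
  imports
    "HOL-Analysis.Analysis"
    "HOL-Combinatorics.Orbits"
    "HOL-Library.Multiset"
begin

section \<open>PD-codes\<close>

type_synonym label = "nat \<times> nat"

datatype slabel = is_Plus: Plus (label_of: label) | Minus (label_of: label)

fun neg :: "slabel \<Rightarrow> slabel" where
  "neg (Plus l) = Minus l"
| "neg (Minus l) = Plus l"

type_synonym quad = "slabel \<times> slabel \<times> slabel \<times> slabel"

fun ends :: "quad \<Rightarrow> slabel list" where
  "ends (w, x, y, z) = [w, x, y, z]"

definition labels :: "nat \<Rightarrow> (nat \<Rightarrow> nat) \<Rightarrow> label set" where
  "labels \<mu> n = (SIGMA c:{1..\<mu>}. {1..n c})"

definition signed_labels :: "nat \<Rightarrow> (nat \<Rightarrow> nat) \<Rightarrow> slabel set" where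
  "signed_labels \<mu> n = Plus ` labels \<mu> n \<union> Minus ` labels \<mu> n"

definition next_label :: "(nat \<Rightarrow> nat) \<Rightarrow> label \<Rightarrow> label" where
  "next_label n l = (fst l, snd l mod n (fst l) + 1)"

definition consecutive_pair :: "(nat \<Rightarrow> nat) \<Rightarrow> slabel \<Rightarrow> slabel \<Rightarrow> bool" where
  "consecutive_pair n x y \<longleftrightarrow>
     (\<exists>l. (x = Plus l \<and> y = Minus (next_label n l)) \<or> (y = Plus l \<and> x = Minus (next_label n l)))"

text \<open>The multiset equation says that the entries of all the quadruples, taken together,
  are the signed labels, each exactly once.  Since \<open>consecutive_pair\<close> puts the positive entry
  on the lesser label, it covers both the requirement that opposite entries be
  consecutive on one component and the one on their signs.\<close>

definition pd_code :: "nat \<Rightarrow> (nat \<Rightarrow> nat) \<Rightarrow> quad multiset \<Rightarrow> bool" where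
  "pd_code \<mu> n C \<longleftrightarrow>
     1 \<le> \<mu> \<and> (\<forall>c\<in>{1..\<mu>}. 1 \<le> n c) \<and>
     (\<Sum>q\<in>#C. mset (ends q)) = mset_set (signed_labels \<mu> n) \<and>
     (\<forall>q\<in>#C.
        length (filter is_Plus (ends q)) = 2 \<and> is_Plus (ends q ! 0) \<and>
        consecutive_pair n (ends q ! 0) (ends q ! 2) \<and>
        consecutive_pair n (ends q ! 1) (ends q ! 3))"


section \<open>Smooth oriented surfaces\<close>

text \<open>Charts take values in the complex plane, regarded as the oriented real plane;
  \<open>det2 u v > 0\<close> means that \<open>(u, v)\<close> is a positively oriented frame.\<close>

definition det2 :: "complex \<Rightarrow> complex \<Rightarrow> real" where
  "det2 u v = Re u * Im v - Im u * Re v"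

text \<open>The following two notions are meant for open sets \<open>S\<close>.\<close>

primrec Ck_on :: "nat \<Rightarrow> ('a::real_normed_vector \<Rightarrow> 'b::real_normed_vector) \<Rightarrow> 'a set \<Rightarrow> bool" where
  "Ck_on 0 f S \<longleftrightarrow> continuous_on S f"
| "Ck_on (Suc k) f S \<longleftrightarrow>
     f differentiable_on S \<and> (\<forall>v. Ck_on k (\<lambda>x. frechet_derivative f (at x) v) S)"

definition smooth_on :: "('a::real_normed_vector \<Rightarrow> 'b::real_normed_vector) \<Rightarrow> 'a set \<Rightarrow> bool" where
  "smooth_on f S \<longleftrightarrow> (\<forall>k. Ck_on k f S)"

definition oriented_smooth_on :: "(complex \<Rightarrow> complex) \<Rightarrow> complex set \<Rightarrow> bool" where
  "oriented_smooth_on f S \<longleftrightarrow> smooth_on f S \<and>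
     (\<forall>z\<in>S. det2 (frechet_derivative f (at z) 1) (frechet_derivative f (at z) \<i>) > 0)"

type_synonym 'a chart = "'a set \<times> ('a \<Rightarrow> complex)"

definition is_chart :: "'a topology \<Rightarrow> 'a chart \<Rightarrow> bool" where
  "is_chart X = (\<lambda>(U, \<phi>). openin X U \<and> open (\<phi> ` U) \<and>
     homeomorphic_map (subtopology X U) (top_of_set (\<phi> ` U)) \<phi>)"

definition oriented_smooth_surface :: "'a topology \<Rightarrow> 'a chart set \<Rightarrow> bool" where
  "oriented_smooth_surface X A \<longleftrightarrow>
     Hausdorff_space X \<and> second_countable X \<and>
     (\<forall>\<kappa>\<in>A. is_chart X \<kappa>) \<and> (\<Union>\<kappa>\<in>A. fst \<kappa>) = topspace X \<and>
     (\<forall>(U, \<phi>)\<in>A. \<forall>(V, \<psi>)\<in>A. oriented_smooth_on (\<psi> \<circ> inv_into U \<phi>) (\<phi> ` (U \<inter> V)))"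

definition closed_oriented_surface :: "'a topology \<Rightarrow> 'a chart set \<Rightarrow> bool" where
  "closed_oriented_surface X A \<longleftrightarrow> oriented_smooth_surface X A \<and> compact_space X"


section \<open>Labeled, oriented link diagrams\<close>

text \<open>The circles are \<open>\<mu>\<close> copies of the unit circle, oriented counterclockwise; the point \<open>z\<close> of
  the \<open>c\<close>-th circle is \<open>(c, z)\<close>.\<close>

definition circles :: "nat \<Rightarrow> (nat \<times> complex) topology" where
  "circles \<mu> = sum_topology (\<lambda>c. top_of_set (sphere 0 1)) {1..\<mu>}"

record 'a diagram =
  surf :: "'a topology"
  atlas :: "'a chart set"
  imm :: "nat \<times> complex \<Rightarrow> 'a"
  edge :: "label \<Rightarrow> 'a set"
  csign :: "'a \<Rightarrow> int"

definition velocity :: "('a \<Rightarrow> complex) \<Rightarrow> (nat \<times> complex \<Rightarrow> 'a) \<Rightarrow> nat \<Rightarrow> real \<Rightarrow> complex" where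
  "velocity \<phi> d c \<theta> = vector_derivative (\<lambda>t. \<phi> (d (c, cis t))) (at \<theta>)"

definition smooth_immersion ::
    "'a topology \<Rightarrow> 'a chart set \<Rightarrow> nat \<Rightarrow> (nat \<times> complex \<Rightarrow> 'a) \<Rightarrow> bool" where
  "smooth_immersion X A \<mu> d \<longleftrightarrow>
     continuous_map (circles \<mu>) X d \<and>
     (\<forall>c\<in>{1..\<mu>}. \<forall>(U, \<phi>)\<in>A.
        smooth_on (\<lambda>t. \<phi> (d (c, cis t))) {t. d (c, cis t) \<in> U} \<and>
        (\<forall>t. d (c, cis t) \<in> U \<longrightarrow> velocity \<phi> d c t \<noteq> 0))"

definition crossings :: "nat \<Rightarrow> (nat \<times> complex \<Rightarrow> 'a) \<Rightarrow> 'a set" where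
  "crossings \<mu> d = {d p | p. p \<in> topspace (circles \<mu>) \<and>
     (\<exists>p'\<in>topspace (circles \<mu>). p' \<noteq> p \<and> d p' = d p)}"

definition transverse_double_points ::
    "'a chart set \<Rightarrow> nat \<Rightarrow> (nat \<times> complex \<Rightarrow> 'a) \<Rightarrow> bool" where
  "transverse_double_points A \<mu> d \<longleftrightarrow>
     finite (crossings \<mu> d) \<and>
     (\<forall>x\<in>crossings \<mu> d. card {p \<in> topspace (circles \<mu>). d p = x} = 2) \<and>
     (\<forall>c\<in>{1..\<mu>}. \<forall>c'\<in>{1..\<mu>}. \<forall>\<theta> \<theta>'.
        (c, cis \<theta>) \<noteq> (c', cis \<theta>') \<longrightarrow> d (c, cis \<theta>) = d (c', cis \<theta>') \<longrightarrow>
        (\<forall>(U, \<phi>)\<in>A. d (c, cis \<theta>) \<in> U \<longrightarrow>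
           det2 (velocity \<phi> d c \<theta>) (velocity \<phi> d c' \<theta>') \<noteq> 0))"

text \<open>The parameters \<open>\<theta> 1 < \<dots> < \<theta> (n c)\<close> are the crossing passages met on one turn around the
  \<open>c\<close>-th circle, and the (open) edge labeled \<open>(c, k)\<close> runs from \<open>\<theta> k\<close> to \<open>\<theta> (k + 1)\<close>.
  As the image is a 4-regular graph covered by circuits, every circle passes
  through some crossing; the conditions below force \<open>1 \<le> n c\<close>.\<close>

definition edge_labeling ::
    "nat \<Rightarrow> (nat \<Rightarrow> nat) \<Rightarrow> (nat \<times> complex \<Rightarrow> 'a) \<Rightarrow> (label \<Rightarrow> 'a set) \<Rightarrow> bool" where
  "edge_labeling \<mu> n d E \<longleftrightarrow>
     (\<forall>c\<in>{1..\<mu>}. \<exists>\<theta> :: nat \<Rightarrow> real.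
        (\<forall>k\<in>{1..n c}. \<theta> k < \<theta> (k + 1)) \<and> \<theta> (n c + 1) = \<theta> 1 + 2 * pi \<and>
        {z \<in> sphere 0 1. d (c, z) \<in> crossings \<mu> d} = (\<lambda>k. cis (\<theta> k)) ` {1..n c} \<and>
        (\<forall>k\<in>{1..n c}. E (c, k) = (\<lambda>t. d (c, cis t)) ` {\<theta> k<..<\<theta> (k + 1)}))"

text \<open>The passage \<open>(c, cis \<theta>)\<close> through a crossing is the over-strand there if the crossing sign is
  the orientation of the frame (its direction, direction of the other strand).\<close>

definition over_strand :: "nat \<Rightarrow> 'a diagram \<Rightarrow> nat \<times> complex \<Rightarrow> bool" where
  "over_strand \<mu> D p \<longleftrightarrow>
     (\<forall>c\<in>{1..\<mu>}. \<forall>c'\<in>{1..\<mu>}. \<forall>\<theta> \<theta>'.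
        p = (c, cis \<theta>) \<longrightarrow> (c', cis \<theta>') \<noteq> p \<longrightarrow> imm D (c', cis \<theta>') = imm D p \<longrightarrow>
        (\<forall>(U, \<phi>)\<in>atlas D. imm D p \<in> U \<longrightarrow>
           of_int (csign D (imm D p)) *
             det2 (velocity \<phi> (imm D) c \<theta>) (velocity \<phi> (imm D) c' \<theta>') > 0))"

definition labeled_link_diagram :: "nat \<Rightarrow> (nat \<Rightarrow> nat) \<Rightarrow> 'a diagram \<Rightarrow> bool" where
  "labeled_link_diagram \<mu> n D \<longleftrightarrow>
     closed_oriented_surface (surf D) (atlas D) \<and>
     smooth_immersion (surf D) (atlas D) \<mu> (imm D) \<and>
     transverse_double_points (atlas D) \<mu> (imm D) \<and>
     edge_labeling \<mu> n (imm D) (edge D) \<and>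
     (\<forall>x\<in>crossings \<mu> (imm D). csign D x \<in> {1, -1} \<and>
        (\<exists>!p. p \<in> topspace (circles \<mu>) \<and> imm D p = x \<and> over_strand \<mu> D p))"

text \<open>Diagrams on surfaces that are not literally the same are compared by an
  orientation-preserving diffeomorphism \<open>h\<close> that carries the immersion to the immersion up to
  orientation-preserving reparametrization \<open>r\<close> of each circle, and respects labels and
  crossing signs.\<close>

definition diagram_equiv ::
    "nat \<Rightarrow> (nat \<Rightarrow> nat) \<Rightarrow> 'a diagram \<Rightarrow> 'b diagram \<Rightarrow> bool" where
  "diagram_equiv \<mu> n D D' \<longleftrightarrow>
     (\<exists>h. homeomorphic_map (surf D) (surf D') h \<and>
        (\<forall>(U, \<phi>)\<in>atlas D. \<forall>(V, \<psi>)\<in>atlas D'.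
           oriented_smooth_on (\<psi> \<circ> h \<circ> inv_into U \<phi>) (\<phi> ` {x \<in> U. h x \<in> V})) \<and>
        (\<forall>c\<in>{1..\<mu>}. \<exists>r :: real \<Rightarrow> real.
           smooth_on r UNIV \<and> (\<forall>t. deriv r t > 0) \<and> (\<forall>t. r (t + 2 * pi) = r t + 2 * pi) \<and>
           (\<forall>t. h (imm D (c, cis t)) = imm D' (c, cis (r t)))) \<and>
        (\<forall>l\<in>labels \<mu> n. h ` edge D l = edge D' l) \<and>
        (\<forall>x\<in>crossings \<mu> (imm D). csign D' (h x) = csign D x))"


section \<open>The reconstruction procedure\<close>

subsection \<open>The graph\<close>

definition location :: "quad multiset \<Rightarrow> slabel \<Rightarrow> quad \<times> nat" where
  "location C x = (THE p. fst p \<in># C \<and> snd p < 4 \<and> ends (fst p) ! snd p = x)"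

definition vertex_of :: "quad multiset \<Rightarrow> slabel \<Rightarrow> quad" where
  "vertex_of C x = fst (location C x)"

text \<open>The end \<open>i\<close> places after \<open>x\<close> in the cyclic order at the vertex of \<open>x\<close>.\<close>

definition turn :: "quad multiset \<Rightarrow> nat \<Rightarrow> slabel \<Rightarrow> slabel" where
  "turn C i x = (case location C x of (q, j) \<Rightarrow> ends q ! ((j + i) mod 4))"


subsection \<open>The surface\<close>

definition face_succ :: "quad multiset \<Rightarrow> slabel \<Rightarrow> slabel" where
  "face_succ C x = neg (turn C 1 x)"

definition faces :: "nat \<Rightarrow> (nat \<Rightarrow> nat) \<Rightarrow> quad multiset \<Rightarrow> slabel set set" where
  "faces \<mu> n C = orbit (face_succ C) ` signed_labels \<mu> n"

text \<open>The \<open>m\<close>-gon of an orbit \<open>F\<close> is the closed unit disc with its boundary divided into \<open>m\<close> equal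
  arcs, which makes sense for all \<open>m \<ge> 1\<close>.  Where the clockwise labeling starts is a choice,
  made by \<open>b\<close>: the side labeled \<open>b F\<close> begins at the point \<open>1\<close>.\<close>

definition base_choice :: "nat \<Rightarrow> (nat \<Rightarrow> nat) \<Rightarrow> quad multiset \<Rightarrow> (slabel set \<Rightarrow> slabel) \<Rightarrow> bool" where
  "base_choice \<mu> n C b \<longleftrightarrow> (\<forall>F\<in>faces \<mu> n C. b F \<in> F)"

definition polygons :: "nat \<Rightarrow> (nat \<Rightarrow> nat) \<Rightarrow> quad multiset \<Rightarrow> (slabel set \<times> complex) topology" where
  "polygons \<mu> n C = sum_topology (\<lambda>F. top_of_set (cball 0 1)) (faces \<mu> n C)"

text \<open>\<open>side C b x\<close> parametrizes the side labeled \<open>x\<close> over \<open>[0, 1]\<close> in the direction of the side: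
  clockwise if \<open>x\<close> is positive, counterclockwise if it is negative.\<close>

definition side ::
    "quad multiset \<Rightarrow> (slabel set \<Rightarrow> slabel) \<Rightarrow> slabel \<Rightarrow> real \<Rightarrow> slabel set \<times> complex" where
  "side C b x t =
     (let F = orbit (face_succ C) x;
          k = real (funpow_dist (face_succ C) (b F) x);
          u = (if is_Plus x then t else 1 - t)
      in (F, cis (- (2 * pi * (k + u) / real (card F)))))"

definition glue ::
    "nat \<Rightarrow> (nat \<Rightarrow> nat) \<Rightarrow> quad multiset \<Rightarrow> (slabel set \<Rightarrow> slabel) \<Rightarrow>
      ((slabel set \<times> complex) \<times> (slabel set \<times> complex)) set" where
  "glue \<mu> n C b =
     (let R = {(side C b (Plus l) t, side C b (Minus l) t) | l t. l \<in> labels \<mu> n \<and> 0 \<le> t \<and> t \<le> 1}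
      in (R \<union> R\<inverse>)\<^sup>*)"

type_synonym point = "(slabel set \<times> complex) set"

definition proj ::
    "nat \<Rightarrow> (nat \<Rightarrow> nat) \<Rightarrow> quad multiset \<Rightarrow> (slabel set \<Rightarrow> slabel) \<Rightarrow> slabel set \<times> complex \<Rightarrow> point" where
  "proj \<mu> n C b p = glue \<mu> n C b `` {p}"

definition quotient_topology :: "'a topology \<Rightarrow> ('a \<Rightarrow> 'b) \<Rightarrow> 'b topology" where
  "quotient_topology X f =
     topology (\<lambda>U. U \<subseteq> f ` topspace X \<and> openin X {x \<in> topspace X. f x \<in> U})"

lemma openin_quotient_topology:
  "openin (quotient_topology X f) U \<longleftrightarrow>
     U \<subseteq> f ` topspace X \<and> openin X {x \<in> topspace X. f x \<in> U}"
proof -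
  let ?P = "\<lambda>U. U \<subseteq> f ` topspace X \<and> openin X {x \<in> topspace X. f x \<in> U}"
  have "istopology ?P"
    unfolding istopology_def
  proof (intro conjI allI impI)
    fix S T assume "?P S" "?P T"
    then have "openin X ({x \<in> topspace X. f x \<in> S} \<inter> {x \<in> topspace X. f x \<in> T})"
      by (intro openin_Int) auto
    moreover have "{x \<in> topspace X. f x \<in> S} \<inter> {x \<in> topspace X. f x \<in> T}
        = {x \<in> topspace X. f x \<in> S \<inter> T}" by auto
    ultimately show "openin X {x \<in> topspace X. f x \<in> S \<inter> T}" by simp
  next
    fix S T assume "?P S" "?P T"
    then show "S \<inter> T \<subseteq> f ` topspace X" by auto
  next
    fix K assume "\<forall>S\<in>K. ?P S"
    then show "\<Union>K \<subseteq> f ` topspace X" by auto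
  next
    fix K assume K: "\<forall>S\<in>K. ?P S"
    then have "openin X (\<Union>S\<in>K. {x \<in> topspace X. f x \<in> S})" by auto
    moreover have "(\<Union>S\<in>K. {x \<in> topspace X. f x \<in> S}) = {x \<in> topspace X. f x \<in> \<Union>K}" by auto
    ultimately show "openin X {x \<in> topspace X. f x \<in> \<Union>K}" by simp
  qed
  then show ?thesis
    by (simp add: quotient_topology_def topology_inverse')
qed

lemma quotient_map_quotient_topology: "quotient_map X (quotient_topology X f) f"
proof -
  have "topspace (quotient_topology X f) = f ` topspace X"
  proof
    show "topspace (quotient_topology X f) \<subseteq> f ` topspace X"
      using openin_quotient_topology[of X f "topspace (quotient_topology X f)"] by auto
    have "{x \<in> topspace X. f x \<in> f ` topspace X} = topspace X" by auto
    then show "f ` topspace X \<subseteq> topspace (quotient_topology X f)"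
      by (intro openin_subset) (simp add: openin_quotient_topology)
  qed
  then show ?thesis
    by (auto simp: quotient_map_def openin_quotient_topology)
qed

definition glued_surface ::
    "nat \<Rightarrow> (nat \<Rightarrow> nat) \<Rightarrow> quad multiset \<Rightarrow> (slabel set \<Rightarrow> slabel) \<Rightarrow> point topology" where
  "glued_surface \<mu> n C b = quotient_topology (polygons \<mu> n C) (proj \<mu> n C b)"

text \<open>A smoothing must induce on the interior of each polygon the structure and
  orientation it has as a subset of the plane.  Asking that the polygons be embedded
  conformally, and not just by orientation-preserving diffeomorphisms, makes the smoothing unique:
  in the coordinate \<open>u\<close> with \<open>z = exp (- 2 * pi * \<i> * u / m)\<close> on an \<open>m\<close>-gon, glued sides
  match by \<open>u \<mapsto> 1 - u\<close>, so the conformal structures of the open polygons fit together along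
  the edges; and they extend over the vertices, where four half-planes in \<open>u\<close> meet and the square
  root of \<open>u\<close> is a coordinate, in which opposite edge ends form a straight line.\<close>

definition smoothing ::
    "nat \<Rightarrow> (nat \<Rightarrow> nat) \<Rightarrow> quad multiset \<Rightarrow> (slabel set \<Rightarrow> slabel) \<Rightarrow> point chart set \<Rightarrow> bool" where
  "smoothing \<mu> n C b A \<longleftrightarrow>
     oriented_smooth_surface (glued_surface \<mu> n C b) A \<and>
     (\<forall>F\<in>faces \<mu> n C. \<forall>(U, \<phi>)\<in>A.
        (\<lambda>z. \<phi> (proj \<mu> n C b (F, z))) holomorphic_on {z \<in> ball 0 1. proj \<mu> n C b (F, z) \<in> U})"


subsection \<open>The 1-skeleton\<close>

definition edge_path ::
    "nat \<Rightarrow> (nat \<Rightarrow> nat) \<Rightarrow> quad multiset \<Rightarrow> (slabel set \<Rightarrow> slabel) \<Rightarrow> label \<Rightarrow> real \<Rightarrow> point" where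
  "edge_path \<mu> n C b l t = proj \<mu> n C b (side C b (Plus l) t)"

fun end_point ::
    "nat \<Rightarrow> (nat \<Rightarrow> nat) \<Rightarrow> quad multiset \<Rightarrow> (slabel set \<Rightarrow> slabel) \<Rightarrow> slabel \<Rightarrow> point" where
  "end_point \<mu> n C b (Plus l) = edge_path \<mu> n C b l 1"
| "end_point \<mu> n C b (Minus l) = edge_path \<mu> n C b l 0"

text \<open>The 1-skeleton is a copy of the graph: edge ends meet in the surface iff they belong to the
  same quadruple, and the open edges are embedded, pairwise disjoint, and disjoint from
  the vertices.\<close>

definition graph_embedded ::
    "nat \<Rightarrow> (nat \<Rightarrow> nat) \<Rightarrow> quad multiset \<Rightarrow> (slabel set \<Rightarrow> slabel) \<Rightarrow> bool" where
  "graph_embedded \<mu> n C b \<longleftrightarrow>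
     (\<forall>x\<in>signed_labels \<mu> n. \<forall>y\<in>signed_labels \<mu> n.
        end_point \<mu> n C b x = end_point \<mu> n C b y \<longleftrightarrow> vertex_of C x = vertex_of C y) \<and>
     inj_on (\<lambda>(l, t). edge_path \<mu> n C b l t) (labels \<mu> n \<times> {0<..<1}) \<and>
     (\<forall>l\<in>labels \<mu> n. \<forall>t\<in>{0<..<1}. \<forall>x\<in>signed_labels \<mu> n.
        edge_path \<mu> n C b l t \<noteq> end_point \<mu> n C b x)"


subsection \<open>The immersion and the crossing signs\<close>

text \<open>Having traversed \<open>l\<close> up to its positive end, one continues along the edge with the opposite
  end at that vertex.\<close>

definition next_edge :: "quad multiset \<Rightarrow> label \<Rightarrow> label" where
  "next_edge C l = label_of (turn C 2 (Plus l))"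

text \<open>The \<open>c\<close>-th circle runs through the edges \<open>l, f l, f (f l), \<dots>\<close>, where \<open>l = (c, 1)\<close> and
  \<open>f = next_edge C\<close>, until \<open>l\<close> is reached again; each edge is traversed monotonically from its
  negative to its positive end.\<close>

definition traverses ::
    "nat \<Rightarrow> (nat \<Rightarrow> nat) \<Rightarrow> quad multiset \<Rightarrow> (slabel set \<Rightarrow> slabel) \<Rightarrow>
      (nat \<times> complex \<Rightarrow> point) \<Rightarrow> bool" where
  "traverses \<mu> n C b d \<longleftrightarrow>
     (\<forall>c\<in>{1..\<mu>}. \<exists>\<theta> :: nat \<Rightarrow> real.
        \<theta> (card (orbit (next_edge C) (c, 1))) = \<theta> 0 + 2 * pi \<and>
        (\<forall>k < card (orbit (next_edge C) (c, 1)).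
           \<theta> k < \<theta> (k + 1) \<and>
           (\<exists>g. continuous_on {\<theta> k..\<theta> (k + 1)} g \<and> strict_mono_on {\<theta> k..\<theta> (k + 1)} g \<and>
              g (\<theta> k) = 0 \<and> g (\<theta> (k + 1)) = 1 \<and>
              (\<forall>t\<in>{\<theta> k..\<theta> (k + 1)}.
                 d (c, cis t) = edge_path \<mu> n C b ((next_edge C ^^ k) (c, 1)) (g t)))))"

definition sign_pattern :: "quad \<Rightarrow> bool list" where
  "sign_pattern q = map is_Plus (ends q)"

definition color :: "quad \<Rightarrow> int" where
  "color q = (if sign_pattern q = [True, False, False, True] then 1
              else if sign_pattern q = [True, True, False, False] then -1 else 0)"

text \<open>\<open>D\<close> is a result of the procedure when the polygons are labeled starting from \<open>b\<close>.\<close>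

definition reconstruction ::
    "nat \<Rightarrow> (nat \<Rightarrow> nat) \<Rightarrow> quad multiset \<Rightarrow> (slabel set \<Rightarrow> slabel) \<Rightarrow> point diagram \<Rightarrow> bool" where
  "reconstruction \<mu> n C b D \<longleftrightarrow>
     base_choice \<mu> n C b \<and>
     surf D = glued_surface \<mu> n C b \<and>
     smoothing \<mu> n C b (atlas D) \<and>
     smooth_immersion (surf D) (atlas D) \<mu> (imm D) \<and>
     traverses \<mu> n C b (imm D) \<and>
     (\<forall>l\<in>labels \<mu> n. edge D l = edge_path \<mu> n C b l ` {0<..<1}) \<and>
     (\<forall>x\<in>signed_labels \<mu> n. csign D (end_point \<mu> n C b x) = color (vertex_of C x))"


subsection \<open>Cyclic order of the edge ends around a vertex\<close>

text \<open>\<open>at_end \<mu> n C b d x \<theta>\<close>: at parameter \<open>\<theta>\<close> the circle carrying the edge of \<open>x\<close> arrives at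
  the vertex through the end \<open>x\<close> (for positive \<open>x\<close>), respectively leaves it through \<open>x\<close> (for
  negative \<open>x\<close>).\<close>

definition at_end ::
    "nat \<Rightarrow> (nat \<Rightarrow> nat) \<Rightarrow> quad multiset \<Rightarrow> (slabel set \<Rightarrow> slabel) \<Rightarrow>
      (nat \<times> complex \<Rightarrow> point) \<Rightarrow> slabel \<Rightarrow> real \<Rightarrow> bool" where
  "at_end \<mu> n C b d x \<theta> \<longleftrightarrow>
     d (fst (label_of x), cis \<theta>) = end_point \<mu> n C b x \<and>
     (\<exists>\<epsilon>>0. \<forall>t \<in> (if is_Plus x then {\<theta> - \<epsilon><..<\<theta>} else {\<theta><..<\<theta> + \<epsilon>}).
        d (fst (label_of x), cis t) \<in> edge_path \<mu> n C b (label_of x) ` {0<..<1})"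

text \<open>Direction, in a chart, in which the edge end \<open>x\<close> points away from the vertex.\<close>

definition outward ::
    "(point \<Rightarrow> complex) \<Rightarrow> (nat \<times> complex \<Rightarrow> point) \<Rightarrow> slabel \<Rightarrow> real \<Rightarrow> complex" where
  "outward \<phi> d x \<theta> =
     (if is_Plus x then - velocity \<phi> d (fst (label_of x)) \<theta> else velocity \<phi> d (fst (label_of x)) \<theta>)"

text \<open>The entries of a quadruple name the four edge ends in counterclockwise order.\<close>

definition respects_cyclic_order ::
    "nat \<Rightarrow> (nat \<Rightarrow> nat) \<Rightarrow> quad multiset \<Rightarrow> (slabel set \<Rightarrow> slabel) \<Rightarrow> point diagram \<Rightarrow> bool" where
  "respects_cyclic_order \<mu> n C b D \<longleftrightarrow>
     (\<forall>x\<in>signed_labels \<mu> n. \<forall>\<theta> \<theta>'.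
        at_end \<mu> n C b (imm D) x \<theta> \<longrightarrow> at_end \<mu> n C b (imm D) (turn C 1 x) \<theta>' \<longrightarrow>
        (\<forall>(U, \<phi>)\<in>atlas D. end_point \<mu> n C b x \<in> U \<longrightarrow>
           det2 (outward \<phi> (imm D) x \<theta>) (outward \<phi> (imm D) (turn C 1 x) \<theta>') > 0))"

end

theory Submission
  imports Defs "HOL-Complex_Analysis.Complex_Analysis"
begin

text \<open>All local questions are settled in one family of coordinates.  On a polygon with \<open>m\<close> sides the
  point \<open>z = exp (- 2 * pi * \<i> * (k + u) / m)\<close> has the coordinate \<open>u\<close> relative to the
  side number \<open>k\<close>: the polygon corresponds to the lower half plane \<open>Im u \<le> 0\<close>, the side is the real interval
  from 0 to 1, and \<open>u - 1\<close> is the coordinate relative to the next side.  Two glued sides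
  match by \<open>u \<mapsto> 1 - u\<close>, which carries the lower to the upper half plane.  Hence the two half
  planes along an edge fit together to a holomorphic coordinate.  Around a vertex the ends
  \<open>x\<close>, \<open>turn C 1 x\<close>, \<open>turn C 2 x\<close>, \<open>turn C 3 x\<close> follow one another, each separated from the next
  by one corner, a half disc in \<open>u\<close> around 1; the square root of \<open>1 - u\<close> turns it into a
  quarter disc, and the four quarter discs fit together to a disc in which the edge ends are the
  four half axes, in counterclockwise order.

  A parametrization of this kind is made of finitely many holomorphic pieces that meet
  along straight lines.  The decisive fact about them (\<open>conf_fun_P\<close>) is that a continuous function
  on an open part of the surface which is holomorphic inside every polygon becomes holomorphic in
  all these coordinates, because continuous functions are holomorphic across a line as soon as
  they are holomorphic off it.  It shows at once that the coordinates form a smooth oriented atlas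
  (\<open>smoothing_std_atlas\<close>) and that any other smoothing has the same holomorphic charts
  (\<open>conf_oriented_smooth\<close>), so that nothing depends on the smoothing.  That the
  quotient is Hausdorff follows from an explicit list of the pairs of glued points
  (\<open>glue_subset\<close>): the projection is then a closed map.

  A circle of a reconstructed diagram runs through its edges in the order of the labels.  Counting
  the edges passed, an increasing bijection of the real line relates its parameter to a
  standard path (\<open>traverses_param_of\<close>), which at the integers passes straight through
  the vertices, from an edge end to the opposite one.  As the immersion is smooth and regular, it
  leaves the vertex along a half axis with nonzero velocity (\<open>passage_velocity\<close>).
  So the two strands at a vertex are transverse, and all orientations asked for can be read off
  from the positions \<open>\<i> ^ j\<close> of the half axes.  Conversely, running through each edge as
  \<open>u = (sin (pi * s / 2))\<^sup>2\<close> makes the passage through the vertices smooth, since the square root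
  of \<open>u\<close> is then a sine (\<open>warp_coord\<close>); this gives the existence of a diagram.

  For uniqueness, a different choice of base sides rotates the polygons, which induces a
  homeomorphism of the surfaces that is conformal in the charts (\<open>H_conf_chart\<close>).  Two immersions
  of the same circuits differ by a reparametrization which is smooth because both have regular
  real coordinates along the circuit (\<open>reparametrization_smooth\<close>).\<close>

section \<open>Smooth functions and regular curves\<close>

lemma Ck_on_cong:
  assumes "open S" "\<And>x. x \<in> S \<Longrightarrow> f x = g x" "Ck_on k f S"
  shows "Ck_on k g S"
  using assms
proof (induction k arbitrary: f g)
  case 0
  have "continuous_on S f = continuous_on S g"
    by (rule continuous_on_cong[OF refl 0(2)])
  then show ?case using 0(3) by simp
next
  case (Suc k)
  have fS: "f differentiable_on S" and fk: "\<And>v. Ck_on k (\<lambda>x. frechet_derivative f (at x) v) S"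
    using Suc.prems(3) by simp_all
  have diff: "f differentiable (at x)" if "x \<in> S" for x
    using fS Suc.prems(1) that by (metis differentiable_on_def at_within_open)
  have *: "frechet_derivative f (at x) = frechet_derivative g (at x)" if "x \<in> S" for x
    by (rule frechet_derivative_transform_within_open[OF diff[OF that] Suc.prems(1) that])
       (rule Suc.prems(2))
  have "g differentiable_on S"
    unfolding differentiable_on_def
  proof
    fix x assume "x \<in> S"
    then show "g differentiable at x within S"
      using differentiable_transform_within[of f x S 1 g] Suc.prems(2) fS
      unfolding differentiable_on_def by (metis zero_less_one)
  qed
  moreover have "Ck_on k (\<lambda>x. frechet_derivative g (at x) v) S" for v
    by (rule Suc.IH[OF Suc.prems(1) _ fk]) (simp add: *)
  ultimately show ?case by simp
qed

lemma Ck_on_subset: "Ck_on k f S \<Longrightarrow> T \<subseteq> S \<Longrightarrow> Ck_on k f T"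
  by (induction k arbitrary: f) (auto intro: continuous_on_subset differentiable_on_subset)

lemma Ck_on_local:
  assumes "\<And>x. x \<in> S \<Longrightarrow> \<exists>T. open T \<and> x \<in> T \<and> Ck_on k f T"
  shows "Ck_on k f S"
  using assms
proof (induction k arbitrary: f)
  case 0
  have "continuous (at x within S) f" if "x \<in> S" for x
    using 0[OF that] by (auto simp: continuous_on_eq_continuous_at intro: continuous_at_imp_continuous_at_within)
  then show ?case by (simp add: continuous_on_eq_continuous_within)
next
  case (Suc k)
  have "f differentiable_on S"
    unfolding differentiable_on_def
  proof
    fix x assume "x \<in> S"
    then obtain T where "open T" "x \<in> T" "f differentiable_on T"
      using Suc.prems[of x] by auto
    then have "f differentiable at x"
      by (auto simp: differentiable_on_def at_within_open_NO_MATCH)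
    then show "f differentiable at x within S"
      by (rule differentiable_at_withinI)
  qed
  moreover have "Ck_on k (\<lambda>x. frechet_derivative f (at x) v) S" for v
  proof (rule Suc.IH)
    fix x assume "x \<in> S"
    then show "\<exists>T. open T \<and> x \<in> T \<and> Ck_on k (\<lambda>x. frechet_derivative f (at x) v) T"
      using Suc.prems[of x] by auto
  qed
  ultimately show ?case by simp
qed

lemma Ck_on_Suc_D: "Ck_on (Suc k) f S \<Longrightarrow> Ck_on k f S"
  by (induction k arbitrary: f) (auto intro: differentiable_imp_continuous_on)

text \<open>Every closure property below is proved by induction on the order of
  differentiability, going up with this rule, in which the derivative may be given by any formula.\<close>

lemma Ck_on_SucI:
  assumes "open S" "\<And>x. x \<in> S \<Longrightarrow> (f has_derivative D x) (at x)" "\<And>v. Ck_on k (\<lambda>x. D x v) S"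
  shows "Ck_on (Suc k) f S"
proof -
  have "f differentiable_on S"
    using assms(1,2) by (metis differentiable_on_def differentiable_def has_derivative_at_withinI)
  moreover have "frechet_derivative f (at x) = D x" if "x \<in> S" for x
    using frechet_derivative_at[OF assms(2)[OF that]] by simp
  ultimately show ?thesis
    using Ck_on_cong[OF assms(1) _ assms(3)] by simp
qed

lemma Ck_on_SucD:
  assumes "open S" "Ck_on (Suc k) f S" "x \<in> S"
  shows "(f has_derivative frechet_derivative f (at x)) (at x)"
proof -
  have "f differentiable_on S" using assms(2) by simp
  then have "f differentiable (at x)"
    using assms(1,3) by (metis differentiable_on_def at_within_open)
  then show ?thesis by (simp add: frechet_derivative_works)
qed

lemma Ck_on_const: "open S \<Longrightarrow> Ck_on k (\<lambda>x. c) S"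
  by (induction k arbitrary: c) (auto intro!: Ck_on_SucI[where D="\<lambda>x v. 0"] simp del: Ck_on.simps(2))

lemma Ck_on_bounded_linear:
  assumes "bounded_linear L" "open S" "Ck_on k f S"
  shows "Ck_on k (\<lambda>x. L (f x)) S"
  using assms(3)
proof (induction k arbitrary: f)
  case 0
  then show ?case
    using assms(1) by (auto intro: bounded_linear.continuous_on)
next
  case (Suc k)
  show ?case
    by (rule Ck_on_SucI[OF assms(2), where D="\<lambda>x v. L (frechet_derivative f (at x) v)"])
       (use Suc bounded_linear.has_derivative[OF assms(1) Ck_on_SucD[OF assms(2) Suc.prems]] in auto)
qed

lemma Ck_on_add:
  assumes "open S" "Ck_on k f S" "Ck_on k g S"
  shows "Ck_on k (\<lambda>x. f x + g x) S"
  using assms(2,3)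
proof (induction k arbitrary: f g)
  case 0
  then show ?case by (auto intro: continuous_on_add)
next
  case (Suc k)
  show ?case
    by (rule Ck_on_SucI[OF assms(1),
          where D="\<lambda>x v. frechet_derivative f (at x) v + frechet_derivative g (at x) v"])
       (use Suc has_derivative_add[OF Ck_on_SucD[OF assms(1) Suc.prems(1)]
          Ck_on_SucD[OF assms(1) Suc.prems(2)]] in auto)
qed

lemma Ck_on_mult:
  fixes f g :: "'a::real_normed_vector \<Rightarrow> 'b::real_normed_algebra"
  assumes "open S" "Ck_on k f S" "Ck_on k g S"
  shows "Ck_on k (\<lambda>x. f x * g x) S"
  using assms(2,3)
proof (induction k arbitrary: f g)
  case 0
  then show ?case by (auto intro: continuous_on_mult)
next
  case (Suc k)
  have fg: "Ck_on k f S" "Ck_on k g S"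
    using Suc.prems Ck_on_Suc_D by blast+
  show ?case
  proof (rule Ck_on_SucI[OF assms(1),
          where D="\<lambda>x v. f x * frechet_derivative g (at x) v + frechet_derivative f (at x) v * g x"])
    fix x assume "x \<in> S"
    then show "((\<lambda>x. f x * g x) has_derivative
        (\<lambda>v. f x * frechet_derivative g (at x) v + frechet_derivative f (at x) v * g x)) (at x)"
      using has_derivative_mult[OF Ck_on_SucD[OF assms(1) Suc.prems(1)] Ck_on_SucD[OF assms(1) Suc.prems(2)]]
      by blast
  next
    fix v
    show "Ck_on k (\<lambda>x. f x * frechet_derivative g (at x) v + frechet_derivative f (at x) v * g x) S"
      by (intro Ck_on_add[OF assms(1)] Suc.IH fg) (use Suc.prems in auto)
  qed
qed

lemma holomorphic_has_derivative:
  assumes "f holomorphic_on S" "open S" "z \<in> S"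
  shows "(f has_derivative (\<lambda>v. deriv f z * v)) (at z)"
  using holomorphic_derivI[OF assms] by (simp add: has_field_derivative_def)

lemma Ck_on_holomorphic:
  assumes "open S" "f holomorphic_on S"
  shows "Ck_on k f S"
  using assms(2)
proof (induction k arbitrary: f)
  case 0
  then show ?case by (simp add: holomorphic_on_imp_continuous_on)
next
  case (Suc k)
  show ?case
    by (rule Ck_on_SucI[OF assms(1), where D="\<lambda>z v. deriv f z * v"])
       (auto intro!: holomorphic_has_derivative[OF Suc.prems assms(1)] Suc.IH holomorphic_intros
          holomorphic_deriv[OF Suc.prems assms(1)])
qed

text \<open>The chain rule expresses the derivative by \<open>deriv f\<close> along the curve, which is again
  a holomorphic function composed with the curve, so the induction hypothesis applies to it.\<close>

lemma Ck_on_holomorphic_compose: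
  assumes "open S" "open T" "f holomorphic_on S" "Ck_on k \<gamma> T" "\<gamma> ` T \<subseteq> S"
  shows "Ck_on k (\<lambda>t. f (\<gamma> t)) T"
  using assms(3,4)
proof (induction k arbitrary: f)
  case 0
  then show ?case
    using continuous_on_compose2[OF holomorphic_on_imp_continuous_on[OF 0(1)], of T \<gamma>] assms(5) by auto
next
  case (Suc k)
  show ?case
  proof (rule Ck_on_SucI[OF assms(2), where D="\<lambda>t v. deriv f (\<gamma> t) * frechet_derivative \<gamma> (at t) v"])
    fix t assume t: "t \<in> T"
    then have "\<gamma> t \<in> S" using assms(5) by blast
    from has_derivative_compose[OF Ck_on_SucD[OF assms(2) Suc.prems(2) t]
            holomorphic_has_derivative[OF Suc.prems(1) assms(1) this]]
    show "((\<lambda>t. f (\<gamma> t)) has_derivative (\<lambda>v. deriv f (\<gamma> t) * frechet_derivative \<gamma> (at t) v)) (at t)"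
      by (simp only:)
  next
    fix v
    show "Ck_on k (\<lambda>t. deriv f (\<gamma> t) * frechet_derivative \<gamma> (at t) v) T"
    proof (rule Ck_on_mult[OF assms(2)])
      show "Ck_on k (\<lambda>t. deriv f (\<gamma> t)) T"
        by (rule Suc.IH[OF holomorphic_deriv[OF Suc.prems(1) assms(1)] Ck_on_Suc_D[OF Suc.prems(2)]])
      show "Ck_on k (\<lambda>t. frechet_derivative \<gamma> (at t) v) T"
        using Suc.prems(2) by simp
    qed
  qed
qed

lemma Ck_on_real_compose:
  fixes f :: "real \<Rightarrow> real" and r :: "real \<Rightarrow> real"
  assumes "open S" "open T" "Ck_on k f S" "Ck_on k r T" "r ` T \<subseteq> S"
  shows "Ck_on k (\<lambda>t. f (r t)) T"
  using assms(3,4)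
proof (induction k arbitrary: f)
  case 0
  then show ?case
    using continuous_on_compose2[of S f T r] assms(5) by auto
next
  case (Suc k)
  have lin: "frechet_derivative f (at (r t)) a = frechet_derivative f (at (r t)) 1 * a" if "t \<in> T" for t a
  proof -
    have "linear (frechet_derivative f (at (r t)))"
      by (rule has_derivative_linear[OF Ck_on_SucD[OF assms(1) Suc.prems(1)]]) (use that assms(5) in blast)
    then show ?thesis
      using linear_scale[of _ a 1] by (metis mult.commute mult_1_right real_scaleR_def)
  qed
  show ?case
  proof (rule Ck_on_SucI[OF assms(2), where
        D="\<lambda>t v. frechet_derivative f (at (r t)) 1 * frechet_derivative r (at t) v"])
    fix t assume t: "t \<in> T"
    have "r t \<in> S" using t assms(5) by blast
    from has_derivative_compose[OF Ck_on_SucD[OF assms(2) Suc.prems(2) t]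
          Ck_on_SucD[OF assms(1) Suc.prems(1) this]]
    have D: "((\<lambda>t. f (r t)) has_derivative
        (\<lambda>v. frechet_derivative f (at (r t)) (frechet_derivative r (at t) v))) (at t)" .
    have eq: "(\<lambda>v. frechet_derivative f (at (r t)) (frechet_derivative r (at t) v)) =
        (\<lambda>v. frechet_derivative f (at (r t)) 1 * frechet_derivative r (at t) v)"
      by (rule ext) (rule lin[OF t])
    show "((\<lambda>t. f (r t)) has_derivative
        (\<lambda>v. frechet_derivative f (at (r t)) 1 * frechet_derivative r (at t) v)) (at t)"
      using D unfolding eq .
  next
    fix v
    show "Ck_on k (\<lambda>t. frechet_derivative f (at (r t)) 1 * frechet_derivative r (at t) v) T"
    proof (rule Ck_on_mult[OF assms(2)])
      have "Ck_on k (\<lambda>x. frechet_derivative f (at x) 1) S"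
        using Suc.prems(1) by simp
      then show "Ck_on k (\<lambda>t. frechet_derivative f (at (r t)) 1) T"
        by (rule Suc.IH[OF _ Ck_on_Suc_D[OF Suc.prems(2)]])
      show "Ck_on k (\<lambda>t. frechet_derivative r (at t) v) T"
        using Suc.prems(2) by simp
    qed
  qed
qed

lemma Ck_on_inverse: "Ck_on k (inverse :: real \<Rightarrow> real) (- {0})"
proof (induction k)
  case 0
  then show ?case by (auto intro!: continuous_intros)
next
  case (Suc k)
  have op: "open (- {0::real})" by auto
  show ?case
  proof (rule Ck_on_SucI[OF op, where D="\<lambda>x v. - (inverse x * v * inverse x)"])
    show "Ck_on k (\<lambda>x. - (inverse x * v * inverse x)) (- {0::real})" for v
      by (intro Ck_on_bounded_linear[OF bounded_linear_minus[OF bounded_linear_ident] op]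
            Ck_on_mult[OF op] Ck_on_const[OF op] Suc)
  qed (auto intro: has_derivative_inverse')
qed

lemma smooth_onD: "smooth_on f S \<Longrightarrow> Ck_on k f S"
  by (simp add: smooth_on_def)

lemma smooth_on_local:
  assumes "\<And>x. x \<in> S \<Longrightarrow> \<exists>T. open T \<and> x \<in> T \<and> smooth_on f T"
  shows "smooth_on f S"
  unfolding smooth_on_def using Ck_on_local[of S _ f] assms unfolding smooth_on_def by metis

lemma smooth_on_subset: "smooth_on f S \<Longrightarrow> T \<subseteq> S \<Longrightarrow> smooth_on f T"
  unfolding smooth_on_def using Ck_on_subset by blast

lemma smooth_on_cong:
  "open S \<Longrightarrow> (\<And>x. x \<in> S \<Longrightarrow> f x = g x) \<Longrightarrow> smooth_on f S \<Longrightarrow> smooth_on g S"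
  unfolding smooth_on_def using Ck_on_cong by metis

lemma smooth_on_has_vector_derivative:
  assumes "open S" "smooth_on \<gamma> S" "t \<in> S"
  shows "(\<gamma> has_vector_derivative vector_derivative \<gamma> (at t)) (at t)"
proof -
  have "\<gamma> differentiable (at t)"
    using Ck_on_SucD[OF assms(1) smooth_onD[OF assms(2)] assms(3)] by (metis differentiable_def)
  then show ?thesis by (simp add: vector_derivative_works)
qed

lemma smooth_on_vector_derivative:
  fixes \<gamma> :: "real \<Rightarrow> 'b::real_normed_vector"
  assumes "open S" "smooth_on \<gamma> S"
  shows "smooth_on (\<lambda>t. vector_derivative \<gamma> (at t)) S"
  unfolding smooth_on_def
proof
  fix k
  have "Ck_on k (\<lambda>t. frechet_derivative \<gamma> (at t) 1) S"
    using smooth_onD[OF assms(2), of "Suc k"] by auto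
  then show "Ck_on k (\<lambda>t. vector_derivative \<gamma> (at t)) S"
  proof (rule Ck_on_cong[OF assms(1), rotated])
    fix t assume "t \<in> S"
    from frechet_derivative_at[OF smooth_on_has_vector_derivative[OF assms this, unfolded has_vector_derivative_def]]
    show "frechet_derivative \<gamma> (at t) 1 = vector_derivative \<gamma> (at t)"
      by (metis scaleR_one)
  qed
qed

lemma smooth_on_holomorphic: "open S \<Longrightarrow> f holomorphic_on S \<Longrightarrow> smooth_on f S"
  unfolding smooth_on_def by (simp add: Ck_on_holomorphic)

lemma det2_mult: "det2 (d * u) (d * v) = (norm d)\<^sup>2 * det2 u v"
  unfolding cmod_power2 by (simp add: det2_def power2_eq_square algebra_simps)

text \<open>The derivative of an injective holomorphic function at a point is the multiplication by
  a nonzero complex number, which preserves the orientation of frames.\<close>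

lemma oriented_smooth_on_holomorphic:
  assumes "open S" "f holomorphic_on S" "inj_on f S"
  shows "oriented_smooth_on f S"
  unfolding oriented_smooth_on_def
proof (intro conjI ballI smooth_on_holomorphic assms)
  fix z assume z: "z \<in> S"
  have "deriv f z \<noteq> 0"
    using holomorphic_injective_imp_regular[OF assms(2,1,3) z] .
  moreover have "frechet_derivative f (at z) = (\<lambda>v. deriv f z * v)"
    using frechet_derivative_at[OF holomorphic_has_derivative[OF assms(2,1) z]] by simp
  moreover have "det2 (1::complex) \<i> = 1" by (simp add: det2_def)
  ultimately show "0 < det2 (frechet_derivative f (at z) 1) (frechet_derivative f (at z) \<i>)"
    using det2_mult[of "deriv f z" 1 \<i>] by simp
qed

definition regular_curve :: "(real \<Rightarrow> complex) \<Rightarrow> real set \<Rightarrow> bool" where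
  "regular_curve \<gamma> T \<longleftrightarrow> smooth_on \<gamma> T \<and> (\<forall>t\<in>T. vector_derivative \<gamma> (at t) \<noteq> 0)"

lemma vector_derivative_cong_open:
  assumes "open T" "t \<in> T" "\<And>s. s \<in> T \<Longrightarrow> \<gamma> s = \<delta> s"
  shows "vector_derivative \<gamma> (at t) = vector_derivative \<delta> (at t)"
  by (rule vector_derivative_cong_eq) (use assms in \<open>auto simp: eventually_nhds\<close>)

lemma regular_curve_cong:
  assumes "open T" "\<And>s. s \<in> T \<Longrightarrow> \<gamma> s = \<delta> s" "regular_curve \<gamma> T"
  shows "regular_curve \<delta> T"
  unfolding regular_curve_def
proof (intro conjI ballI)
  show "smooth_on \<delta> T"
    using assms smooth_on_cong[OF assms(1), of \<gamma> \<delta>] by (auto simp: regular_curve_def)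
  fix t assume "t \<in> T"
  then show "vector_derivative \<delta> (at t) \<noteq> 0"
    using assms vector_derivative_cong_open[of T t \<gamma> \<delta>] by (auto simp: regular_curve_def)
qed

lemma regular_curve_local:
  assumes "\<And>t. t \<in> T \<Longrightarrow> \<exists>S. open S \<and> t \<in> S \<and> regular_curve \<gamma> S"
  shows "regular_curve \<gamma> T"
  unfolding regular_curve_def using smooth_on_local[of T \<gamma>] assms unfolding regular_curve_def by metis

lemma vector_derivative_holomorphic_compose:
  assumes "open S" "f holomorphic_on S" "\<gamma> t \<in> S" "(\<gamma> has_vector_derivative v) (at t)"
  shows "((\<lambda>t. f (\<gamma> t)) has_vector_derivative deriv f (\<gamma> t) * v) (at t)"
proof -
  have "((f \<circ> \<gamma>) has_vector_derivative v * deriv f (\<gamma> t)) (at t)"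
    by (rule field_vector_diff_chain_at[OF assms(4) holomorphic_derivI[OF assms(2,1,3)]])
  then show ?thesis by (simp add: o_def mult.commute)
qed

lemma regular_curve_holomorphic_compose:
  assumes "open S" "f holomorphic_on S" "inj_on f S" "open T" "regular_curve \<gamma> T" "\<gamma> ` T \<subseteq> S"
  shows "regular_curve (\<lambda>t. f (\<gamma> t)) T"
  unfolding regular_curve_def
proof (intro conjI ballI)
  show "smooth_on (\<lambda>t. f (\<gamma> t)) T"
    unfolding smooth_on_def
    using Ck_on_holomorphic_compose[OF assms(1,4,2) _ assms(6)] assms(5)
    by (auto simp: regular_curve_def smooth_on_def)
  fix t assume t: "t \<in> T"
  have "vector_derivative (\<lambda>t. f (\<gamma> t)) (at t) = deriv f (\<gamma> t) * vector_derivative \<gamma> (at t)"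
    by (rule vector_derivative_at, rule vector_derivative_holomorphic_compose[OF assms(1,2)])
       (use assms t in \<open>auto simp: regular_curve_def intro: smooth_on_has_vector_derivative\<close>)
  moreover have "deriv f (\<gamma> t) \<noteq> 0"
    using holomorphic_injective_imp_regular[OF assms(2,1,3), of "\<gamma> t"] t assms(6) by auto
  ultimately show "vector_derivative (\<lambda>t. f (\<gamma> t)) (at t) \<noteq> 0"
    using t assms(5) by (auto simp: regular_curve_def)
qed

text \<open>With the continuous difference quotient \<open>g\<close> of \<open>\<beta>\<close> at \<open>r t\<close>, the difference quotient of \<open>\<alpha>\<close>
  is that of \<open>r\<close> times \<open>g (r s)\<close>, and \<open>g (r s)\<close> tends to \<open>b\<close>.\<close>

lemma reparametrization_has_derivative:
  fixes \<alpha> \<beta> r :: "real \<Rightarrow> real"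
  assumes T: "open T" "t \<in> T" and eq: "\<And>s. s \<in> T \<Longrightarrow> \<beta> (r s) = \<alpha> s"
    and r: "isCont r t" and A: "(\<alpha> has_real_derivative a) (at t)"
    and B: "(\<beta> has_real_derivative b) (at (r t))" and b: "b \<noteq> 0"
  shows "(r has_real_derivative a / b) (at t)"
proof -
  obtain g where g: "\<And>z. \<beta> z - \<beta> (r t) = g z * (z - r t)" "isCont g (r t)" "g (r t) = b"
    using B unfolding CARAT_DERIV by auto
  have "isCont (\<lambda>s. g (r s)) t"
    using isCont_o2[OF r g(2)] .
  then have lim: "((\<lambda>s. g (r s)) \<longlongrightarrow> b) (at t)"
    using g(3) by (simp add: isCont_def)
  have ne: "eventually (\<lambda>s. g (r s) \<noteq> 0) (at t)"
    using tendsto_imp_eventually_ne[OF lim b] .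
  have "((\<lambda>s. ((\<alpha> s - \<alpha> t) / (s - t)) / g (r s)) \<longlongrightarrow> a / b) (at t)"
    by (intro tendsto_divide lim b) (use A in \<open>simp add: has_field_derivative_iff\<close>)
  moreover have "eventually (\<lambda>s. s \<in> T) (at t)"
    using T by (simp add: eventually_at_topological) blast
  then have "eventually (\<lambda>s. ((\<alpha> s - \<alpha> t) / (s - t)) / g (r s) = (r s - r t) / (s - t)) (at t)"
    using ne
  proof eventually_elim
    case (elim s)
    have "\<alpha> s - \<alpha> t = g (r s) * (r s - r t)"
      using g(1)[of "r s"] eq[OF elim(1)] eq[OF T(2)] by simp
    then show ?case using elim(2) by simp
  qed
  ultimately have "((\<lambda>s. (r s - r t) / (s - t)) \<longlongrightarrow> a / b) (at t)"
    using tendsto_cong by fastforce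
  then show ?thesis by (simp add: has_field_derivative_iff)
qed

text \<open>The derivative of \<open>r\<close> is a smooth expression in \<open>r\<close> itself, so each order of
  differentiability of \<open>r\<close> gives the next one.\<close>

lemma reparametrization_smooth:
  fixes \<alpha> \<beta> r :: "real \<Rightarrow> real"
  assumes T: "open T" and V: "open V" "r ` T \<subseteq> V" and eq: "\<And>s. s \<in> T \<Longrightarrow> \<beta> (r s) = \<alpha> s"
    and r: "continuous_on T r" and sm: "smooth_on \<alpha> T" "smooth_on \<beta> V"
    and ne: "\<And>s. s \<in> V \<Longrightarrow> vector_derivative \<beta> (at s) \<noteq> 0"
  shows "smooth_on r T"
    and "\<And>t. t \<in> T \<Longrightarrow> (r has_real_derivative
            vector_derivative \<alpha> (at t) / vector_derivative \<beta> (at (r t))) (at t)"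
proof -
  define D where "D t = vector_derivative \<alpha> (at t) * inverse (vector_derivative \<beta> (at (r t)))" for t
  have D: "(r has_real_derivative D t) (at t)" if "t \<in> T" for t
    unfolding D_def divide_inverse[symmetric]
  proof (rule reparametrization_has_derivative[OF T that])
    show "isCont r t" using r T that by (simp add: continuous_on_eq_continuous_at)
    show "(\<alpha> has_real_derivative vector_derivative \<alpha> (at t)) (at t)"
      using smooth_on_has_vector_derivative[OF T sm(1) that] by (simp add: has_real_derivative_iff_has_vector_derivative)
    show "(\<beta> has_real_derivative vector_derivative \<beta> (at (r t))) (at (r t))"
      using smooth_on_has_vector_derivative[OF V(1) sm(2), of "r t"] V(2) that
      by (auto simp: has_real_derivative_iff_has_vector_derivative)
  qed (use eq ne V that in auto)
  then show "\<And>t. t \<in> T \<Longrightarrow> (r has_real_derivative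
            vector_derivative \<alpha> (at t) / vector_derivative \<beta> (at (r t))) (at t)"
    by (simp add: D_def divide_inverse)
  have "Ck_on k r T" for k
  proof (induction k)
    case 0
    then show ?case using r by simp
  next
    case (Suc k)
    have d: "Ck_on k (\<lambda>t. vector_derivative \<beta> (at (r t))) T"
      by (rule Ck_on_real_compose[OF V(1) T smooth_onD[OF smooth_on_vector_derivative[OF V(1) sm(2)]] Suc V(2)])
    have i: "Ck_on k (\<lambda>t. inverse (vector_derivative \<beta> (at (r t)))) T"
      by (rule Ck_on_real_compose[OF _ T Ck_on_inverse d]) (use ne V in auto)
    have "Ck_on k D T"
      unfolding D_def
      by (rule Ck_on_mult[OF T smooth_onD[OF smooth_on_vector_derivative[OF T sm(1)]] i])
    then show ?case
      by (intro Ck_on_SucI[OF T, where D="\<lambda>t v. D t * v"] Ck_on_mult[OF T] Ck_on_const[OF T])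
         (use D in \<open>auto simp: has_field_derivative_def\<close>)
  qed
  then show "smooth_on r T" by (simp add: smooth_on_def)
qed

section \<open>Combinatorics of PD-codes\<close>

lemma neg_neg [simp]: "neg (neg x) = x"
  by (cases x) auto

lemma label_of_neg [simp]: "label_of (neg x) = label_of x"
  by (cases x) auto

lemma is_Plus_neg [simp]: "is_Plus (neg x) \<longleftrightarrow> \<not> is_Plus x"
  by (cases x) auto

lemma length_ends [simp]: "length (ends q) = 4"
  by (cases q) auto

lemma neg_in_signed_labels [simp]: "neg x \<in> signed_labels \<mu> n \<longleftrightarrow> x \<in> signed_labels \<mu> n"
  by (cases x) (auto simp: signed_labels_def)

lemma signed_labels_iff: "x \<in> signed_labels \<mu> n \<longleftrightarrow> label_of x \<in> labels \<mu> n"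
  by (cases x) (auto simp: signed_labels_def)

lemma finite_labels [simp]: "finite (labels \<mu> n)"
  by (auto simp: labels_def)

lemma finite_signed_labels [simp]: "finite (signed_labels \<mu> n)"
  by (auto simp: signed_labels_def)

lemma count_sum_mset_ends_ge_two:
  assumes "q \<in># C" "q' \<in># C - {#q#}" "x \<in> set (ends q)" "x \<in> set (ends q')"
  shows "2 \<le> count (\<Sum>q\<in>#C. mset (ends q)) x"
proof -
  obtain B where B: "C = add_mset q (add_mset q' B)"
    using assms(1,2) by (metis insert_DiffM)
  have "1 \<le> count (mset (ends q)) x" "1 \<le> count (mset (ends q')) x"
    using assms(3,4) by (auto simp: Suc_le_eq)
  moreover have "count (\<Sum>q\<in>#C. mset (ends q)) x =
      count (mset (ends q)) x + (count (mset (ends q')) x + count (\<Sum>q\<in>#B. mset (ends q)) x)"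
    by (simp add: B)
  ultimately show ?thesis by linarith
qed

locale pd =
  fixes \<mu> :: nat and n :: "nat \<Rightarrow> nat" and C :: "quad multiset"
  assumes code: "pd_code \<mu> n C"
begin

abbreviation "L \<equiv> labels \<mu> n"
abbreviation "SL \<equiv> signed_labels \<mu> n"
abbreviation "\<tau> \<equiv> turn C 1"
abbreviation "f \<equiv> face_succ C"

lemma n_pos: "c \<in> {1..\<mu>} \<Longrightarrow> 1 \<le> n c"
  using code by (auto simp: pd_code_def)

lemma sum_ends: "(\<Sum>q\<in>#C. mset (ends q)) = mset_set SL"
  using code by (auto simp: pd_code_def)

lemma quad:
  assumes "q \<in># C"
  shows "length (filter is_Plus (ends q)) = 2" "is_Plus (ends q ! 0)"
    "consecutive_pair n (ends q ! 0) (ends q ! 2)" "consecutive_pair n (ends q ! 1) (ends q ! 3)"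
  using code assms by (auto simp: pd_code_def)

lemma ends_in_SL:
  assumes "q \<in># C" "j < 4"
  shows "ends q ! j \<in> SL"
proof -
  have "ends q ! j \<in># mset (ends q)" using assms by simp
  then have "ends q ! j \<in># (\<Sum>q\<in>#C. mset (ends q))"
    using assms(1) by (auto simp: in_Union_mset_iff)
  then show ?thesis by (simp add: sum_ends)
qed

text \<open>A signed label at two different places would be counted twice in the union of all
  quadruples, in which it has multiplicity one.\<close>

lemma location_unique:
  assumes "q \<in># C" "i < 4" "q' \<in># C" "j < 4" "ends q ! i = ends q' ! j"
  shows "q = q' \<and> i = j"
proof -
  let ?x = "ends q ! i"
  have x: "?x \<in> set (ends q)" "?x \<in> set (ends q')"
    using nth_mem[of i "ends q"] nth_mem[of j "ends q'"] assms by simp_all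
  have one: "count (\<Sum>q\<in>#C. mset (ends q)) ?x \<le> 1"
    by (simp add: sum_ends count_mset_set')
  have q: "q = q'"
  proof (rule ccontr)
    assume "q \<noteq> q'"
    then have "q' \<in># C - {#q#}" using assms(3) by (simp add: in_diff_count)
    then have "2 \<le> count (\<Sum>q\<in>#C. mset (ends q)) ?x"
      using count_sum_mset_ends_ge_two[OF assms(1) _ x] by blast
    then show False using one by simp
  qed
  have "mset (ends q) \<subseteq># (\<Sum>q\<in>#C. mset (ends q))"
    using multi_member_split[OF assms(1)] by auto
  then have le: "count (mset (ends q)) ?x \<le> 1"
    using one mset_subset_eq_count[of "mset (ends q)" _ ?x] by (meson le_trans)
  have "i = j"
  proof (rule ccontr)
    assume ne: "i \<noteq> j"
    have "{i, j} \<subseteq> {k. k < length (ends q) \<and> ?x = ends q ! k}"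
      using assms(2,4,5) q by auto
    then have "card {i, j} \<le> card {k. k < length (ends q) \<and> ?x = ends q ! k}"
      by (rule card_mono[rotated]) simp
    also have "\<dots> = count (mset (ends q)) ?x"
      by (simp only: count_mset count_list_eq_length_filter length_filter_conv_card)
    finally show False
      using le ne by simp
  qed
  then show ?thesis using q by simp
qed

lemma location_ex1:
  assumes "x \<in> SL"
  shows "\<exists>!p. fst p \<in># C \<and> snd p < 4 \<and> ends (fst p) ! snd p = x"
proof -
  have "x \<in># (\<Sum>q\<in>#C. mset (ends q))" using assms by (simp add: sum_ends)
  then obtain q where q: "q \<in># C" "x \<in> set (ends q)"
    by (auto simp: in_Union_mset_iff)
  then obtain i where i: "i < 4" "ends q ! i = x"
    by (auto simp: in_set_conv_nth)
  show ?thesis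
  proof (rule ex1I[of _ "(q, i)"])
    fix p assume "fst p \<in># C \<and> snd p < 4 \<and> ends (fst p) ! snd p = x"
    then show "p = (q, i)"
      using location_unique[of "fst p" "snd p" q i] q i by (auto simp: prod_eq_iff)
  qed (use q i in auto)
qed

lemma location_ends:
  assumes "q \<in># C" "j < 4"
  shows "location C (ends q ! j) = (q, j)"
  unfolding location_def
  by (rule the1_equality[OF location_ex1[OF ends_in_SL[OF assms]]]) (use assms in auto)

lemma SL_cases:
  assumes "x \<in> SL"
  obtains q j where "q \<in># C" "j < 4" "x = ends q ! j" "location C x = (q, j)"
  using location_ex1[OF assms] location_ends by (metis (no_types, lifting))

lemma turn_ends: "q \<in># C \<Longrightarrow> j < 4 \<Longrightarrow> turn C i (ends q ! j) = ends q ! ((j + i) mod 4)"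
  by (simp add: turn_def location_ends)

lemma vertex_of_ends: "q \<in># C \<Longrightarrow> j < 4 \<Longrightarrow> vertex_of C (ends q ! j) = q"
  by (simp add: vertex_of_def location_ends)

lemma turn_in [simp]: "x \<in> SL \<Longrightarrow> turn C i x \<in> SL"
  by (erule SL_cases) (auto simp: turn_ends intro!: ends_in_SL)

text \<open>The four ends at a vertex are permuted simply transitively by the integers modulo 4,
  acting by \<open>turn C\<close>.\<close>

lemma turn_turn: "x \<in> SL \<Longrightarrow> turn C i (turn C j x) = turn C (i + j) x"
  by (erule SL_cases) (simp add: turn_ends mod_simps ac_simps)

lemma turn_mod: "x \<in> SL \<Longrightarrow> turn C (i mod 4) x = turn C i x"
  by (erule SL_cases) (simp add: turn_ends mod_add_right_eq)

lemma turn_0 [simp]: "x \<in> SL \<Longrightarrow> turn C 0 x = x"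
  by (erule SL_cases) (simp add: turn_ends)

lemma turn_4 [simp]: "x \<in> SL \<Longrightarrow> turn C 4 x = x"
  by (erule SL_cases) (simp add: turn_ends)

lemma vertex_of_turn [simp]: "x \<in> SL \<Longrightarrow> vertex_of C (turn C i x) = vertex_of C x"
  by (erule SL_cases) (simp add: turn_ends vertex_of_ends)

lemma turn_inj:
  assumes "x \<in> SL" "turn C i x = turn C j x"
  shows "i mod 4 = j mod 4"
proof -
  obtain q k where q: "q \<in># C" "k < 4" "x = ends q ! k"
    using SL_cases[OF assms(1)] by metis
  then have "(k + i) mod 4 = (k + j) mod 4"
    using location_unique[of q "(k + i) mod 4" q "(k + j) mod 4"] assms(2) by (simp add: turn_ends)
  then have "((k + i) mod 4 + (4 - k)) mod 4 = ((k + j) mod 4 + (4 - k)) mod 4" by simp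
  moreover have "(k + i) + (4 - k) = i + 4" "(k + j) + (4 - k) = j + 4" using q(2) by simp_all
  ultimately show ?thesis by (metis mod_add_left_eq mod_add_self2)
qed

lemma same_vertex:
  assumes "x \<in> SL" "y \<in> SL" "vertex_of C x = vertex_of C y"
  shows "\<exists>i<4. y = turn C i x"
proof -
  obtain q k where q: "q \<in># C" "k < 4" "x = ends q ! k"
    using SL_cases[OF assms(1)] by metis
  obtain q' k' where q': "q' \<in># C" "k' < 4" "y = ends q' ! k'"
    using SL_cases[OF assms(2)] by metis
  have "q = q'" using assms q q' by (simp add: vertex_of_ends)
  then have "y = turn C ((k' + (4 - k)) mod 4) x"
    using q q' by (simp add: turn_ends mod_simps)
  then show ?thesis by (metis mod_less_divisor zero_less_numeral)
qed

lemma consecutive_pair_Plus: "consecutive_pair n (Plus l) y \<longleftrightarrow> y = Minus (next_label n l)"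
  by (auto simp: consecutive_pair_def)

lemma consecutive_pair_sym: "consecutive_pair n x y \<longleftrightarrow> consecutive_pair n y x"
  by (auto simp: consecutive_pair_def)

text \<open>The condition on opposite entries is symmetric, so it holds from whichever of the
  four places one starts.\<close>

lemma opposite_ends:
  assumes "x \<in> SL"
  shows "consecutive_pair n x (turn C 2 x)"
proof -
  obtain q k where q: "q \<in># C" "k < 4" "x = ends q ! k"
    using SL_cases[OF assms(1)] by metis
  have mods: "(0 + 2) mod 4 = (2::nat)" "(1 + 2) mod 4 = (3::nat)" "(2 + 2) mod 4 = (0::nat)"
    "(3 + 2) mod 4 = (1::nat)"
    by simp_all
  have sym: "consecutive_pair n (ends q ! 2) (ends q ! 0)" "consecutive_pair n (ends q ! 3) (ends q ! 1)"
    using quad(3,4)[OF q(1)] consecutive_pair_sym by blast+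
  have "turn C 2 x = ends q ! ((k + 2) mod 4)"
    using q turn_ends by simp
  moreover from \<open>k < 4\<close> have "k = 0 \<or> k = 1 \<or> k = 2 \<or> k = 3" by linarith
  ultimately show ?thesis
    unfolding q(3) by (elim disjE; simp only: mods quad(3,4)[OF q(1)] sym)
qed

lemma turn2_Plus: "l \<in> L \<Longrightarrow> turn C 2 (Plus l) = Minus (next_label n l)"
  using opposite_ends[of "Plus l"] by (simp add: signed_labels_iff consecutive_pair_Plus)

lemma next_label_in: "l \<in> L \<Longrightarrow> next_label n l \<in> L"
  using turn2_Plus[of l] turn_in[of "Plus l" 2] by (simp add: signed_labels_iff)

lemma next_edge: "l \<in> L \<Longrightarrow> next_edge C l = next_label n l"
  by (simp add: next_edge_def turn2_Plus)

lemma next_edge_funpow: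
  assumes "c \<in> {1..\<mu>}"
  shows "(next_edge C ^^ k) (c, 1) = (c, k mod n c + 1)"
proof (induction k)
  case (Suc k)
  have "(c, k mod n c + 1) \<in> L"
    using assms n_pos[OF assms] by (auto simp: labels_def Suc_le_eq)
  then have "next_edge C (c, k mod n c + 1) = (c, (k mod n c + 1) mod n c + 1)"
    by (simp add: next_edge next_label_def)
  moreover have "(next_edge C ^^ Suc k) (c, 1) = next_edge C (c, k mod n c + 1)"
    by (simp only: funpow.simps o_apply Suc)
  ultimately show ?case
    by (simp add: mod_Suc_eq)
qed (use n_pos[OF assms] in simp)

lemma orbit_next_edge:
  assumes "c \<in> {1..\<mu>}"
  shows "orbit (next_edge C) (c, 1) = {c} \<times> {1..n c}"
proof -
  have "orbit (next_edge C) (c, 1) = {(c, m mod n c + 1) | m. m < n c}"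
    using orbit_altdef_bounded[of "n c" "next_edge C" "(c, 1)"] n_pos[OF assms]
    by (simp only: next_edge_funpow[OF assms]) simp
  also have "\<dots> = {c} \<times> {1..n c}"
  proof (intro set_eqI iffI)
    fix p assume "p \<in> {c} \<times> {1..n c}"
    then have "p = (c, (snd p - 1) mod n c + 1) \<and> snd p - 1 < n c" by auto
    then show "p \<in> {(c, m mod n c + 1) | m. m < n c}" by blast
  qed (auto simp: Suc_le_eq)
  finally show ?thesis .
qed

lemma opposite_sign: "x \<in> SL \<Longrightarrow> is_Plus (turn C 2 x) \<longleftrightarrow> \<not> is_Plus x"
  using opposite_ends[of x] by (auto simp: consecutive_pair_def)

lemma sign_pattern:
  assumes "q \<in># C"
  shows "sign_pattern q \<in> {[True, False, False, True], [True, True, False, False]}"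
proof -
  obtain w x y z where q: "q = (w, x, y, z)" by (cases q)
  show ?thesis
    using quad[OF assms] by (auto simp: q sign_pattern_def consecutive_pair_def)
qed

lemma f_in [simp]: "x \<in> SL \<Longrightarrow> f x \<in> SL"
  by (simp add: face_succ_def)

lemma turn_eq_neg_f: "turn C 1 x = neg (f x)"
  by (simp add: face_succ_def)

lemma f_turn3_neg [simp]: "x \<in> SL \<Longrightarrow> f (turn C 3 (neg x)) = x"
  by (simp add: face_succ_def turn_turn)

lemma bij_f: "bij_betw f SL SL"
proof (rule bij_betw_byWitness[where f'="\<lambda>x. turn C 3 (neg x)"])
  show "\<forall>x\<in>SL. turn C 3 (neg (f x)) = x"
    by (simp add: face_succ_def turn_turn)
qed auto

text \<open>On the signed labels \<open>f\<close> is a permutation of a finite set; it is extended by the identity to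
  a permutation of all ends.\<close>

lemma self_in_orbit: "x \<in> SL \<Longrightarrow> x \<in> orbit f x"
proof -
  assume x: "x \<in> SL"
  define g where "g = (\<lambda>x. if x \<in> SL then f x else x)"
  have "g permutes SL"
  proof (rule bij_imp_permutes)
    show "bij_betw g SL SL"
      using bij_betw_cong[of SL g f SL] bij_f by (auto simp: g_def)
  qed (auto simp: g_def)
  then have "permutation g" by (metis permutation_permutes finite_signed_labels)
  then have "x \<in> orbit g x" by (rule permutation_self_in_orbit)
  also have "orbit g x = orbit f x"
    by (rule orbit_cong0[of _ SL]) (use x in \<open>auto simp: g_def\<close>)
  finally show ?thesis .
qed

lemma orbit_subset_SL: "x \<in> SL \<Longrightarrow> orbit f x \<subseteq> SL"
proof
  fix y assume "x \<in> SL" "y \<in> orbit f x"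
  from this(2,1) show "y \<in> SL" by (induction rule: orbit.induct) auto
qed

lemma orbit_eq: "x \<in> SL \<Longrightarrow> y \<in> orbit f x \<Longrightarrow> orbit f y = orbit f x"
  using self_in_orbit orbit_trans orbit_swap by (metis subset_antisym subsetI)

lemma orbit_f [simp]: "x \<in> SL \<Longrightarrow> orbit f (f x) = orbit f x"
  using self_in_orbit_step self_in_orbit by metis

lemma finite_orbit_f [simp]: "x \<in> SL \<Longrightarrow> finite (orbit f x)"
  using finite_orbit self_in_orbit by metis

lemma base_choice_exists: "\<exists>b. base_choice \<mu> n C b"
proof
  show "base_choice \<mu> n C (\<lambda>F. SOME x. x \<in> F)"
    unfolding base_choice_def faces_def
    using self_in_orbit someI_ex by (metis (mono_tags, lifting) imageE)
qed

end

locale pdb = pd +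
  fixes b :: "slabel set \<Rightarrow> slabel"
  assumes base: "base_choice \<mu> n C b"
begin

text \<open>The number of sides of the polygon to which the side \<open>x\<close> belongs, and the number of the
  side \<open>x\<close> in it, counted clockwise from the base side.\<close>

definition m :: "slabel \<Rightarrow> nat" where "m x = card (orbit f x)"
definition k :: "slabel \<Rightarrow> nat" where "k x = funpow_dist f (b (orbit f x)) x"

lemma b_in: "x \<in> SL \<Longrightarrow> b (orbit f x) \<in> orbit f x"
  using base by (auto simp: base_choice_def faces_def)

lemma m_pos: "x \<in> SL \<Longrightarrow> 0 < m x"
  by (auto simp: m_def card_gt_0_iff orbit_nonempty)

text \<open>The orbit of the base side returns to it for the first time after as many steps as
  the polygon has sides, so \<open>k\<close> is the inverse of the enumeration of the sides by these steps.\<close>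

lemma face_enumeration:
  assumes "x \<in> SL"
  defines "a \<equiv> b (orbit f x)"
  shows "(f ^^ m x) a = a" "orbit f x = (\<lambda>i. (f ^^ i) a) ` {0..<m x}"
    "\<And>i. i < m x \<Longrightarrow> k ((f ^^ i) a) = i"
proof -
  have aF: "a \<in> orbit f x" using b_in[OF assms(1)] by (simp add: a_def)
  have aSL: "a \<in> SL" using aF orbit_subset_SL[OF assms(1)] by blast
  have eq: "orbit f a = orbit f x" by (rule orbit_eq[OF assms(1) aF])
  have aa: "a \<in> orbit f a" by (rule self_in_orbit[OF aSL])
  let ?M = "funpow_dist1 f a a"
  have img: "orbit f a = (\<lambda>i. (f ^^ i) a) ` {0..<?M}"
    by (rule orbit_conv_funpow_dist1[OF aa])
  have inj: "inj_on (\<lambda>i. (f ^^ i) a) {0..<?M}"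
    by (rule inj_on_funpow_dist1[OF aa])
  have M: "m x = ?M"
    unfolding m_def eq[symmetric] using img card_image[OF inj] by simp
  show "(f ^^ m x) a = a" unfolding M using funpow_dist1_prop[OF aa] .
  show "orbit f x = (\<lambda>i. (f ^^ i) a) ` {0..<m x}" unfolding M eq[symmetric] by (rule img)
  fix i assume i: "i < m x"
  have "(f ^^ i) a \<in> orbit f a" using aa by (rule funpow_in_orbit)
  then have "orbit f ((f ^^ i) a) = orbit f x" using orbit_eq[OF aSL] eq by simp
  then have k: "k ((f ^^ i) a) = funpow_dist f a ((f ^^ i) a)" by (simp add: k_def a_def)
  show "k ((f ^^ i) a) = i"
    unfolding k funpow_dist_def
  proof (rule Least_equality)
    fix j assume j: "(f ^^ j) a = (f ^^ i) a"
    show "i \<le> j"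
    proof (rule ccontr)
      assume "\<not> i \<le> j"
      then have "j = i" using inj_onD[OF inj j] i M by auto
      then show False using \<open>\<not> i \<le> j\<close> by simp
    qed
  qed simp
qed

lemma k_less: "x \<in> SL \<Longrightarrow> k x < m x"
  and funpow_k: "x \<in> SL \<Longrightarrow> (f ^^ k x) (b (orbit f x)) = x"
proof -
  assume x: "x \<in> SL"
  obtain i where "i < m x" "x = (f ^^ i) (b (orbit f x))"
    using self_in_orbit[OF x] by (subst (asm) face_enumeration(2)[OF x]) auto
  moreover from this have "k x = i"
    using face_enumeration(3)[OF x, of i] by simp
  ultimately show "k x < m x" "(f ^^ k x) (b (orbit f x)) = x"
    by simp_all
qed

lemma k_surj:
  assumes "x \<in> SL" "i < m x"
  shows "\<exists>y\<in>orbit f x. k y = i"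
  using face_enumeration(2,3)[OF assms(1)] assms(2) by fastforce

lemma k_inj: "x \<in> SL \<Longrightarrow> y \<in> SL \<Longrightarrow> orbit f x = orbit f y \<Longrightarrow> k x = k y \<Longrightarrow> x = y"
  using funpow_k by metis

lemma k_f: "x \<in> SL \<Longrightarrow> k (f x) = (k x + 1) mod m x"
proof -
  assume x: "x \<in> SL"
  let ?a = "b (orbit f x)"
  have fx: "f x = (f ^^ (k x + 1)) ?a" using funpow_k[OF x] by simp
  show ?thesis
  proof (cases "k x + 1 < m x")
    case True
    then show ?thesis using face_enumeration(3)[OF x True] by (simp only: fx[symmetric] mod_less)
  next
    case False
    then have e: "k x + 1 = m x" using k_less[OF x] by simp
    then have "f x = ?a" using fx face_enumeration(1)[OF x] by metis
    moreover have "k ?a = 0" using face_enumeration(3)[OF x, of 0] m_pos[OF x] by simp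
    ultimately show ?thesis using e by simp
  qed
qed

lemma m_cong: "orbit f x = orbit f y \<Longrightarrow> m x = m y"
  by (simp add: m_def)

end

section \<open>Polygons and their gluing\<close>

context pdb
begin

text \<open>The point of the disc with coordinate \<open>u\<close> relative to the side \<open>x\<close>.  Real \<open>u\<close> between 0 and 1
  run clockwise through the side, and the interior of the disc is \<open>Im u < 0\<close>.\<close>

definition pos :: "slabel \<Rightarrow> complex \<Rightarrow> complex" where
  "pos x u = exp (- (2 * of_real pi * \<i> * (of_nat (k x) + u) / of_nat (m x)))"

text \<open>This point as an element of the disjoint union of the polygons; \<open>pt\<close> is its image in the glued
  surface.\<close>

definition spt :: "slabel \<Rightarrow> complex \<Rightarrow> slabel set \<times> complex" where
  "spt x u = (orbit f x, pos x u)"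

abbreviation "Fs \<equiv> faces \<mu> n C"
abbreviation "Y \<equiv> polygons \<mu> n C"
abbreviation "X \<equiv> glued_surface \<mu> n C b"
abbreviation "pr \<equiv> proj \<mu> n C b"

definition pt :: "slabel \<Rightarrow> complex \<Rightarrow> point" where
  "pt x u = pr (spt x u)"

lemma norm_pos: "norm (pos x u) = exp (2 * pi * Im u / m x)"
proof -
  have "Re (- (2 * of_real pi * \<i> * (of_nat (k x) + u) / of_nat (m x))) = 2 * pi * Im u / m x"
    by (simp add: Re_divide_of_nat)
  then show ?thesis unfolding pos_def by simp
qed

lemma norm_pos_le: "x \<in> SL \<Longrightarrow> norm (pos x u) \<le> 1 \<longleftrightarrow> Im u \<le> 0"
  and norm_pos_less: "x \<in> SL \<Longrightarrow> norm (pos x u) < 1 \<longleftrightarrow> Im u < 0"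
proof -
  assume x: "x \<in> SL"
  define c where "c = 2 * pi / m x"
  have c: "0 < c" using m_pos[OF x] by (simp add: c_def)
  have "norm (pos x u) = exp (c * Im u)" by (simp add: norm_pos c_def)
  then show "norm (pos x u) \<le> 1 \<longleftrightarrow> Im u \<le> 0" "norm (pos x u) < 1 \<longleftrightarrow> Im u < 0"
    using c by (simp_all add: mult_le_0_iff mult_less_0_iff)
qed

lemma pos_holomorphic: "g holomorphic_on S \<Longrightarrow> (\<lambda>u. pos x (g u)) holomorphic_on S"
  unfolding pos_def by (cases "m x = 0") (auto intro!: holomorphic_intros)

lemma pos_eq_iff:
  assumes "m y = m x" "0 < m x"
  shows "pos x u = pos y v \<longleftrightarrow> (\<exists>j::int. of_nat (k x) + u = of_nat (k y) + v + of_int j * of_nat (m x))"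
proof -
  let ?c = "2 * of_real pi * \<i> / of_nat (m x) :: complex"
  have c: "?c \<noteq> 0" using assms by simp
  have "pos x u = pos y v \<longleftrightarrow> (\<exists>j::int. - (?c * (of_nat (k x) + u)) = - (?c * (of_nat (k y) + v)) + of_int (2 * j) * pi * \<i>)"
    unfolding pos_def assms(1) exp_eq by (simp add: field_simps)
  also have "\<dots> \<longleftrightarrow> (\<exists>j::int. ?c * (of_nat (k x) + u) = ?c * (of_nat (k y) + v + of_int (- j) * of_nat (m x)))"
  proof (rule ex_cong1)
    fix j :: int
    have "?c * (of_int (- j) * of_nat (m x)) = - (of_int (2 * j) * pi * \<i>)"
      using assms by simp
    then show "(- (?c * (of_nat (k x) + u)) = - (?c * (of_nat (k y) + v)) + of_int (2 * j) * pi * \<i>) \<longleftrightarrow>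
       (?c * (of_nat (k x) + u) = ?c * (of_nat (k y) + v + of_int (- j) * of_nat (m x)))"
      by (simp only: distrib_left[of ?c "of_nat (k y) + v"]) (auto simp: algebra_simps)
  qed
  also have "\<dots> \<longleftrightarrow> (\<exists>j::int. of_nat (k x) + u = of_nat (k y) + v + of_int (- j) * of_nat (m x))"
    using c by (simp only: mult_cancel_left) simp
  also have "\<dots> \<longleftrightarrow> (\<exists>j::int. of_nat (k x) + u = of_nat (k y) + v + of_int j * of_nat (m x))"
    by (metis add.inverse_inverse)
  finally show ?thesis .
qed

lemma spt_eq_iff:
  assumes "x \<in> SL"
  shows "spt x u = spt y v \<longleftrightarrow> orbit f x = orbit f y \<and>
    (\<exists>j::int. of_nat (k x) + u = of_nat (k y) + v + of_int j * of_nat (m x))"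
  unfolding spt_def using pos_eq_iff[of y x u v] m_pos[OF assms] by (auto simp: m_def)

text \<open>The side \<open>f x\<close> begins where the side \<open>x\<close> ends.\<close>

lemma spt_Suc:
  assumes "x \<in> SL"
  shows "spt x (1 + u) = spt (f x) u"
proof -
  have "int (k x + 1) = int (k (f x)) + int ((k x + 1) div m x) * int (m x)"
    unfolding k_f[OF assms] by (metis mod_div_mult_eq of_nat_add of_nat_mult)
  then have "(of_int (int (k x + 1)) :: complex) =
      of_int (int (k (f x)) + int ((k x + 1) div m x) * int (m x))"
    by (simp only:)
  then have "of_nat (k x) + (1 + u) = of_nat (k (f x)) + u + of_int (int ((k x + 1) div m x)) * of_nat (m x)"
    by (simp add: algebra_simps)
  then show ?thesis unfolding spt_eq_iff[OF assms] orbit_f[OF assms] by blast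
qed

text \<open>Two coordinates of the same point, relative to sides of the same polygon, differ by an
  integer; if that integer is 0, the numbers of the sides agree modulo \<open>m\<close>.\<close>

lemma spt_inj_Re:
  assumes "x \<in> SL" "y \<in> SL" "spt x u = spt y v" "\<bar>Re (u - v)\<bar> < 1"
  shows "x = y \<and> u = v"
proof -
  obtain j :: int where j: "orbit f x = orbit f y"
    "of_nat (k x) + u = of_nat (k y) + v + of_int j * of_nat (m x)"
    using assms(3) spt_eq_iff[OF assms(1)] by blast
  have uv: "u - v = of_int (int (k y) - int (k x) + j * int (m x))"
    using j(2) by (simp add: algebra_simps)
  then have "\<bar>real_of_int (int (k y) - int (k x) + j * int (m x))\<bar> < 1"
    using assms(4) by (metis Re_complex_of_real of_real_of_int_eq)
  then have e: "int (k y) - int (k x) + j * int (m x) = 0" by linarith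
  then have uv: "u = v" using uv by simp
  have "int (k x) = int (k y) + j * int (m x)" using e by linarith
  then have "int (k x) mod int (m x) = int (k y) mod int (m x)" by simp
  then have "k x = k y"
    using k_less[OF assms(1)] k_less[OF assms(2)] m_cong[OF j(1)] by simp
  then show ?thesis using k_inj[OF assms(1,2) j(1)] uv by blast
qed

lemma spt_inj:
  assumes "x \<in> SL" "y \<in> SL" "spt x u = spt y v" "norm (u - v) < 1"
  shows "x = y \<and> u = v"
  using spt_inj_Re[OF assms(1,2,3)] abs_Re_le_cmod[of "u - v"] assms(4) by linarith

lemma side_eq:
  fixes u v :: real
  assumes "x \<in> SL" "y \<in> SL" "spt x u = spt y v" "u \<in> {0..1}" "v \<in> {0..1}"
  shows "(x = y \<and> u = v) \<or> (x = f y \<and> u = 0 \<and> v = 1) \<or> (y = f x \<and> u = 1 \<and> v = 0)"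
proof -
  have nrm: "norm (complex_of_real u - of_real v) = \<bar>u - v\<bar>" by (metis norm_of_real of_real_diff)
  consider "\<bar>u - v\<bar> < 1" | "u = 0" "v = 1" | "u = 1" "v = 0"
    using assms(4,5) by fastforce
  then show ?thesis
  proof cases
    case 1
    then show ?thesis using spt_inj[OF assms(1,2,3)] nrm by simp
  next
    case 2
    then have "spt x 0 = spt (f y) 0"
      using assms(3) spt_Suc[OF assms(2), of 0] by simp
    then show ?thesis using spt_inj[OF assms(1) f_in[OF assms(2)]] 2 by simp
  next
    case 3
    then have "spt (f x) 0 = spt y 0"
      using assms(3) spt_Suc[OF assms(1), of 0] by simp
    then have "f x = y" using spt_inj[OF f_in[OF assms(1)] assms(2), of 0 0] by simp
    then show ?thesis using 3 by simp
  qed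
qed

text \<open>A logarithm of \<open>z\<close> is a coordinate relative to the base side, and the integral part of its real
  part, taken modulo \<open>m\<close>, is the number of the side to choose.\<close>

lemma pos_surj:
  assumes "x \<in> SL" "z \<noteq> 0"
  shows "\<exists>y\<in>orbit f x. \<exists>u. 0 \<le> Re u \<and> Re u < 1 \<and> (orbit f x, z) = spt y u"
proof -
  define s where "s = Ln z * of_nat (m x) / (- (2 * of_real pi * \<i>))"
  have mx: "0 < m x" by (rule m_pos[OF assms(1)])
  have z: "z = exp (- (2 * of_real pi * \<i> * s / of_nat (m x)))"
    using mx assms(2) by (simp add: s_def)
  define p where "p = \<lfloor>Re s\<rfloor>"
  define i where "i = nat (p mod int (m x))"
  have "i < m x" using mx by (simp add: i_def nat_less_iff)
  then obtain y where y: "y \<in> orbit f x" "k y = i" using k_surj[OF assms(1)] by blast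
  have my: "m y = m x" using orbit_eq[OF assms(1) y(1)] by (rule m_cong)
  have "int i = p - int (m x) * (p div int (m x))"
    using mx by (simp add: i_def minus_mult_div_eq_mod)
  then have i: "(of_nat i :: complex) = of_int p - of_nat (m x) * of_int (p div int (m x))"
    by (metis of_int_diff of_int_mult of_int_of_nat_eq)
  have "z = pos y (s - of_int p)"
  proof -
    have "- (2 * of_real pi * \<i> * s / of_nat (m x)) =
        - (2 * of_real pi * \<i> * (of_nat i + (s - of_int p)) / of_nat (m x)) +
          (of_int (2 * (- (p div int (m x)))) * pi) * \<i>"
      unfolding i using mx by (simp add: field_simps)
    then show ?thesis unfolding pos_def my y(2) by (subst z) (use exp_eq in blast)
  qed
  moreover have "0 \<le> Re (s - of_int p)" "Re (s - of_int p) < 1"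
    by (simp_all add: p_def) linarith
  ultimately show ?thesis
    using y(1) orbit_eq[OF assms(1) y(1)]
    by (intro bexI[of _ y] exI[of _ "s - of_int p"]) (simp_all add: spt_def)
qed

section \<open>The gluing relation\<close>

text \<open>The identifications in both directions.  The coordinate of a positive side is the
  parameter of the side and that of a negative side is 1 minus the parameter, so one formula serves
  both signs.\<close>

definition Rg :: "((slabel set \<times> complex) \<times> (slabel set \<times> complex)) set" where
  "Rg = {(spt x (of_real u), spt (neg x) (of_real (1 - u))) | x u. x \<in> SL \<and> 0 \<le> u \<and> u \<le> 1}"

lemma side_eq_spt: "side C b x t = spt x (of_real (if is_Plus x then t else 1 - t))"
  by (simp add: side_def Let_def spt_def pos_def k_def m_def cis_conv_exp algebra_simps)

lemma RgI: "x \<in> SL \<Longrightarrow> 0 \<le> u \<Longrightarrow> u \<le> 1 \<Longrightarrow> (spt x (of_real u), spt (neg x) (of_real (1 - u))) \<in> Rg"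
  unfolding Rg_def by blast

lemma glue_eq: "glue \<mu> n C b = Rg\<^sup>*"
proof -
  define R where "R = {(side C b (Plus l) t, side C b (Minus l) t) | l t. l \<in> L \<and> 0 \<le> t \<and> t \<le> 1}"
  have "R \<union> R\<inverse> = Rg"
  proof (intro set_eqI iffI)
    fix p assume "p \<in> R \<union> R\<inverse>"
    then consider "p \<in> R" | "(snd p, fst p) \<in> R" by (cases p) auto
    then show "p \<in> Rg"
    proof cases
      case 1
      then obtain l t where "p = (spt (Plus l) (of_real t), spt (neg (Plus l)) (of_real (1 - t)))"
        "l \<in> L" "0 \<le> t" "t \<le> 1"
        by (auto simp: R_def side_eq_spt)
      then show ?thesis using RgI[of "Plus l" t] by (simp add: signed_labels_iff)
    next
      case 2
      then obtain l t where lt: "p = (spt (Minus l) (of_real (1 - t)), spt (neg (Minus l)) (of_real (1 - (1 - t))))"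
        "l \<in> L" "0 \<le> t" "t \<le> 1"
        by (cases p) (auto simp: R_def side_eq_spt)
      show ?thesis using RgI[of "Minus l" "1 - t"] lt by (simp add: signed_labels_iff)
    qed
  next
    fix p assume "p \<in> Rg"
    then obtain x u where p: "p = (spt x (of_real u), spt (neg x) (of_real (1 - u)))" and
      x: "x \<in> SL" "0 \<le> u" "u \<le> 1" by (auto simp: Rg_def)
    show "p \<in> R \<union> R\<inverse>"
    proof (cases x)
      case (Plus l)
      have "(side C b (Plus l) u, side C b (Minus l) u) \<in> R"
        using x unfolding R_def Plus signed_labels_iff slabel.sel by blast
      then show ?thesis by (simp add: p Plus side_eq_spt)
    next
      case (Minus l)
      have "l \<in> L" "0 \<le> 1 - u" "1 - u \<le> 1"
        using x unfolding Minus signed_labels_iff by simp_all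
      then have "(side C b (Plus l) (1 - u), side C b (Minus l) (1 - u)) \<in> R"
        unfolding R_def by blast
      then show ?thesis by (simp add: p Minus side_eq_spt)
    qed
  qed
  then show ?thesis by (simp add: glue_def R_def Let_def)
qed

lemma sym_Rg: "sym Rg"
proof (rule symI)
  fix p q assume "(p, q) \<in> Rg"
  then obtain x u where "p = spt x (of_real u)" "q = spt (neg x) (of_real (1 - u))" "x \<in> SL" "0 \<le> u" "u \<le> 1"
    by (auto simp: Rg_def)
  then show "(q, p) \<in> Rg" using RgI[of "neg x" "1 - u"] by simp
qed

lemma sym_glue: "(p, q) \<in> Rg\<^sup>* \<Longrightarrow> (q, p) \<in> Rg\<^sup>*"
  using sym_rtrancl[OF sym_Rg] by (rule symD)

lemma proj_eq_iff: "pr p = pr q \<longleftrightarrow> (p, q) \<in> Rg\<^sup>*"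
proof
  assume "pr p = pr q"
  then have "q \<in> Rg\<^sup>* `` {p}" unfolding proj_def glue_eq by blast
  then show "(p, q) \<in> Rg\<^sup>*" by blast
next
  assume pq: "(p, q) \<in> Rg\<^sup>*"
  show "pr p = pr q"
    unfolding proj_def glue_eq
    using rtrancl_trans[OF pq] rtrancl_trans[OF sym_glue[OF pq]] by blast
qed

lemma pt_glue: "x \<in> SL \<Longrightarrow> 0 \<le> u \<Longrightarrow> u \<le> 1 \<Longrightarrow> pt x (of_real u) = pt (neg x) (of_real (1 - u))"
  unfolding pt_def proj_eq_iff using RgI by blast

lemma pt_Suc: "x \<in> SL \<Longrightarrow> pt x (1 + u) = pt (f x) u"
  by (simp add: pt_def spt_Suc)

text \<open>Crossing the edge end \<open>\<tau> x\<close> counterclockwise at its vertex: the corner between \<open>x\<close> and \<open>\<tau> x\<close>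
  lies around the coordinate 1 of \<open>x\<close>, and beyond 1 runs the side \<open>f x\<close>, which is glued to
  the side \<open>\<tau> x\<close>.\<close>

lemma pt_turn:
  assumes "x \<in> SL" "0 \<le> v" "v \<le> 1"
  shows "pt (\<tau> x) (of_real (1 - v)) = pt x (1 + of_real v)"
proof -
  have "pt x (1 + of_real v) = pt (neg (f x)) (of_real (1 - v))"
    using pt_Suc[OF assms(1)] pt_glue[of "f x" v] assms by simp
  then show ?thesis by (simp only: turn_eq_neg_f)
qed

lemma pt_corner: "x \<in> SL \<Longrightarrow> pt (turn C i x) 1 = pt x 1"
proof (induction i)
  case (Suc i)
  have "turn C (Suc i) x = \<tau> (turn C i x)" using turn_turn[of x 1 i] Suc.prems by simp
  then show ?case using Suc pt_turn[of "turn C i x" 0] by simp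
qed simp

definition corner_rel :: "((slabel set \<times> complex) \<times> (slabel set \<times> complex)) set" where
  "corner_rel = {(spt x 1, spt (turn C i x) 1) | x i. x \<in> SL}"

lemma Rg_corner:
  assumes "x \<in> SL" "(spt x 1, p) \<in> Rg"
  shows "\<exists>i. p = spt (turn C i x) 1"
proof -
  obtain y u where y: "spt x 1 = spt y (of_real u)" "p = spt (neg y) (of_real (1 - u))" "y \<in> SL" "0 \<le> u" "u \<le> 1"
    using assms(2) by (auto simp: Rg_def)
  then consider "x = y" "u = 1" | "y = f x" "u = 0"
    using side_eq[OF assms(1) y(3), of 1 u] by auto
  then show ?thesis
  proof cases
    case 1
    have "f (turn C 3 x) = neg x" using f_turn3_neg[of "neg x"] assms(1) by simp
    then have "p = spt (turn C 3 x) 1"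
      using y(2) 1 spt_Suc[of "turn C 3 x" 0] assms(1) by simp
    then show ?thesis by blast
  next
    case 2
    then have "p = spt (\<tau> x) 1" using y(2) unfolding turn_eq_neg_f by simp
    then show ?thesis by blast
  qed
qed

lemma Rg_inner:
  assumes "x \<in> SL" "0 < t" "t < 1" "(spt x (of_real t), p) \<in> Rg"
  shows "p = spt (neg x) (of_real (1 - t))"
proof -
  obtain y u where y: "spt x (of_real t) = spt y (of_real u)" "p = spt (neg y) (of_real (1 - u))" "y \<in> SL" "0 \<le> u" "u \<le> 1"
    using assms(4) by (auto simp: Rg_def)
  then show ?thesis
    using side_eq[OF assms(1) y(3) y(1)] assms(2,3) by auto
qed

lemma Rg_cases:
  assumes "(p, q) \<in> Rg"
  obtains (inner) x t where "x \<in> SL" "0 < t" "t < 1" "p = spt x (of_real t)" "q = spt (neg x) (of_real (1 - t))"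
  | (corner) x i where "x \<in> SL" "p = spt x 1" "q = spt (turn C i x) 1"
proof -
  obtain x u where x: "x \<in> SL" "0 \<le> u" "u \<le> 1" "p = spt x (of_real u)" "q = spt (neg x) (of_real (1 - u))"
    using assms by (auto simp: Rg_def)
  consider "0 < u" "u < 1" | "u = 0" | "u = 1" using x by linarith
  then show thesis
  proof cases
    case 1
    then show ?thesis using x inner by blast
  next
    case 2
    have "f (turn C 3 (neg x)) = x" using x(1) by simp
    then have "p = spt (turn C 3 (neg x)) 1"
      using spt_Suc[of "turn C 3 (neg x)" 0] x 2 by simp
    moreover have "turn C 3 (neg x) \<in> SL" using x(1) by simp
    ultimately show ?thesis
      using corner Rg_corner assms by metis
  next
    case 3
    then have "p = spt x 1" using x by simp
    then show ?thesis using corner Rg_corner assms x(1) by metis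
  qed
qed

text \<open>An inner point of a side is glued only to the one point opposite to it, and a corner
  only to corners of the same vertex.  So composing identifications yields nothing beyond these
  pairs.\<close>

lemma glue_subset: "Rg\<^sup>* \<subseteq> Id \<union> Rg \<union> corner_rel"
proof
  fix pq assume "pq \<in> Rg\<^sup>*"
  moreover obtain p q where "pq = (p, q)" by (cases pq)
  ultimately have "(p, q) \<in> Rg\<^sup>*" by simp
  then have "(p, q) \<in> Id \<union> Rg \<union> corner_rel"
  proof (induction rule: rtrancl_induct)
    case (step q q')
    have c: "(p, q') \<in> corner_rel" if xpi: "x \<in> SL" "p = spt x 1" "q = spt (turn C i x) 1" for x i
    proof -
      obtain j where "q' = spt (turn C j (turn C i x)) 1"
        using Rg_corner[of "turn C i x" q'] step.hyps(2)[unfolded xpi(3)] xpi(1) by auto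
      then have "q' = spt (turn C (j + i) x) 1" using turn_turn[OF xpi(1)] by simp
      then show ?thesis unfolding corner_rel_def using xpi by blast
    qed
    from step.IH consider "p = q" | "(p, q) \<in> Rg" | "(p, q) \<in> corner_rel" by blast
    then show ?case
    proof cases
      case 1
      then show ?thesis using step.hyps(2) by simp
    next
      case 2
      then show ?thesis
      proof (cases rule: Rg_cases)
        case (inner x t)
        then have "q' = p"
          using Rg_inner[of "neg x" "1 - t" q'] step.hyps(2) by simp
        then show ?thesis by simp
      next
        case (corner x i)
        then show ?thesis using c by blast
      qed
    next
      case 3
      then show ?thesis using c by (auto simp: corner_rel_def)
    qed
  qed simp
  then show "pq \<in> Id \<union> Rg \<union> corner_rel" using \<open>pq = (p, q)\<close> by simp
qed

section \<open>The embedded graph\<close>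

lemma end_point_eq: "x \<in> SL \<Longrightarrow> end_point \<mu> n C b x = pt x 1"
  using pt_glue[of x 1] by (cases x) (auto simp: edge_path_def side_eq_spt pt_def pt_glue)

lemma edge_path_eq: "edge_path \<mu> n C b l t = pt (Plus l) (of_real t)"
  by (simp add: edge_path_def side_eq_spt pt_def)

lemma pt_corner_eq_iff:
  assumes "x \<in> SL" "y \<in> SL"
  shows "pt x 1 = pt y 1 \<longleftrightarrow> vertex_of C x = vertex_of C y"
proof
  assume "pt x 1 = pt y 1"
  then have "(spt x 1, spt y 1) \<in> Id \<union> Rg \<union> corner_rel"
    using glue_subset by (auto simp: pt_def proj_eq_iff)
  moreover have *: "vertex_of C x = vertex_of C y" if "spt y 1 = spt (turn C i x) 1" for i
    using spt_inj[of y "turn C i x" 1 1] that assms by auto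
  ultimately consider "spt x 1 = spt y 1" | "(spt x 1, spt y 1) \<in> Rg" | "(spt x 1, spt y 1) \<in> corner_rel" by blast
  then show "vertex_of C x = vertex_of C y"
  proof cases
    case 1
    then show ?thesis using spt_inj[of x y 1 1] assms by simp
  next
    case 2
    then show ?thesis using Rg_corner[OF assms(1)] * by blast
  next
    case 3
    then obtain z i where z: "z \<in> SL" "spt x 1 = spt z 1" "spt y 1 = spt (turn C i z) 1"
      by (auto simp: corner_rel_def)
    then have "x = z" using spt_inj[of x z 1 1] assms by simp
    then show ?thesis using z * by blast
  qed
next
  assume "vertex_of C x = vertex_of C y"
  then obtain i where "y = turn C i x" using same_vertex[OF assms] by blast
  then show "pt x 1 = pt y 1" using pt_corner assms by simp
qed

lemma norm_of_real_diff: "norm (complex_of_real s - complex_of_real t) = \<bar>s - t\<bar>"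
  by (metis norm_of_real of_real_diff)

lemma edge_neq_corner:
  assumes "l \<in> L" "0 < t" "t < 1" "x \<in> SL"
  shows "pt (Plus l) (of_real t) \<noteq> pt x 1"
proof
  have l: "Plus l \<in> SL" "Minus l \<in> SL" using assms(1) by (auto simp: signed_labels_iff)
  assume "pt (Plus l) (of_real t) = pt x 1"
  then have "(spt (Plus l) (of_real t), spt x 1) \<in> Id \<union> Rg \<union> corner_rel"
    using glue_subset by (auto simp: pt_def proj_eq_iff)
  moreover have no: "spt y (of_real s) \<noteq> spt z 1" if "y \<in> SL" "z \<in> SL" "0 < s" "s < 1" for y z and s :: real
    using spt_inj[OF that(1,2), of "of_real s" 1] that norm_of_real_diff[of s 1] by auto
  ultimately consider "(spt (Plus l) (of_real t), spt x 1) \<in> Rg" | "(spt (Plus l) (of_real t), spt x 1) \<in> corner_rel"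
    using l assms by blast
  then show False
  proof cases
    case 1
    then have "spt (Minus l) (of_real (1 - t)) = spt x 1"
      using Rg_inner[OF l(1) assms(2,3)] by simp
    then show False using no[OF l(2) assms(4), of "1 - t"] assms by simp
  next
    case 2
    then show False using no[OF l(1)] assms by (auto simp: corner_rel_def)
  qed
qed

lemma edge_inj:
  assumes "l \<in> L" "0 < t" "t < 1" "l' \<in> L" "0 < t'" "t' < 1"
    "pt (Plus l) (of_real t) = pt (Plus l') (of_real t')"
  shows "l = l' \<and> t = t'"
proof -
  have l: "Plus l \<in> SL" "Minus l \<in> SL" "Plus l' \<in> SL" using assms by (auto simp: signed_labels_iff)
  have "(spt (Plus l) (of_real t), spt (Plus l') (of_real t')) \<in> Id \<union> Rg \<union> corner_rel"
    using glue_subset assms(7) by (auto simp: pt_def proj_eq_iff)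
  then consider "spt (Plus l) (of_real t) = spt (Plus l') (of_real t')"
    | "(spt (Plus l) (of_real t), spt (Plus l') (of_real t')) \<in> Rg"
    | "(spt (Plus l) (of_real t), spt (Plus l') (of_real t')) \<in> corner_rel" by blast
  then show ?thesis
  proof cases
    case 1
    then show ?thesis
      using spt_inj[OF l(1,3) 1] norm_of_real_diff[of t t'] assms by auto
  next
    case 2
    then have "spt (Minus l) (of_real (1 - t)) = spt (Plus l') (of_real t')"
      using Rg_inner[OF l(1) assms(2,3)] by simp
    then show ?thesis
      using side_eq[OF l(2,3), of "1 - t" t'] assms(2,3,5,6) by auto
  next
    case 3
    then obtain z where z: "z \<in> SL" "spt (Plus l) (of_real t) = spt z (of_real 1)"
      by (auto simp: corner_rel_def)
    then show ?thesis using side_eq[OF l(1) z(1), of t 1] assms(2,3) by auto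
  qed
qed

lemma graph_embedded: "graph_embedded \<mu> n C b"
  unfolding graph_embedded_def
proof (intro conjI ballI)
  show "inj_on (\<lambda>(l, t). edge_path \<mu> n C b l t) (L \<times> {0<..<1})"
    by (rule inj_onI) (auto simp: edge_path_eq dest: edge_inj)
qed (auto simp: end_point_eq edge_path_eq pt_corner_eq_iff edge_neq_corner)

section \<open>Topology of the glued surface\<close>

lemma finite_faces [simp]: "finite Fs"
  by (simp add: faces_def)

lemma face_in [simp]: "x \<in> SL \<Longrightarrow> orbit f x \<in> Fs"
  by (simp add: faces_def)

lemma topspace_Y: "topspace Y = Fs \<times> cball 0 1"
  by (auto simp: polygons_def)

lemma openin_Y: "openin Y U \<longleftrightarrow> U \<subseteq> Fs \<times> cball 0 1 \<and> (\<forall>F\<in>Fs. openin (top_of_set (cball 0 1)) {z. (F, z) \<in> U})"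
  unfolding polygons_def openin_sum_topology by (auto simp: o_def)

lemma quotient_map_pr: "quotient_map Y X pr"
  unfolding glued_surface_def by (rule quotient_map_quotient_topology)

lemma topspace_X: "topspace X = pr ` (Fs \<times> cball 0 1)"
  using quotient_map_pr topspace_Y by (simp add: quotient_map_def)

lemma continuous_pr: "continuous_map Y X pr"
  by (rule quotient_imp_continuous_map[OF quotient_map_pr])

lemma openin_X: "openin X U \<longleftrightarrow> U \<subseteq> topspace X \<and>
    (\<forall>F\<in>Fs. openin (top_of_set (cball 0 1)) {z \<in> cball 0 1. pr (F, z) \<in> U})"
proof (cases "U \<subseteq> topspace X")
  case True
  have "openin X U \<longleftrightarrow> openin Y {p \<in> topspace Y. pr p \<in> U}"
    using quotient_map_pr True by (simp add: quotient_map_def)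
  also have "\<dots> \<longleftrightarrow> (\<forall>F\<in>Fs. openin (top_of_set (cball 0 1)) {z. (F, z) \<in> {p \<in> topspace Y. pr p \<in> U}})"
    unfolding openin_Y by (auto simp: topspace_Y)
  also have "\<dots> \<longleftrightarrow> (\<forall>F\<in>Fs. openin (top_of_set (cball 0 1)) {z \<in> cball 0 1. pr (F, z) \<in> U})"
    by (rule ball_cong) (auto simp: topspace_Y)
  finally show ?thesis using True by simp
next
  case False
  then show ?thesis using openin_subset by blast
qed

lemma continuous_map_face:
  "F \<in> Fs \<Longrightarrow> continuous_map (top_of_set (cball 0 1)) Y (\<lambda>z. (F, z))"
  unfolding polygons_def by (rule continuous_map_component_injection)

lemma continuous_map_spt:
  assumes "x \<in> SL" "continuous_on S g" "\<And>s. s \<in> S \<Longrightarrow> Im (g s) \<le> 0"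
  shows "continuous_map (top_of_set S) Y (\<lambda>s. spt x (g s))"
proof -
  have "continuous_on S (\<lambda>s. pos x (g s))"
    unfolding pos_def using m_pos[OF assms(1)] by (auto intro!: continuous_intros assms(2))
  then have "continuous_map (top_of_set S) (top_of_set (cball 0 1)) (\<lambda>s. pos x (g s))"
    using assms(3) norm_pos_le[OF assms(1)] by auto
  from continuous_map_compose[OF this continuous_map_face[OF face_in[OF assms(1)]]]
  show ?thesis by (simp add: spt_def o_def)
qed

lemma spt_in_Y: "x \<in> SL \<Longrightarrow> Im u \<le> 0 \<Longrightarrow> spt x u \<in> topspace Y"
  by (simp add: topspace_Y spt_def norm_pos_le)

lemma compact_Y: "compact_space Y"
proof -
  have "topspace Y = (\<Union>F\<in>Fs. (\<lambda>z. (F, z)) ` cball 0 1)"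
    by (auto simp: topspace_Y)
  moreover have "compactin Y ((\<lambda>z. (F, z)) ` cball 0 1)" if "F \<in> Fs" for F
    by (rule image_compactin[OF _ continuous_map_face[OF that]]) (simp add: compactin_subtopology)
  ultimately show ?thesis
    unfolding compact_space_def by (auto intro: compactin_Union)
qed

lemma Hausdorff_Y: "Hausdorff_space Y"
  unfolding Hausdorff_space_def
proof (intro allI impI)
  fix p q :: "slabel set \<times> complex" assume pq: "p \<in> topspace Y \<and> q \<in> topspace Y \<and> p \<noteq> q"
  obtain F z G w where FG: "p = (F, z)" "q = (G, w)" by (cases p, cases q)
  have op: "openin Y {p \<in> topspace Y. fst p = F' \<and> snd p \<in> U}" if "open U" for U F'
    unfolding openin_Y
  proof (intro conjI ballI)
    fix G' assume "G' \<in> Fs"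
    then have "{z. (G', z) \<in> {p \<in> topspace Y. fst p = F' \<and> snd p \<in> U}} =
        (if G' = F' then cball 0 1 \<inter> U else {})"
      by (auto simp: topspace_Y)
    then show "openin (top_of_set (cball 0 1)) {z. (G', z) \<in> {p \<in> topspace Y. fst p = F' \<and> snd p \<in> U}}"
      using that by (auto intro: openin_open_Int)
  qed (auto simp: topspace_Y)
  show "\<exists>U V. openin Y U \<and> openin Y V \<and> p \<in> U \<and> q \<in> V \<and> disjnt U V"
  proof (cases "F = G")
    case True
    then have "z \<noteq> w" using pq FG by auto
    then obtain U V where "open U" "open V" "z \<in> U" "w \<in> V" "U \<inter> V = {}"
      by (meson hausdorff)
    then show ?thesis
      using op[of U F] op[of V G] pq FG
      by (intro exI[of _ "{p \<in> topspace Y. fst p = F \<and> snd p \<in> U}"] exI[of _ "{p \<in> topspace Y. fst p = G \<and> snd p \<in> V}"])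
        (auto simp: disjnt_def)
  next
    case False
    then show ?thesis
      using op[of UNIV F] op[of UNIV G] pq FG
      by (intro exI[of _ "{p \<in> topspace Y. fst p = F \<and> snd p \<in> UNIV}"] exI[of _ "{p \<in> topspace Y. fst p = G \<and> snd p \<in> UNIV}"])
        (auto simp: disjnt_def)
  qed
qed

lemma compact_X: "compact_space X"
  using compact_Y image_compactin[OF _ continuous_pr, of "topspace Y"]
  unfolding compact_space_def by (simp add: topspace_X topspace_Y)

text \<open>By the description of the gluing, saturating a closed set \<open>K\<close> adds for every side the image of a
  compact set of parameters, and finitely many corners.\<close>

lemma closed_map_pr: "closed_map Y X pr"
  unfolding closed_map_def
proof (intro allI impI)
  fix K assume K: "closedin Y K"
  then have KY: "K \<subseteq> topspace Y" by (rule closedin_subset)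
  define A where "A x = (\<lambda>u. spt (neg x) (of_real (1 - u))) ` {u \<in> {0..1}. spt x (of_real u) \<in> K}" for x
  define B where "B x = {p. spt x 1 \<in> K \<and> (\<exists>i<4. p = spt (turn C i x) 1)}" for x
  have eq: "{p \<in> topspace Y. pr p \<in> pr ` K} = K \<union> (\<Union>x\<in>SL. A x) \<union> (\<Union>x\<in>SL. B x)"
  proof (intro set_eqI iffI)
    fix p assume p: "p \<in> {p \<in> topspace Y. pr p \<in> pr ` K}"
    then have "pr p \<in> pr ` K" by simp
    then obtain q where q: "q \<in> K" "pr q = pr p" by (metis imageE)
    then have "(q, p) \<in> Id \<union> Rg \<union> corner_rel" using glue_subset by (auto simp: proj_eq_iff)
    then consider "q = p" | "(q, p) \<in> Rg" | "(q, p) \<in> corner_rel" by blast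
    then show "p \<in> K \<union> (\<Union>x\<in>SL. A x) \<union> (\<Union>x\<in>SL. B x)"
    proof cases
      case 1
      then show ?thesis using q by simp
    next
      case 2
      then obtain x u where "x \<in> SL" "0 \<le> u" "u \<le> 1" "q = spt x (of_real u)" "p = spt (neg x) (of_real (1 - u))"
        by (auto simp: Rg_def)
      then have "p \<in> A x" using q unfolding A_def by auto
      then show ?thesis using \<open>x \<in> SL\<close> by blast
    next
      case 3
      then obtain x i where x: "x \<in> SL" "q = spt x 1" "p = spt (turn C i x) 1"
        by (auto simp: corner_rel_def)
      moreover have "i mod 4 < 4" "turn C i x = turn C (i mod 4) x" using turn_mod[OF x(1)] by simp_all
      ultimately have "p \<in> B x" using q unfolding B_def mem_Collect_eq by metis
      then show ?thesis using \<open>x \<in> SL\<close> by blast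
    qed
  next
    fix p assume "p \<in> K \<union> (\<Union>x\<in>SL. A x) \<union> (\<Union>x\<in>SL. B x)"
    then consider "p \<in> K" | x where "x \<in> SL" "p \<in> A x" | x where "x \<in> SL" "p \<in> B x" by blast
    then show "p \<in> {p \<in> topspace Y. pr p \<in> pr ` K}"
    proof cases
      case 1
      then show ?thesis using KY by auto
    next
      case 2
      then obtain u where u: "u \<in> {0..1}" "spt x (of_real u) \<in> K" "p = spt (neg x) (of_real (1 - u))"
        by (auto simp: A_def)
      then have "pr p = pr (spt x (of_real u))" using pt_glue[OF 2(1), of u] by (simp add: pt_def)
      moreover have "p \<in> topspace Y" using spt_in_Y[of "neg x"] 2(1) u by simp
      ultimately show ?thesis using u(2) by auto
    next
      case 3
      then obtain i where u: "spt x 1 \<in> K" "p = spt (turn C i x) 1"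
        by (auto simp: B_def)
      then have "pr p = pr (spt x 1)" using pt_corner[OF 3(1), of i] by (simp add: pt_def)
      moreover have "p \<in> topspace Y" using spt_in_Y[of "turn C i x"] 3(1) u by simp
      ultimately show ?thesis using u(1) by auto
    qed
  qed
  have "closedin Y (A x)" if x: "x \<in> SL" for x
  proof -
    have c1: "continuous_map (top_of_set {0..1::real}) Y (\<lambda>u. spt x (of_real u))"
      by (rule continuous_map_spt[OF x]) (auto intro!: continuous_intros)
    have c2: "continuous_map (top_of_set {0..1::real}) Y (\<lambda>u. spt (neg x) (of_real (1 - u)))"
      by (rule continuous_map_spt) (use x in \<open>auto intro!: continuous_intros\<close>)
    have "closedin (top_of_set {0..1::real}) {u \<in> {0..1}. spt x (of_real u) \<in> K}"
      using closedin_continuous_map_preimage[OF c1 K] by simp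
    then have "compactin (top_of_set {0..1::real}) {u \<in> {0..1}. spt x (of_real u) \<in> K}"
      by (intro closedin_compact_space) (auto simp: compact_space_subtopology)
    then have "compactin Y (A x)" unfolding A_def by (rule image_compactin[OF _ c2])
    then show ?thesis by (rule compactin_imp_closedin[OF Hausdorff_Y])
  qed
  moreover have "closedin Y (B x)" if x: "x \<in> SL" for x
  proof -
    have "B x \<subseteq> (\<lambda>i. spt (turn C i x) 1) ` {..<4}" by (auto simp: B_def)
    moreover have "B x \<subseteq> topspace Y" using x by (auto simp: B_def spt_in_Y)
    ultimately have "finite (B x)" "B x \<subseteq> topspace Y" by (auto intro: finite_subset)
    then show ?thesis
      using Hausdorff_imp_t1_space[OF Hausdorff_Y] by (simp add: t1_space_closedin_finite)
  qed
  ultimately have "closedin Y {p \<in> topspace Y. pr p \<in> pr ` K}"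
    unfolding eq by (intro closedin_Un K closedin_Union) auto
  moreover have "pr ` K \<subseteq> topspace X" using KY by (auto simp: topspace_X topspace_Y)
  ultimately show "closedin X (pr ` K)"
    using quotient_map_pr unfolding quotient_map_closedin by blast
qed

lemma Hausdorff_X: "Hausdorff_space X"
proof (rule normal_t1_imp_Hausdorff_space)
  show "normal_space X"
    by (rule normal_space_continuous_closed_map_image[OF _ continuous_pr closed_map_pr])
      (use compact_Hausdorff_or_regular_imp_normal_space[OF compact_Y] Hausdorff_Y topspace_X topspace_Y in auto)
  show "t1_space X"
    unfolding t1_space_closedin_singleton
  proof
    fix p assume "p \<in> topspace X"
    then obtain q where q: "q \<in> topspace Y" "p = pr q" by (auto simp: topspace_X topspace_Y)
    have "closedin Y {q}" using q Hausdorff_imp_t1_space[OF Hausdorff_Y] by (simp add: t1_space_closedin_singleton)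
    then have "closedin X (pr ` {q})" using closed_map_pr unfolding closed_map_def by blast
    then show "closedin X {p}" using q by simp
  qed
qed

end

section \<open>Parametrizations of the surface by holomorphic pieces\<close>

context pdb
begin

text \<open>The functions that the conformal structures of the open polygons determine: continuous
  on the surface, and holomorphic wherever this is meaningful a priori.\<close>

definition conf_fun :: "point set \<Rightarrow> (point \<Rightarrow> complex) \<Rightarrow> bool" where
  "conf_fun V g \<longleftrightarrow> openin X V \<and> continuous_map (subtopology X V) euclidean g \<and>
     (\<forall>F\<in>Fs. (\<lambda>z. g (pr (F, z))) holomorphic_on {z \<in> ball 0 1. pr (F, z) \<in> V})"

text \<open>A holomorphic parametrization \<open>P\<close> of an open part of the surface by \<open>W\<close>.  The last clause is
  the essential one: functions that are continuous and holomorphic inside the polygons are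
  holomorphic in the parameter, also where \<open>P\<close> meets edges and vertices.\<close>

definition conf_par :: "complex set \<Rightarrow> (complex \<Rightarrow> point) \<Rightarrow> bool" where
  "conf_par W P \<longleftrightarrow> open W \<and> inj_on P W \<and> P ` W \<subseteq> topspace X \<and>
     (\<forall>V. open V \<longrightarrow> V \<subseteq> W \<longrightarrow> openin X (P ` V)) \<and>
     (\<forall>U. openin X U \<longrightarrow> open {w \<in> W. P w \<in> U}) \<and>
     (\<forall>F\<in>Fs. (\<lambda>z. inv_into W P (pr (F, z))) holomorphic_on {z \<in> ball 0 1. pr (F, z) \<in> P ` W}) \<and>
     (\<forall>V g. conf_fun V g \<longrightarrow> (\<lambda>w. g (P w)) holomorphic_on {w \<in> W. P w \<in> V})"

lemma conf_par_cong:
  assumes "conf_par W P" "\<And>w. w \<in> W \<Longrightarrow> P w = Q w"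
  shows "conf_par W Q"
proof -
  have img: "Q ` V = P ` V" if "V \<subseteq> W" for V
    by (rule image_cong) (use that assms(2) in auto)
  have inv: "inv_into W Q p = inv_into W P p" for p
  proof -
    have "(\<lambda>w. w \<in> W \<and> Q w = p) = (\<lambda>w. w \<in> W \<and> P w = p)" using assms(2) by auto
    then show ?thesis by (simp add: inv_into_def)
  qed
  have inj: "inj_on Q W \<longleftrightarrow> inj_on P W" by (rule inj_on_cong) (use assms(2) in auto)
  have sets: "{w \<in> W. Q w \<in> U} = {w \<in> W. P w \<in> U}" for U using assms(2) by auto
  have "(\<lambda>w. g (Q w)) holomorphic_on {w \<in> W. P w \<in> V} \<longleftrightarrow> (\<lambda>w. g (P w)) holomorphic_on {w \<in> W. P w \<in> V}"
    for g :: "point \<Rightarrow> complex" and V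
    by (rule holomorphic_cong) (use assms(2) in auto)
  note hol = this
  have op: "openin X (Q ` V)" if "open V" "V \<subseteq> W" for V
    using assms(1) that unfolding conf_par_def img[OF that(2)] by blast
  show ?thesis
    unfolding conf_par_def inv inj sets img[OF order_refl] hol
    using assms(1) op unfolding conf_par_def by blast
qed

end

text \<open>The set \<open>W\<close> is cut into closed pieces \<open>K i\<close>, and each piece is mapped by a holomorphic function
  \<open>E i\<close> into the closed disc of a polygon \<open>G i\<close>, with the boundary of the disc along the cuts.  The
  hypotheses \<open>coherent\<close> and \<open>saturated\<close> say that a parameter on several pieces names all
  the glued copies of one point of the surface, \<open>E_open\<close> makes the resulting map open, and \<open>paste\<close>
  is the theorem that a continuous function which is holomorphic off the cuts is holomorphic.\<close>

locale pieces = pdb +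
  fixes W :: "complex set" and I :: "nat set" and K :: "nat \<Rightarrow> complex set"
    and G :: "nat \<Rightarrow> slabel set" and E :: "nat \<Rightarrow> complex \<Rightarrow> complex"
  assumes open_W: "open W"
    and finite_I: "finite I"
    and G_face: "i \<in> I \<Longrightarrow> G i \<in> Fs"
    and closed_K: "i \<in> I \<Longrightarrow> closed (K i)"
    and cover: "W \<subseteq> (\<Union>i\<in>I. K i)"
    and E_holomorphic: "i \<in> I \<Longrightarrow> E i holomorphic_on W"
    and E_cball: "i \<in> I \<Longrightarrow> w \<in> W \<Longrightarrow> w \<in> K i \<Longrightarrow> norm (E i w) \<le> 1"
    and E_inj: "i \<in> I \<Longrightarrow> j \<in> I \<Longrightarrow> w \<in> W \<Longrightarrow> w' \<in> W \<Longrightarrow> w \<in> K i \<Longrightarrow> w' \<in> K j \<Longrightarrow>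
      G i = G j \<Longrightarrow> E i w = E j w' \<Longrightarrow> w = w'"
    and coherent: "i \<in> I \<Longrightarrow> j \<in> I \<Longrightarrow> w \<in> W \<Longrightarrow> w \<in> K i \<Longrightarrow> w \<in> K j \<Longrightarrow> pr (G i, E i w) = pr (G j, E j w)"
    and saturated: "i \<in> I \<Longrightarrow> w \<in> W \<Longrightarrow> w \<in> K i \<Longrightarrow> ((G i, E i w), p) \<in> Rg \<Longrightarrow>
      \<exists>j\<in>I. w \<in> K j \<and> p = (G j, E j w)"
    and E_open: "i \<in> I \<Longrightarrow> open V \<Longrightarrow> V \<subseteq> W \<Longrightarrow> \<exists>U. open U \<and> E i ` (V \<inter> K i) = cball 0 1 \<inter> U"
    and open_interior: "i \<in> I \<Longrightarrow> open {w \<in> W \<inter> K i. norm (E i w) < 1}"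
    and paste: "open S \<Longrightarrow> S \<subseteq> W \<Longrightarrow> continuous_on S h \<Longrightarrow>
      (\<And>i. i \<in> I \<Longrightarrow> h holomorphic_on {w \<in> S \<inter> K i. norm (E i w) < 1}) \<Longrightarrow> h holomorphic_on S"
begin

definition P :: "complex \<Rightarrow> point" where
  "P w = (let i = (SOME i. i \<in> I \<and> w \<in> K i) in pr (G i, E i w))"

lemma P_eq:
  assumes "i \<in> I" "w \<in> W" "w \<in> K i"
  shows "P w = pr (G i, E i w)"
proof -
  let ?i = "SOME i. i \<in> I \<and> w \<in> K i"
  have "?i \<in> I \<and> w \<in> K ?i" by (rule someI_ex) (use assms in blast)
  then show ?thesis unfolding P_def Let_def using coherent assms by blast
qed

lemma W_cases:
  assumes "w \<in> W"
  obtains i where "i \<in> I" "w \<in> K i" "P w = pr (G i, E i w)"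
proof -
  obtain i where "i \<in> I" "w \<in> K i" using cover assms by blast
  then show thesis using that P_eq assms by blast
qed

text \<open>By \<open>saturated\<close>, the set of the names of a given parameter is closed under gluing.\<close>

lemma P_fibre:
  assumes "w \<in> W" "pr p = P w"
  shows "\<exists>j\<in>I. w \<in> K j \<and> p = (G j, E j w)"
proof -
  obtain i where i: "i \<in> I" "w \<in> K i" "P w = pr (G i, E i w)" using W_cases[OF assms(1)] .
  then have "((G i, E i w), p) \<in> Rg\<^sup>*" using assms(2) proj_eq_iff by metis
  then show ?thesis
  proof (induction rule: rtrancl_induct)
    case base
    then show ?case using i by blast
  next
    case (step p q)
    then show ?case using saturated assms(1) by blast
  qed
qed

lemma inj_P: "inj_on P W"
proof (rule inj_onI)
  fix w w' assume ww: "w \<in> W" "w' \<in> W" "P w = P w'"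
  obtain i where i: "i \<in> I" "w \<in> K i" "P w = pr (G i, E i w)" using W_cases[OF ww(1)] .
  then obtain j where "j \<in> I" "w' \<in> K j" "(G i, E i w) = (G j, E j w')"
    using P_fibre[OF ww(2), of "(G i, E i w)"] ww(3) by auto
  then show "w = w'" using E_inj[OF i(1) _ ww(1,2) i(2)] by simp
qed

lemma P_topspace: "P ` W \<subseteq> topspace X"
proof
  fix p assume "p \<in> P ` W"
  then obtain w where w: "w \<in> W" "p = P w" by blast
  obtain i where i: "i \<in> I" "w \<in> K i" "P w = pr (G i, E i w)" using W_cases[OF w(1)] .
  then have "(G i, E i w) \<in> Fs \<times> cball 0 1" using G_face E_cball w(1) by simp
  then show "p \<in> topspace X" unfolding w(2) i(3) topspace_X by (rule imageI)
qed

lemma P_image_face: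
  assumes "V \<subseteq> W"
  shows "{z. pr (F, z) \<in> P ` V} = (\<Union>i\<in>{i\<in>I. G i = F}. E i ` (V \<inter> K i))"
proof (intro set_eqI iffI)
  fix z assume "z \<in> {z. pr (F, z) \<in> P ` V}"
  then obtain w where w: "w \<in> V" "pr (F, z) = P w" by blast
  then obtain j where "j \<in> I" "w \<in> K j" "(F, z) = (G j, E j w)"
    using P_fibre[of w "(F, z)"] assms by blast
  then show "z \<in> (\<Union>i\<in>{i\<in>I. G i = F}. E i ` (V \<inter> K i))" using w(1) by auto
next
  fix z assume "z \<in> (\<Union>i\<in>{i\<in>I. G i = F}. E i ` (V \<inter> K i))"
  then obtain i w where i: "i \<in> I" "G i = F" "w \<in> V" "w \<in> K i" "z = E i w" by blast
  then have "pr (F, z) = P w" using P_eq[of i w] assms by auto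
  then show "z \<in> {z. pr (F, z) \<in> P ` V}" using i(3) by blast
qed

lemma P_open:
  assumes "open V" "V \<subseteq> W"
  shows "openin X (P ` V)"
  unfolding openin_X
proof (intro conjI ballI)
  show "P ` V \<subseteq> topspace X" using P_topspace assms(2) by blast
  fix F assume "F \<in> Fs"
  have "\<forall>i\<in>I. \<exists>U. open U \<and> E i ` (V \<inter> K i) = cball 0 1 \<inter> U"
    using E_open assms by blast
  then obtain U where U: "\<And>i. i \<in> I \<Longrightarrow> open (U i)" "\<And>i. i \<in> I \<Longrightarrow> E i ` (V \<inter> K i) = cball 0 1 \<inter> U i"
    by metis
  have "{z. pr (F, z) \<in> P ` V} = (\<Union>i\<in>{i\<in>I. G i = F}. cball 0 1 \<inter> U i)"
    unfolding P_image_face[OF assms(2)] by (rule SUP_cong) (use U(2) in auto)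
  then have "{z \<in> cball 0 1. pr (F, z) \<in> P ` V} = cball 0 1 \<inter> (\<Union>i\<in>{i\<in>I. G i = F}. U i)"
    unfolding Collect_conj_eq Collect_mem_eq by (simp only:) blast
  moreover have "open (\<Union>i\<in>{i\<in>I. G i = F}. U i)" using U(1) by blast
  ultimately show "openin (top_of_set (cball 0 1)) {z \<in> cball 0 1. pr (F, z) \<in> P ` V}"
    by (simp add: openin_open_Int)
qed

text \<open>On each closed piece the map factors through the continuous \<open>E i\<close>, and there are only
  finitely many pieces.\<close>

lemma P_continuous:
  assumes "openin X U"
  shows "open {w \<in> W. P w \<in> U}"
proof -
  have "\<exists>O'. open O' \<and> {z \<in> cball 0 1. pr (G i, z) \<in> U} = cball 0 1 \<inter> O'" if "i \<in> I" for i
  proof -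
    have "openin (top_of_set (cball 0 1)) {z \<in> cball 0 1. pr (G i, z) \<in> U}"
      using assms G_face[OF that] unfolding openin_X by blast
    then show ?thesis unfolding openin_open .
  qed
  then obtain A where A: "\<And>i. i \<in> I \<Longrightarrow> open (A i)"
    "\<And>i. i \<in> I \<Longrightarrow> {z \<in> cball 0 1. pr (G i, z) \<in> U} = cball 0 1 \<inter> A i"
    using bchoice[of I "\<lambda>i O'. open O' \<and> {z \<in> cball 0 1. pr (G i, z) \<in> U} = cball 0 1 \<inter> O'"] by blast
  have iff: "P w \<in> U \<longleftrightarrow> E i w \<in> A i" if "i \<in> I" "w \<in> W" "w \<in> K i" for i w
  proof -
    have "E i w \<in> cball 0 1" using E_cball that by simp
    then show ?thesis using A(2)[OF that(1)] P_eq[OF that] by auto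
  qed
  have "{w \<in> W. P w \<in> U} = W \<inter> (\<Inter>i\<in>I. (W - K i) \<union> (W \<inter> E i -` A i))"
  proof (intro set_eqI iffI)
    fix w assume "w \<in> {w \<in> W. P w \<in> U}"
    then show "w \<in> W \<inter> (\<Inter>i\<in>I. (W - K i) \<union> (W \<inter> E i -` A i))" using iff by auto
  next
    fix w assume w: "w \<in> W \<inter> (\<Inter>i\<in>I. (W - K i) \<union> (W \<inter> E i -` A i))"
    then obtain i where "i \<in> I" "w \<in> K i" using cover by blast
    then show "w \<in> {w \<in> W. P w \<in> U}" using w iff[of i w] by auto
  qed
  moreover have "open ((W - K i) \<union> (W \<inter> E i -` A i))" if "i \<in> I" for i
    using that A(1) open_W closed_K holomorphic_on_imp_continuous_on[OF E_holomorphic]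
    by (intro open_Un open_Diff continuous_open_preimage) auto
  ultimately show ?thesis using finite_I open_W by (simp add: open_INT open_Int)
qed

text \<open>Inside a polygon the parametrized part is the union of the images of the injective holomorphic
  pieces, and the inverse map is the inverse of each of them.\<close>

lemma P_inverse_holomorphic:
  "(\<lambda>z. inv_into W P (pr (F, z))) holomorphic_on {z \<in> ball 0 1. pr (F, z) \<in> P ` W}"
proof -
  define D where "D i = {w \<in> W \<inter> K i. norm (E i w) < 1}" for i
  have eq: "{z \<in> ball 0 1. pr (F, z) \<in> P ` W} = (\<Union>i\<in>{i\<in>I. G i = F}. E i ` D i)"
    unfolding Collect_conj_eq Collect_mem_eq P_image_face[OF order_refl] by (auto simp: D_def)
  have D: "open (E i ` D i) \<and> (\<lambda>z. inv_into W P (pr (F, z))) holomorphic_on E i ` D i"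
    if i: "i \<in> I" "G i = F" for i
  proof -
    have hol: "E i holomorphic_on D i"
      using E_holomorphic[OF i(1)] by (rule holomorphic_on_subset) (auto simp: D_def)
    have op: "open (D i)" unfolding D_def by (rule open_interior[OF i(1)])
    have inj: "inj_on (E i) (D i)"
      by (rule inj_onI) (use E_inj[OF i(1) i(1)] in \<open>auto simp: D_def\<close>)
    obtain g where g: "g holomorphic_on (E i ` D i)" "\<And>w. w \<in> D i \<Longrightarrow> g (E i w) = w"
      using holomorphic_has_inverse[OF hol op inj] by metis
    have "inv_into W P (pr (F, z)) = g z" if "z \<in> E i ` D i" for z
    proof -
      obtain w where w: "w \<in> D i" "z = E i w" using \<open>z \<in> E i ` D i\<close> by blast
      then have "pr (F, z) = P w" using P_eq[of i w] i by (simp add: D_def)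
      then show ?thesis using inv_into_f_f[OF inj_P, of w] w g(2) by (simp add: D_def)
    qed
    then show ?thesis
      using open_mapping_thm3[OF hol op inj] holomorphic_transform[OF g(1)] by auto
  qed
  show ?thesis unfolding eq
    by (rule holomorphic_on_UN_open) (use D in auto)
qed

text \<open>Inside the polygons the function is holomorphic in the parameter by composition with the
  pieces; continuity carries this across the cuts.\<close>

lemma conf_fun_P:
  assumes "conf_fun V g"
  shows "(\<lambda>w. g (P w)) holomorphic_on {w \<in> W. P w \<in> V}"
proof (rule paste)
  let ?S = "{w \<in> W. P w \<in> V}"
  have V: "openin X V" "continuous_map (subtopology X V) euclidean g"
    "\<And>F. F \<in> Fs \<Longrightarrow> (\<lambda>z. g (pr (F, z))) holomorphic_on {z \<in> ball 0 1. pr (F, z) \<in> V}"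
    using assms by (auto simp: conf_fun_def)
  show S: "open ?S" by (rule P_continuous[OF V(1)])
  show "?S \<subseteq> W" by blast
  show "continuous_on ?S (\<lambda>w. g (P w))"
    unfolding continuous_on_open_vimage[OF S]
  proof (intro allI impI)
    fix B :: "complex set" assume "open B"
    then have "openin (subtopology X V) {x \<in> topspace (subtopology X V). g x \<in> B}"
      using V(2) by (simp add: continuous_map_def)
    then have "openin X {x \<in> topspace (subtopology X V). g x \<in> B}"
      using V(1) openin_trans_full by blast
    then have "open {w \<in> W. P w \<in> {x \<in> topspace (subtopology X V). g x \<in> B}}"
      by (rule P_continuous)
    moreover have "{w \<in> W. P w \<in> {x \<in> topspace (subtopology X V). g x \<in> B}} = (\<lambda>w. g (P w)) -` B \<inter> ?S"
      using P_topspace by auto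
    ultimately show "open ((\<lambda>w. g (P w)) -` B \<inter> ?S)" by simp
  qed
  fix i assume i: "i \<in> I"
  have "(\<lambda>w. g (pr (G i, E i w))) holomorphic_on {w \<in> ?S \<inter> K i. norm (E i w) < 1}"
  proof (rule holomorphic_on_compose_gen[OF _ V(3)[OF G_face[OF i]], unfolded o_def])
    show "E i holomorphic_on {w \<in> ?S \<inter> K i. norm (E i w) < 1}"
      using E_holomorphic[OF i] by (rule holomorphic_on_subset) auto
    show "E i ` {w \<in> ?S \<inter> K i. norm (E i w) < 1} \<subseteq> {z \<in> ball 0 1. pr (G i, z) \<in> V}"
      using P_eq[OF i] by auto
  qed
  then show "(\<lambda>w. g (P w)) holomorphic_on {w \<in> ?S \<inter> K i. norm (E i w) < 1}"
    by (rule holomorphic_transform) (use P_eq[OF i] in auto)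
qed

theorem conf_par_P: "conf_par W P"
  unfolding conf_par_def
  using open_W inj_P P_topspace P_open P_continuous P_inverse_holomorphic conf_fun_P by blast

end

context pdb
begin

section \<open>Face coordinates\<close>

lemma Rg_norm:
  assumes "((F, z), p) \<in> Rg"
  shows "norm z = 1"
  using assms by (auto simp: Rg_def spt_def norm_pos)

lemma Rg_real:
  assumes "x \<in> SL" "(spt x u, p) \<in> Rg"
  shows "Im u = 0"
proof -
  have "norm (pos x u) = 1" using assms(2) Rg_norm by (simp add: spt_def)
  then show ?thesis
    using norm_pos_le[OF assms(1), of u] norm_pos_less[OF assms(1), of u] by linarith
qed

lemma conf_par_face:
  assumes "F \<in> Fs"
  shows "conf_par (ball 0 1) (\<lambda>z. pr (F, z))"
proof -
  interpret p: pieces \<mu> n C b "ball 0 1" "{0}" "\<lambda>_. UNIV" "\<lambda>_. F" "\<lambda>_ z. z"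
  proof
    fix V :: "complex set" assume "open V"
    then show "\<exists>U. open U \<and> (\<lambda>z. z) ` (V \<inter> UNIV) = cball 0 1 \<inter> U" if "V \<subseteq> ball 0 1" for i :: nat
      using that ball_subset_cball by (intro exI[of _ V]) auto
  next
    show "open {w \<in> ball 0 1 \<inter> UNIV. norm (w::complex) < 1}" for i :: nat
    proof -
      have "{w \<in> ball 0 1 \<inter> UNIV. norm (w::complex) < 1} = ball 0 1" by auto
      then show ?thesis by simp
    qed
  next
    fix S :: "complex set" and h :: "complex \<Rightarrow> complex"
    assume "S \<subseteq> ball 0 1" "\<And>i. i \<in> {0::nat} \<Longrightarrow> h holomorphic_on {w \<in> S \<inter> UNIV. norm w < 1}"
    moreover have "{w \<in> S \<inter> UNIV. norm w < 1} = S" using calculation(1) by auto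
    ultimately show "h holomorphic_on S" by auto
  next
    fix i :: nat and w :: complex and p assume "w \<in> ball 0 1" "((F, w), p) \<in> Rg"
    then show "\<exists>j\<in>{0::nat}. w \<in> UNIV \<and> p = (F, w)" using Rg_norm by fastforce
  qed (use assms in auto)
  have "p.P = (\<lambda>z. pr (F, z))" by (simp add: p.P_def fun_eq_iff)
  then show ?thesis using p.conf_par_P by simp
qed

section \<open>Edge coordinates\<close>

definition strip :: "complex set" where
  "strip = {w. 0 < Re w \<and> Re w < 1}"

text \<open>Along an edge the lower half of the strip is mapped to the polygon of the side \<open>x\<close> and the
  upper half to that of the other side \<open>neg x\<close> of the same edge.\<close>

definition ept :: "slabel \<Rightarrow> complex \<Rightarrow> point" where
  "ept x w = (if Im w \<le> 0 then pt x w else pt (neg x) (1 - w))"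

lemma open_strip: "open strip"
  unfolding strip_def by (intro open_Collect_conj open_Collect_less continuous_intros)

lemma real_complex: "Im u = 0 \<Longrightarrow> u = of_real (Re u)"
  by (simp add: complex_eq_iff)

text \<open>The image is open by the open mapping theorem, and a coordinate belongs to the closed
  disc exactly if it lies in the closed lower half plane.\<close>

lemma open_image_Int_halfplane:
  assumes "x \<in> SL" "open V" "V \<subseteq> strip" "K = {w. Im (h w) \<le> 0}" "h holomorphic_on V" "inj_on h V"
    "h ` V \<subseteq> strip"
  shows "\<exists>U. open U \<and> (\<lambda>w. pos x (h w)) ` (V \<inter> K) = cball 0 1 \<inter> U"
proof (intro exI conjI)
  have "inj_on (\<lambda>w. pos x (h w)) V"
  proof (rule inj_onI)
    fix w w' assume w: "w \<in> V" "w' \<in> V" "pos x (h w) = pos x (h w')"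
    then have "h w \<in> strip" "h w' \<in> strip" using assms(7) by auto
    then have "\<bar>Re (h w - h w')\<bar> < 1" by (auto simp: strip_def)
    then have "h w = h w'" using spt_inj_Re[OF assms(1,1), of "h w" "h w'"] w by (simp add: spt_def)
    then show "w = w'" using assms(6) w inj_onD by metis
  qed
  then show "open ((\<lambda>w. pos x (h w)) ` V)"
    using open_mapping_thm3[OF pos_holomorphic[OF assms(5)] assms(2)] by blast
  show "(\<lambda>w. pos x (h w)) ` (V \<inter> K) = cball 0 1 \<inter> (\<lambda>w. pos x (h w)) ` V"
    using norm_pos_le[OF assms(1)] assms(4) by auto
qed

lemma conf_par_edge:
  assumes x: "x \<in> SL"
  shows "conf_par strip (ept x)"
    and "w \<in> strip \<Longrightarrow> Im w \<le> 0 \<Longrightarrow> ept x w = pt x w"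
    and "w \<in> strip \<Longrightarrow> Im w \<ge> 0 \<Longrightarrow> ept x w = pt (neg x) (1 - w)"
proof -
  define K :: "nat \<Rightarrow> complex set" where "K i = (if i = 0 then {w. Im w \<le> 0} else {w. Im (1 - w) \<le> 0})" for i
  define y where "y i = (if i = (0::nat) then x else neg x)" for i
  define e where "e i w = (if i = (0::nat) then w else 1 - w)" for i and w :: complex
  have y: "y i \<in> SL" for i using x by (simp add: y_def)
  have e_strip: "e i w \<in> strip \<longleftrightarrow> w \<in> strip" for i w by (auto simp: e_def strip_def)
  have K_iff: "w \<in> K i \<longleftrightarrow> Im (e i w) \<le> 0" for i w by (auto simp: K_def e_def)
  have e_hol: "e i holomorphic_on S" for i S
    by (cases "i = 0") (auto simp: e_def[abs_def] intro!: holomorphic_intros)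
  have glue1: "pt x w = pt (neg x) (1 - w)" if "w \<in> strip" "Im w = 0" for w
    using pt_glue[OF x, of "Re w"] real_complex[OF that(2)] that(1) by (simp add: strip_def)
  interpret p: pieces \<mu> n C b strip "{0, 1}" K "\<lambda>i. orbit f (y i)" "\<lambda>i w. pos (y i) (e i w)"
  proof
    show "open strip" by (rule open_strip)
    show "orbit f (y i) \<in> Fs" for i using y by simp
    show "closed (K i)" for i
      by (auto simp: K_def intro!: closed_Collect_le continuous_intros)
    show "strip \<subseteq> (\<Union>i\<in>{0, 1}. K i)" by (auto simp: K_def)
    show "(\<lambda>w. pos (y i) (e i w)) holomorphic_on strip" for i
      by (rule pos_holomorphic[OF e_hol])
    show "norm (pos (y i) (e i w)) \<le> 1" if "w \<in> K i" for i w
      using that K_iff norm_pos_le[OF y] by simp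
  next
    fix i j :: nat and w w' assume ij: "i \<in> {0, 1}" "j \<in> {0, 1}" "w \<in> strip" "w' \<in> strip"
      "orbit f (y i) = orbit f (y j)" "pos (y i) (e i w) = pos (y j) (e j w')"
    then have "spt (y i) (e i w) = spt (y j) (e j w')" by (simp add: spt_def)
    moreover have "\<bar>Re (e i w - e j w')\<bar> < 1"
      using e_strip[of i w] e_strip[of j w'] ij(3,4) by (auto simp: strip_def)
    ultimately have "y i = y j \<and> e i w = e j w'" using spt_inj_Re y by blast
    moreover have "x \<noteq> neg x" by (cases x) auto
    ultimately show "w = w'" using ij(1,2) by (auto simp: y_def e_def)
  next
    fix i j :: nat and w assume "i \<in> {0, 1}" "j \<in> {0, 1}" "w \<in> strip" "w \<in> K i" "w \<in> K j"
    moreover have "pt (y i) (e i w) = pt (y j) (e j w)"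
    proof (cases "i = j")
      case False
      then have "Im w = 0" using calculation by (auto simp: K_def)
      then show ?thesis using glue1[of w] calculation False by (auto simp: y_def e_def)
    qed simp
    ultimately show "pr (orbit f (y i), pos (y i) (e i w)) = pr (orbit f (y j), pos (y j) (e j w))"
      by (simp add: pt_def spt_def)
  next
    fix i :: nat and w p assume i: "i \<in> {0, 1}" "w \<in> strip" "((orbit f (y i), pos (y i) (e i w)), p) \<in> Rg"
    then have g: "(spt (y i) (e i w), p) \<in> Rg" by (simp add: spt_def)
    then have "Im (e i w) = 0" by (rule Rg_real[OF y])
    then have re: "e i w = of_real (Re (e i w))" "Im w = 0"
      by (simp_all add: real_complex[symmetric]) (auto simp: e_def split: if_splits)
    have "0 < Re (e i w)" "Re (e i w) < 1" using e_strip[of i w] i(2) by (auto simp: strip_def)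
    then have "p = spt (neg (y i)) (of_real (1 - Re (e i w)))"
      using Rg_inner[OF y] g re(1) by metis
    also have "\<dots> = spt (neg (y i)) (1 - e i w)" by (subst (2) re(1)) simp
    also have "\<dots> = spt (y (1 - i)) (e (1 - i) w)" using i(1) by (auto simp: y_def e_def)
    finally show "\<exists>j\<in>{0, 1}. w \<in> K j \<and> p = (orbit f (y j), pos (y j) (e j w))"
      using i(1) re(2) by (intro bexI[of _ "1 - i"]) (auto simp: spt_def K_def)
  next
    fix i :: nat and V assume V: "open V" "V \<subseteq> strip"
    show "\<exists>U. open U \<and> (\<lambda>w. pos (y i) (e i w)) ` (V \<inter> K i) = cball 0 1 \<inter> U"
    proof (rule open_image_Int_halfplane[OF y V])
      show "e i holomorphic_on V" by (rule e_hol)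
      show "inj_on (e i) V" by (auto simp: e_def inj_on_def)
      show "e i ` V \<subseteq> strip" using e_strip V(2) by auto
    qed (use K_iff in auto)
  next
    fix i :: nat
    have "{w \<in> strip \<inter> K i. norm (pos (y i) (e i w)) < 1} = strip \<inter> {w. Im (e i w) < 0}"
      using K_iff norm_pos_less[OF y] by auto
    also have "open \<dots>"
      by (intro open_Int open_strip open_Collect_less continuous_intros
          holomorphic_on_imp_continuous_on[OF e_hol])
    finally show "open {w \<in> strip \<inter> K i. norm (pos (y i) (e i w)) < 1}" .
  next
    fix S h assume S: "open S" "S \<subseteq> strip" "continuous_on S h"
      and h: "\<And>i. i \<in> {0, 1} \<Longrightarrow> h holomorphic_on {w \<in> S \<inter> K i. norm (pos (y i) (e i w)) < 1}"
    have eq: "{w \<in> S \<inter> K i. norm (pos (y i) (e i w)) < 1} = S \<inter> {w. Im (e i w) < 0}" for i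
      using K_iff norm_pos_less[OF y] by auto
    show "h holomorphic_on S"
    proof (rule holomorphic_on_paste_across_line[of S \<i> h 0])
      show "h holomorphic_on (S \<inter> {z. \<i> \<bullet> z < 0})"
        using h[of 0] unfolding eq by (simp add: e_def)
      show "h holomorphic_on (S \<inter> {z. 0 < \<i> \<bullet> z})"
        using h[of 1] unfolding eq by (simp add: e_def)
    qed (use S in auto)
  qed auto
  have P: "p.P w = ept x w" if "w \<in> strip" for w
  proof (cases "Im w \<le> 0")
    case True
    then show ?thesis using p.P_eq[of 0 w] that by (simp add: K_def ept_def y_def e_def pt_def spt_def)
  next
    case False
    then show ?thesis using p.P_eq[of 1 w] that by (simp add: K_def ept_def y_def e_def pt_def spt_def)
  qed
  show "w \<in> strip \<Longrightarrow> Im w \<le> 0 \<Longrightarrow> ept x w = pt x w" by (simp add: ept_def)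
  show "w \<in> strip \<Longrightarrow> Im w \<ge> 0 \<Longrightarrow> ept x w = pt (neg x) (1 - w)"
    using glue1 by (auto simp: ept_def)
  show "conf_par strip (ept x)"
    using p.conf_par_P P by (rule conf_par_cong)
qed


section \<open>Vertex coordinates\<close>

definition Q1 :: "complex set" where
  "Q1 = {w. 0 \<le> Re w \<and> 0 \<le> Im w}"

text \<open>The coordinate around the vertex of \<open>x\<close>.  Turning the quadrant number \<open>j\<close> back to \<open>Q1\<close>, its
  point \<open>w\<close> becomes a square root of \<open>1 - u\<close> with \<open>u\<close> the coordinate relative to the side
  \<open>turn C j x\<close>; so the end \<open>x\<close> runs along the positive real axis and the end \<open>turn C j x\<close> along the
  half axis through \<open>\<i> ^ j\<close>.\<close>

definition vpt :: "slabel \<Rightarrow> complex \<Rightarrow> point" where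
  "vpt x w = (let j = (SOME j. j < 4 \<and> (- \<i>) ^ j * w \<in> Q1) in pt (turn C j x) (1 - ((- \<i>) ^ j * w)\<^sup>2))"

lemma four_cases: "j < (4::nat) \<Longrightarrow> j = 0 \<or> j = 1 \<or> j = 2 \<or> j = 3"
  by linarith

lemma minus_i_power: "(- \<i>) ^ 0 = (1::complex)" "(- \<i>) ^ 1 = - \<i>" "(- \<i>) ^ 2 = (- 1::complex)" "(- \<i>) ^ 3 = \<i>"
  "(- \<i>) ^ 4 = (1::complex)"
  by (simp_all add: power2_eq_square power3_eq_cube power4_eq_xxxx)

lemma minus_i_power_mod: "(- \<i>) ^ (j mod 4) = (- \<i> :: complex) ^ j"
proof -
  have "(- \<i> :: complex) ^ j = (- \<i>) ^ (4 * (j div 4) + j mod 4)" by simp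
  also have "\<dots> = ((- \<i>) ^ 4) ^ (j div 4) * (- \<i>) ^ (j mod 4)" by (simp only: power_add power_mult)
  finally show ?thesis by (simp only: minus_i_power power_one mult_1_left)
qed

lemma norm_minus_i_power: "norm ((- \<i>) ^ j * w) = norm w"
  by (simp add: norm_mult norm_power)

lemma Im_one_minus_square: "Im (1 - w\<^sup>2) = - 2 * Re w * Im w"
  by (simp add: power2_eq_square)

lemma Q1_real_square:
  assumes "w \<in> Q1" "Im (1 - w\<^sup>2) = 0"
  shows "\<exists>a\<ge>0. w = of_real a \<or> w = \<i> * of_real a"
proof -
  have "Re w = 0 \<or> Im w = 0" using assms(2) unfolding Im_one_minus_square by simp
  then show ?thesis
  proof
    assume "Re w = 0"
    then have "w = \<i> * of_real (Im w)" by (simp add: complex_eq_iff)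
    then show ?thesis using assms(1) by (auto simp: Q1_def)
  next
    assume "Im w = 0"
    then have "w = of_real (Re w)" by (simp add: complex_eq_iff)
    then show ?thesis using assms(1) by (auto simp: Q1_def)
  qed
qed

lemma quadrant_cover: "\<exists>j<4. (- \<i>) ^ j * w \<in> Q1"
proof -
  consider "0 \<le> Re w" "0 \<le> Im w" | "Re w \<le> 0" "0 \<le> Im w" | "Re w \<le> 0" "Im w \<le> 0" | "0 \<le> Re w" "Im w \<le> 0"
    by linarith
  then show ?thesis
  proof cases
    case 1 then show ?thesis by (intro exI[of _ 0]) (simp add: Q1_def)
  next
    case 2
    have "(- \<i>) ^ 1 * w \<in> Q1" unfolding minus_i_power using 2 by (simp add: Q1_def)
    then show ?thesis by (meson one_less_numeral_iff semiring_norm(76))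
  next
    case 3
    have "(- \<i>) ^ 2 * w \<in> Q1" unfolding minus_i_power using 3 by (simp add: Q1_def)
    then show ?thesis by (intro exI[of _ 2]) simp
  next
    case 4
    have "(- \<i>) ^ 3 * w \<in> Q1" unfolding minus_i_power using 4 by (simp add: Q1_def)
    then show ?thesis by (intro exI[of _ 3]) simp
  qed
qed

text \<open>Two quadrants overlap only along a half axis, where \<open>pt_turn\<close> identifies the two
  corners, or, if they are opposite, in the vertex.\<close>

lemma quadrant_glue:
  assumes "x \<in> SL" "w \<in> Q1" "(- \<i>) ^ d * w \<in> Q1" "norm w < 1"
  shows "pt (turn C d x) (1 - ((- \<i>) ^ d * w)\<^sup>2) = pt x (1 - w\<^sup>2)"
proof -
  have "pt (turn C d x) (1 - ((- \<i>) ^ d * w)\<^sup>2) = pt x (1 - w\<^sup>2)" if d: "d < 4" "(- \<i>) ^ d * w \<in> Q1" for d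
  proof -
    have ab: "\<bar>Re w\<bar> < 1" "\<bar>Im w\<bar> < 1"
      using abs_Re_le_cmod[of w] abs_Im_le_cmod[of w] assms(4) by linarith+
    then have sq: "(Re w)\<^sup>2 \<le> 1" "(Im w)\<^sup>2 \<le> 1" by (simp_all add: abs_square_le_1)
    from four_cases[OF d(1)] consider "d = 0" | "d = 1" | "d = 2" | "d = 3" by blast
    then show ?thesis
    proof cases
      case 1
      then show ?thesis using assms(1) by simp
    next
      case 2
      then have "Re w = 0" using d(2) assms(2) unfolding 2 minus_i_power by (simp add: Q1_def)
      then have w: "w = \<i> * of_real (Im w)" by (simp add: complex_eq_iff)
      have "w\<^sup>2 = - of_real ((Im w)\<^sup>2)" "((- \<i>) * w)\<^sup>2 = of_real ((Im w)\<^sup>2)"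
        by (subst w; simp add: power_mult_distrib)+
      then show ?thesis
        using pt_turn[OF assms(1), of "(Im w)\<^sup>2"] sq unfolding 2 minus_i_power by simp
    next
      case 3
      then have "w = 0" using d(2) assms(2) unfolding 3 minus_i_power
        by (auto simp: Q1_def complex_eq_iff)
      then show ?thesis using pt_corner[OF assms(1), of d] by simp
    next
      case 4
      then have "Im w = 0" using d(2) assms(2) unfolding 4 minus_i_power by (simp add: Q1_def)
      then have w: "w = of_real (Re w)" by (simp add: complex_eq_iff)
      have "w\<^sup>2 = of_real ((Re w)\<^sup>2)" "(\<i> * w)\<^sup>2 = - of_real ((Re w)\<^sup>2)"
        by (subst w; simp add: power_mult_distrib)+
      moreover have "turn C 3 x \<in> SL" "\<tau> (turn C 3 x) = x" using assms(1) turn_turn[OF assms(1), of 1 3] by simp_all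
      ultimately show ?thesis
        using pt_turn[of "turn C 3 x" "(Re w)\<^sup>2"] sq unfolding 4 minus_i_power by simp
    qed
  qed
  from this[of "d mod 4"] show ?thesis
    using assms turn_mod[OF assms(1), of d] by (simp add: minus_i_power_mod)
qed

lemma quadrant_coherent:
  assumes "x \<in> SL" "(- \<i>) ^ i * w \<in> Q1" "(- \<i>) ^ j * w \<in> Q1" "norm w < 1"
  shows "pt (turn C i x) (1 - ((- \<i>) ^ i * w)\<^sup>2) = pt (turn C j x) (1 - ((- \<i>) ^ j * w)\<^sup>2)"
proof -
  have main: "pt (turn C j x) (1 - ((- \<i>) ^ j * w)\<^sup>2) = pt (turn C i x) (1 - ((- \<i>) ^ i * w)\<^sup>2)"
    if "i \<le> j" "(- \<i>) ^ i * w \<in> Q1" "(- \<i>) ^ j * w \<in> Q1" for i j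
  proof -
    have e: "(- \<i>) ^ (j - i) * ((- \<i>) ^ i * w) = (- \<i>) ^ j * w"
      using that(1) by (simp add: mult.assoc[symmetric] power_add[symmetric])
    have t: "turn C (j - i) (turn C i x) = turn C j x"
      using turn_turn[OF assms(1)] that(1) by simp
    show ?thesis
      using quadrant_glue[of "turn C i x" "(- \<i>) ^ i * w" "j - i"] that assms(1,4)
      unfolding e t norm_minus_i_power by simp
  qed
  show ?thesis using main[of i j] main[of j i] assms by (cases "i \<le> j") auto
qed

text \<open>A point in a corner that is glued to another point lies on one of the two sides there,
  that is on a half axis bounding the quadrant, and the other point lies in the corner on the other
  side of this half axis.\<close>

lemma quadrant_saturated:
  assumes "x \<in> SL" "w \<in> Q1" "norm w < 1" "(spt x (1 - w\<^sup>2), p) \<in> Rg"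
  shows "\<exists>d. (- \<i>) ^ d * w \<in> Q1 \<and> p = spt (turn C d x) (1 - ((- \<i>) ^ d * w)\<^sup>2)"
proof -
  obtain a where a: "0 \<le> a" "w = of_real a \<or> w = \<i> * of_real a"
    using Q1_real_square[OF assms(2) Rg_real[OF assms(1,4)]] by blast
  then have a1: "a < 1" using assms(3) by (auto simp: norm_mult)
  consider "a = 0" | "0 < a" "w = of_real a" | "0 < a" "w = \<i> * of_real a" using a by linarith
  then show ?thesis
  proof cases
    case 1
    then have w: "w = 0" using a by auto
    have "(spt x 1, p) \<in> Rg" using assms(4) w by simp
    then obtain i where "p = spt (turn C i x) 1" using Rg_corner[OF assms(1)] by blast
    then show ?thesis using w by (intro exI[of _ i]) (simp add: Q1_def)
  next
    case 2
    have a2: "0 < a\<^sup>2" "a\<^sup>2 < 1" using 2(1) a1 by (simp_all add: power_less_one_iff)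
    have "1 - w\<^sup>2 = of_real (1 - a\<^sup>2)" using 2 by simp
    then have "p = spt (neg x) (of_real (1 - (1 - a\<^sup>2)))"
      using Rg_inner[OF assms(1), of "1 - a\<^sup>2" p] assms(4) a2 by simp
    moreover have "f (turn C 3 x) = neg x" using f_turn3_neg[of "neg x"] assms(1) by simp
    ultimately have "p = spt (turn C 3 x) (1 + of_real (a\<^sup>2))"
      using spt_Suc[of "turn C 3 x" "of_real (a\<^sup>2)"] assms(1) by simp
    moreover have "1 + of_real (a\<^sup>2) = 1 - ((- \<i>) ^ 3 * w)\<^sup>2"
      unfolding minus_i_power using 2 by (simp add: power_mult_distrib)
    moreover have "(- \<i>) ^ 3 * w \<in> Q1" unfolding minus_i_power using 2 by (simp add: Q1_def)
    ultimately show ?thesis by metis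
  next
    case 3
    have a2: "0 < a\<^sup>2" "a\<^sup>2 < 1" using 3(1) a1 by (simp_all add: power_less_one_iff)
    have "1 - w\<^sup>2 = 1 + of_real (a\<^sup>2)" using 3 by (simp add: power_mult_distrib)
    then have "(spt (f x) (of_real (a\<^sup>2)), p) \<in> Rg"
      using spt_Suc[OF assms(1), of "of_real (a\<^sup>2)"] assms(4) by (simp only:)
    then have "p = spt (neg (f x)) (of_real (1 - a\<^sup>2))"
      using Rg_inner[of "f x" "a\<^sup>2" p] assms(1) a2 by simp
    then have "p = spt (turn C 1 x) (1 - of_real (a\<^sup>2))" unfolding turn_eq_neg_f by simp
    moreover have "1 - of_real (a\<^sup>2) = 1 - ((- \<i>) ^ 1 * w)\<^sup>2"
      unfolding minus_i_power using 3 by (simp add: power_mult_distrib)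
    moreover have "(- \<i>) ^ 1 * w \<in> Q1" unfolding minus_i_power using 3 by (simp add: Q1_def)
    ultimately show ?thesis by metis
  qed
qed

lemma square_ball_image: "(\<lambda>w::complex. w\<^sup>2) ` ball 0 r = ball 0 (r\<^sup>2)" if "0 < r"
proof (intro set_eqI iffI)
  fix z :: complex assume "z \<in> ball 0 (r\<^sup>2)"
  then have "norm z < r\<^sup>2" by simp
  then have "sqrt (norm z) < r" using that real_less_lsqrt by simp
  then have "csqrt z \<in> ball 0 r" by simp
  moreover have "z = (csqrt z)\<^sup>2" by simp
  ultimately show "z \<in> (\<lambda>w. w\<^sup>2) ` ball 0 r" by blast
next
  fix z :: complex assume "z \<in> (\<lambda>w. w\<^sup>2) ` ball 0 r"
  then show "z \<in> ball 0 (r\<^sup>2)" using that by (auto simp: norm_power power_strict_mono)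
qed

lemma norm_square_diff_less:
  fixes w w' :: complex
  assumes "norm w < 1/2" "norm w' < 1/2"
  shows "norm ((1 - w\<^sup>2) - (1 - w'\<^sup>2)) < 1"
proof -
  have "norm (w\<^sup>2) < (1/2)\<^sup>2" "norm (w'\<^sup>2) < (1/2)\<^sup>2"
    using assms by (simp_all only: norm_power) (simp_all add: power_strict_mono)
  moreover have "norm ((1 - w\<^sup>2) - (1 - w'\<^sup>2)) \<le> norm (w\<^sup>2) + norm (w'\<^sup>2)"
    using norm_triangle_ineq4[of "w'\<^sup>2" "w\<^sup>2"] by simp
  ultimately show ?thesis by (simp add: power2_eq_square)
qed

text \<open>Away from 0 the quadrant is cut out of the half plane \<open>H\<close> by the condition that the image
  lies in the disc; the other solution, the opposite quadrant, is not in \<open>H\<close>.  Near 0 both solutions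
  belong to \<open>V\<close> and have the same image, and squaring maps a disc around 0 onto a disc.\<close>

lemma quadrant_open:
  assumes x: "x \<in> SL" and V: "open V" "V \<subseteq> ball 0 (1/2)"
  shows "\<exists>U. open U \<and> (\<lambda>w. pos x (1 - w\<^sup>2)) ` (V \<inter> Q1) = cball 0 1 \<inter> U"
proof -
  let ?h = "\<lambda>w. pos x (1 - w\<^sup>2)"
  define H where "H = {w. 0 < Re w + Im w}"
  have eq: "w\<^sup>2 = w'\<^sup>2" if "w \<in> ball 0 (1/2)" "w' \<in> ball 0 (1/2)" "?h w = ?h w'" for w w'
    using spt_inj[OF x x, of "1 - w\<^sup>2" "1 - w'\<^sup>2"] norm_square_diff_less[of w w'] that by (simp add: spt_def)
  have opH: "open (?h ` (V \<inter> H))"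
  proof (rule open_mapping_thm3)
    show "?h holomorphic_on V \<inter> H" by (intro pos_holomorphic holomorphic_intros)
    have "open H" unfolding H_def by (intro open_Collect_less continuous_intros)
    then show "open (V \<inter> H)" using V(1) by blast
    show "inj_on ?h (V \<inter> H)"
    proof (rule inj_onI)
      fix w w' assume w: "w \<in> V \<inter> H" "w' \<in> V \<inter> H" "?h w = ?h w'"
      then have "w\<^sup>2 = w'\<^sup>2" using eq V(2) by blast
      then have "w = w' \<or> w = - w'" by (simp add: power2_eq_iff)
      then show "w = w'" using w(1,2) by (auto simp: H_def)
    qed
  qed
  have le: "norm (?h w) \<le> 1 \<longleftrightarrow> 0 \<le> Re w * Im w" for w
    unfolding norm_pos_le[OF x] Im_one_minus_square by (simp add: mult.commute)
  have QH: "w \<in> Q1" if "w \<in> H" "norm (?h w) \<le> 1" for w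
    using that by (auto simp: le H_def Q1_def zero_le_mult_iff)
  show ?thesis
  proof (cases "0 \<in> V")
    case False
    have "?h ` (V \<inter> Q1) = cball 0 1 \<inter> ?h ` (V \<inter> H)"
    proof (intro set_eqI iffI)
      fix z assume "z \<in> ?h ` (V \<inter> Q1)"
      then obtain w where w: "w \<in> V" "w \<in> Q1" "z = ?h w" by blast
      then have "w \<noteq> 0" using False by auto
      then have "w \<in> H" using w(2) by (auto simp: H_def Q1_def complex_eq_iff)
      moreover have "norm z \<le> 1" using w le by (simp add: Q1_def)
      ultimately show "z \<in> cball 0 1 \<inter> ?h ` (V \<inter> H)" using w by auto
    qed (use QH in auto)
    then show ?thesis using opH by blast
  next
    case True
    then obtain e where e: "0 < e" "ball 0 e \<subseteq> V" using V(1) openE by blast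
    have e2: "e \<le> 1/2"
    proof (rule ccontr)
      assume "\<not> e \<le> 1/2"
      then have "complex_of_real (1/2) \<in> ball 0 e" by simp
      then have "complex_of_real (1/2) \<in> ball 0 (1/2)" using e V by blast
      then show False by simp
    qed
    have "?h ` ball 0 e = (\<lambda>u. pos x (1 - u)) ` ((\<lambda>w. w\<^sup>2) ` ball 0 e)" by (simp add: image_image)
    also have "open \<dots>"
    proof (rule open_mapping_thm3)
      show "(\<lambda>u. pos x (1 - u)) holomorphic_on (\<lambda>w. w\<^sup>2) ` ball 0 e"
        by (intro pos_holomorphic holomorphic_intros)
      show "open ((\<lambda>w::complex. w\<^sup>2) ` ball 0 e)" using square_ball_image[OF e(1)] by simp
      show "inj_on (\<lambda>u. pos x (1 - u)) ((\<lambda>w. w\<^sup>2) ` ball 0 e)"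
      proof (rule inj_onI)
        fix u u' assume u: "u \<in> (\<lambda>w. w\<^sup>2) ` ball 0 e" "u' \<in> (\<lambda>w. w\<^sup>2) ` ball 0 e" "pos x (1 - u) = pos x (1 - u')"
        then obtain w w' where w: "u = w\<^sup>2" "u' = w'\<^sup>2" "w \<in> ball 0 e" "w' \<in> ball 0 e" by blast
        then have "w \<in> ball 0 (1/2)" "w' \<in> ball 0 (1/2)" using e2 by auto
        then show "u = u'" using eq[of w w'] u(3) w(1,2) by blast
      qed
    qed
    finally have op0: "open (?h ` ball 0 e)" .
    have "?h ` (V \<inter> Q1) = cball 0 1 \<inter> (?h ` (V \<inter> H) \<union> ?h ` ball 0 e)"
    proof (intro set_eqI iffI)
      fix z assume "z \<in> ?h ` (V \<inter> Q1)"
      then obtain w where w: "w \<in> V" "w \<in> Q1" "z = ?h w" by blast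
      have "w \<in> H \<or> w = 0" using w(2) by (auto simp: H_def Q1_def complex_eq_iff)
      moreover have "norm z \<le> 1" using w le by (simp add: Q1_def)
      ultimately show "z \<in> cball 0 1 \<inter> (?h ` (V \<inter> H) \<union> ?h ` ball 0 e)" using w e(1) by auto
    next
      fix z assume z: "z \<in> cball 0 1 \<inter> (?h ` (V \<inter> H) \<union> ?h ` ball 0 e)"
      then consider w where "w \<in> V" "w \<in> H" "z = ?h w" | w where "w \<in> ball 0 e" "z = ?h w" by blast
      then show "z \<in> ?h ` (V \<inter> Q1)"
      proof cases
        case 1
        then show ?thesis using z QH by auto
      next
        case 2
        then have "norm (?h w) \<le> 1" using z by simp
        then have "0 \<le> Re w * Im w" by (simp only: le)
        then have "w \<in> Q1 \<or> - w \<in> Q1" by (auto simp: Q1_def zero_le_mult_iff)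
        moreover have "w \<in> V" "- w \<in> V" using 2 e(2) by auto
        moreover have "z = ?h (- w)" using 2 by simp
        ultimately show ?thesis using 2(2) by blast
      qed
    qed
    then show ?thesis using opH op0 by blast
  qed
qed

lemma conf_par_vertex:
  assumes x: "x \<in> SL"
  shows "conf_par (ball 0 (1/2)) (vpt x)"
    and "norm w < 1/2 \<Longrightarrow> (- \<i>) ^ j * w \<in> Q1 \<Longrightarrow> vpt x w = pt (turn C j x) (1 - ((- \<i>) ^ j * w)\<^sup>2)"
proof -
  let ?W = "ball 0 (1/2) :: complex set"
  define q where "q j w = (- \<i>) ^ j * w" for j and w :: complex
  define K where "K j = {w. q j w \<in> Q1}" for j
  define y where "y j = turn C j x" for j
  define E where "E j w = pos (y j) (1 - (q j w)\<^sup>2)" for j w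
  have y: "y i \<in> SL" for i using x by (simp add: y_def)
  have nq: "norm (q j w) = norm w" for j w unfolding q_def by (rule norm_minus_i_power)
  have q_hol: "(\<lambda>w. 1 - (q j w)\<^sup>2) holomorphic_on S" for j S
    unfolding q_def by (intro holomorphic_intros)
  have coh: "pt (y i) (1 - (q i w)\<^sup>2) = pt (y j) (1 - (q j w)\<^sup>2)" if "w \<in> K i" "w \<in> K j" "norm w < 1" for i j w
    using quadrant_coherent[OF x, of i w j] that by (simp add: y_def q_def K_def)
  have norm_le: "norm (E j w) \<le> 1" if "w \<in> K j" for j w
    using that unfolding E_def norm_pos_le[OF y] Im_one_minus_square by (simp add: K_def Q1_def)
  have interior: "{w \<in> S \<inter> K i. norm (E i w) < 1} = S \<inter> {w. 0 < Re (q i w) \<and> 0 < Im (q i w)}" for S i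
  proof -
    have "w \<in> K i \<and> norm (E i w) < 1 \<longleftrightarrow> 0 < Re (q i w) \<and> 0 < Im (q i w)" for w
      unfolding E_def norm_pos_less[OF y] Im_one_minus_square
      by (auto simp: K_def Q1_def zero_less_mult_iff)
    then show ?thesis by blast
  qed
  interpret p: pieces \<mu> n C b ?W "{..<4}" K "\<lambda>i. orbit f (y i)" E
  proof
    show "open ?W" by simp
    show "orbit f (y i) \<in> Fs" for i using y by simp
    show "closed (K i)" for i
      unfolding K_def q_def Q1_def mem_Collect_eq
      by (intro closed_Collect_conj closed_Collect_le continuous_intros)
    show "?W \<subseteq> (\<Union>i\<in>{..<4}. K i)" using quadrant_cover by (auto simp: K_def q_def)
    show "E i holomorphic_on ?W" for i
      unfolding E_def[abs_def] by (intro pos_holomorphic q_hol)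
    show "norm (E i w) \<le> 1" if "w \<in> K i" for i w using norm_le[OF that] .
  next
    fix i j w w' assume ij: "i \<in> {..<4}" "j \<in> {..<4}" "w \<in> ?W" "w' \<in> ?W" "w \<in> K i" "w' \<in> K j"
      "orbit f (y i) = orbit f (y j)" "E i w = E j w'"
    then have "spt (y i) (1 - (q i w)\<^sup>2) = spt (y j) (1 - (q j w')\<^sup>2)" by (simp add: spt_def E_def)
    moreover have "norm ((1 - (q i w)\<^sup>2) - (1 - (q j w')\<^sup>2)) < 1"
      by (rule norm_square_diff_less) (use ij(3,4) nq in simp_all)
    ultimately have "y i = y j \<and> 1 - (q i w)\<^sup>2 = 1 - (q j w')\<^sup>2" using spt_inj[OF y y] by blast
    then have yy: "y i = y j" "(q i w)\<^sup>2 = (q j w')\<^sup>2" by simp_all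
    have "i mod 4 = j mod 4" using yy(1) unfolding y_def by (rule turn_inj[OF x])
    then have i: "i = j" using ij(1,2) by simp
    have "q i w = q j w' \<or> q i w = - q j w'" using yy(2) by (simp add: power2_eq_iff)
    then have "q i w = q j w'" using ij(5,6) by (auto simp: K_def Q1_def complex_eq_iff)
    then show "w = w'" by (simp add: i q_def)
  next
    fix i j w assume "w \<in> ?W" "w \<in> K i" "w \<in> K j"
    then show "pr (orbit f (y i), E i w) = pr (orbit f (y j), E j w)"
      using coh[of w i j] by (simp add: pt_def spt_def E_def)
  next
    fix i w p assume i: "i \<in> {..<4}" "w \<in> ?W" "w \<in> K i" "((orbit f (y i), E i w), p) \<in> Rg"
    then have g: "(spt (y i) (1 - (q i w)\<^sup>2), p) \<in> Rg" by (simp add: spt_def E_def)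
    moreover have "norm (q i w) < 1" using i(2) by (simp add: nq)
    ultimately obtain d where d: "(- \<i>) ^ d * q i w \<in> Q1"
      "p = spt (turn C d (y i)) (1 - ((- \<i>) ^ d * q i w)\<^sup>2)"
      using quadrant_saturated[OF y, of "q i w" i p] i(3) by (auto simp: K_def)
    let ?j = "(d + i) mod 4"
    have "(- \<i>) ^ d * q i w = q ?j w"
      unfolding q_def minus_i_power_mod by (simp add: power_add mult.assoc)
    moreover have "turn C d (y i) = y ?j"
      unfolding y_def using turn_turn[OF x] turn_mod[OF x] by simp
    ultimately have "w \<in> K ?j \<and> p = (orbit f (y ?j), E ?j w)"
      using d by (simp add: K_def spt_def E_def)
    then show "\<exists>j\<in>{..<4}. w \<in> K j \<and> p = (orbit f (y j), E j w)"
      by (intro bexI[of _ ?j]) auto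
  next
    fix i V assume V: "open V" "V \<subseteq> ?W"
    have qinv: "q i ((\<i>) ^ i * w) = w" for w
      by (simp add: q_def mult.assoc[symmetric] power_mult_distrib[symmetric])
    have "q i ` V = (\<lambda>w. \<i> ^ i * w) -` V"
    proof (intro set_eqI iffI)
      fix w assume "w \<in> q i ` V"
      then show "w \<in> (\<lambda>w. \<i> ^ i * w) -` V"
        by (auto simp: q_def mult.assoc[symmetric] power_mult_distrib[symmetric])
    next
      fix w assume "w \<in> (\<lambda>w. \<i> ^ i * w) -` V"
      then show "w \<in> q i ` V" using qinv[of w] by (metis image_eqI vimage_eq)
    qed
    also have "open \<dots>"
      by (rule open_vimage[OF V(1)]) (intro continuous_intros)
    finally have op: "open (q i ` V)" .
    have "q i ` V \<subseteq> ?W" using V(2) nq by auto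
    from quadrant_open[OF y op this]
    obtain U where "open U" "(\<lambda>w. pos (y i) (1 - w\<^sup>2)) ` (q i ` V \<inter> Q1) = cball 0 1 \<inter> U" by blast
    moreover have "(\<lambda>w. pos (y i) (1 - w\<^sup>2)) ` (q i ` V \<inter> Q1) = E i ` (V \<inter> K i)"
      by (auto simp: E_def K_def)
    ultimately show "\<exists>U. open U \<and> E i ` (V \<inter> K i) = cball 0 1 \<inter> U" by auto
  next
    show "open {w \<in> ?W \<inter> K i. norm (E i w) < 1}" for i
      unfolding interior q_def
      by (intro open_Int open_ball open_Collect_conj open_Collect_less continuous_intros)
  next
    fix S h assume S: "open S" "S \<subseteq> ?W" "continuous_on S h"
      and "\<And>i. i \<in> {..<4} \<Longrightarrow> h holomorphic_on {w \<in> S \<inter> K i. norm (E i w) < 1}"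
    then have h: "h holomorphic_on S \<inter> {w. 0 < Re (q i w) \<and> 0 < Im (q i w)}" if "i < 4" for i
      using that unfolding interior by simp
    have q0: "q 0 w = w" "q 1 w = - \<i> * w" "q 2 w = - w" "q 3 w = \<i> * w" for w
      unfolding q_def minus_i_power by simp_all
    \<comment> \<open>First across the imaginary axis, in the upper and in the lower half plane, then across the
      real axis: this also covers the origin.\<close>
    have up: "h holomorphic_on S \<inter> {w. 0 < Im w}"
    proof (rule holomorphic_on_paste_across_line[of _ 1 h 0])
      show "open (S \<inter> {w. 0 < Im w})"
        by (intro open_Int S open_Collect_less continuous_intros)
      show "h holomorphic_on S \<inter> {w. 0 < Im w} \<inter> {z. 1 \<bullet> z < 0}"
        by (rule holomorphic_on_subset[OF h[of 1]]) (auto simp: q0 q0(2)[unfolded One_nat_def])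
      show "h holomorphic_on S \<inter> {w. 0 < Im w} \<inter> {z. 0 < 1 \<bullet> z}"
        by (rule holomorphic_on_subset[OF h[of 0]]) (auto simp: q0)
      show "continuous_on (S \<inter> {w. 0 < Im w}) h"
        using S(3) by (rule continuous_on_subset) auto
    qed auto
    have down: "h holomorphic_on S \<inter> {w. Im w < 0}"
    proof (rule holomorphic_on_paste_across_line[of _ 1 h 0])
      show "open (S \<inter> {w. Im w < 0})"
        by (intro open_Int S open_Collect_less continuous_intros)
      show "h holomorphic_on S \<inter> {w. Im w < 0} \<inter> {z. 1 \<bullet> z < 0}"
        by (rule holomorphic_on_subset[OF h[of 2]]) (auto simp: q0)
      show "h holomorphic_on S \<inter> {w. Im w < 0} \<inter> {z. 0 < 1 \<bullet> z}"
        by (rule holomorphic_on_subset[OF h[of 3]]) (auto simp: q0)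
      show "continuous_on (S \<inter> {w. Im w < 0}) h"
        using S(3) by (rule continuous_on_subset) auto
    qed auto
    show "h holomorphic_on S"
    proof (rule holomorphic_on_paste_across_line[of S \<i> h 0])
      show "h holomorphic_on (S \<inter> {z. \<i> \<bullet> z < 0})" using down by simp
      show "h holomorphic_on (S \<inter> {z. 0 < \<i> \<bullet> z})" using up by simp
    qed (use S in auto)
  qed auto
  have vpt: "vpt x w = pt (y j) (1 - (q j w)\<^sup>2)" if "norm w < 1" "w \<in> K j" for w j
  proof -
    let ?j = "SOME j. j < 4 \<and> (- \<i>) ^ j * w \<in> Q1"
    have "?j < 4 \<and> (- \<i>) ^ ?j * w \<in> Q1"
      by (rule someI_ex) (use quadrant_cover in blast)
    then have "w \<in> K ?j" by (simp add: K_def q_def)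
    then have "pt (y ?j) (1 - (q ?j w)\<^sup>2) = pt (y j) (1 - (q j w)\<^sup>2)" using coh that by blast
    then show ?thesis by (simp add: vpt_def Let_def y_def q_def)
  qed
  then show "norm w < 1/2 \<Longrightarrow> (- \<i>) ^ j * w \<in> Q1 \<Longrightarrow> vpt x w = pt (turn C j x) (1 - ((- \<i>) ^ j * w)\<^sup>2)"
    by (simp add: K_def q_def y_def)
  have "p.P w = vpt x w" if "w \<in> ?W" for w
  proof -
    obtain i where "i < 4" "w \<in> K i" using quadrant_cover[of w] by (auto simp: K_def q_def)
    then show ?thesis using p.P_eq[of i w] vpt[of w i] that by (simp add: pt_def spt_def E_def)
  qed
  then show "conf_par ?W (vpt x)" using p.conf_par_P by (rule conf_par_cong[rotated])
qed

section \<open>The conformal atlas\<close>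

text \<open>Domains and maps of the coordinates, one for each polygon, edge side and edge end.\<close>

definition std :: "(complex set \<times> (complex \<Rightarrow> point)) set" where
  "std = (\<lambda>F. (ball 0 1, \<lambda>z. pr (F, z))) ` Fs \<union> (\<lambda>x. (strip, ept x)) ` SL \<union>
     (\<lambda>x. (ball 0 (1/2), vpt x)) ` SL"

lemma finite_std: "finite std"
  by (simp add: std_def)

lemma std_conf_par: "(W, P) \<in> std \<Longrightarrow> conf_par W P"
  unfolding std_def using conf_par_face conf_par_edge(1) conf_par_vertex(1) by auto

lemma vpt_0: "x \<in> SL \<Longrightarrow> vpt x 0 = pt x 1"
  using conf_par_vertex(2)[of x 0 0] by (simp add: Q1_def)

lemma ept_real: "x \<in> SL \<Longrightarrow> 0 < u \<Longrightarrow> u < 1 \<Longrightarrow> ept x (of_real u) = pt x (of_real u)"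
  using conf_par_edge(2)[of x "of_real u"] by (simp add: strip_def)

lemma std_coverI: "(W, P) \<in> std \<Longrightarrow> w \<in> W \<Longrightarrow> p = P w \<Longrightarrow> \<exists>(W, P)\<in>std. p \<in> P ` W"
  by (rule bexI[of _ "(W, P)"]) auto

text \<open>A point inside a polygon has a face coordinate; a boundary point lies on a side,
  and either inside it, on an edge, or at its beginning, at a vertex.\<close>

lemma std_cover:
  assumes "p \<in> topspace X"
  shows "\<exists>(W, P)\<in>std. p \<in> P ` W"
proof -
  obtain F z where F: "F \<in> Fs" "norm z \<le> 1" "p = pr (F, z)"
    using assms by (auto simp: topspace_X)
  show ?thesis
  proof (cases "norm z < 1")
    case True
    have "(ball 0 1, \<lambda>z. pr (F, z)) \<in> std" using F(1) by (simp add: std_def)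
    then show ?thesis by (rule std_coverI[of _ _ z]) (use True F in auto)
  next
    case False
    then have nz: "norm z = 1" using F(2) by simp
    obtain x where x: "x \<in> SL" "F = orbit f x" using F(1) by (auto simp: faces_def)
    have "z \<noteq> 0" using nz by auto
    from pos_surj[OF x(1) this]
    obtain y u where y: "y \<in> orbit f x" "0 \<le> Re u" "Re u < 1" "(orbit f x, z) = spt y u"
      by (elim bexE exE conjE)
    have ySL: "y \<in> SL" using y(1) orbit_subset_SL[OF x(1)] by blast
    have "norm (pos y u) = 1" using y(4) nz by (simp add: spt_def)
    then have "Im u = 0"
      using norm_pos_le[OF ySL, of u] norm_pos_less[OF ySL, of u] by linarith
    then have u: "u = of_real (Re u)" by (rule real_complex)
    have p: "p = pt y (of_real (Re u))" using F(3) x(2) y(4) u by (simp add: pt_def)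
    show ?thesis
    proof (cases "Re u = 0")
      case True
      let ?y = "turn C 3 (neg y)"
      have y': "?y \<in> SL" "f ?y = y" using ySL by simp_all
      have "p = vpt ?y 0" unfolding vpt_0[OF y'(1)] using pt_Suc[OF y'(1), of 0] p True y'(2) by simp
      moreover have "(ball 0 (1/2), vpt ?y) \<in> std" using y'(1) by (simp add: std_def)
      ultimately show ?thesis by (intro std_coverI[of "ball 0 (1/2)" "vpt ?y" 0]) auto
    next
      case False
      then have "p = ept y (of_real (Re u))" using ept_real[OF ySL, of "Re u"] y(2,3) p by simp
      moreover have "complex_of_real (Re u) \<in> strip" using False y(2,3) by (simp add: strip_def)
      moreover have "(strip, ept y) \<in> std" using ySL by (simp add: std_def)
      ultimately show ?thesis by (intro std_coverI[of strip "ept y"])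
    qed
  qed
qed

lemma second_countable_X: "second_countable X"
proof -
  obtain B :: "complex set set" where B: "countable B" "topological_basis B"
    using ex_countable_basis by blast
  define BB where "BB = (\<Union>(W, P)\<in>std. (\<lambda>U. P ` (W \<inter> U)) ` B)"
  have "countable BB"
    unfolding BB_def
    by (rule countable_UN[OF countable_finite[OF finite_std]])
      (simp add: case_prod_unfold countable_image[OF B(1)])
  moreover have "openin X V" if V: "V \<in> BB" for V
  proof -
    obtain W P U where WPU: "(W, P) \<in> std" "U \<in> B" "V = P ` (W \<inter> U)"
      using V by (auto simp: BB_def)
    have "open U" using B(2) WPU(2) by (rule topological_basis_open)
    moreover have "conf_par W P" by (rule std_conf_par[OF WPU(1)])
    ultimately show ?thesis unfolding WPU(3) conf_par_def by (simp add: open_Int)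
  qed
  moreover have "\<exists>V\<in>BB. x \<in> V \<and> V \<subseteq> U" if U: "openin X U" "x \<in> U" for U x
  proof -
    have "x \<in> topspace X" using U openin_subset by blast
    then obtain W P where WP: "(W, P) \<in> std" "x \<in> P ` W" using std_cover by blast
    then obtain w where w: "w \<in> W" "x = P w" by blast
    have "open {w \<in> W. P w \<in> U}" using std_conf_par[OF WP(1)] U(1) by (simp add: conf_par_def)
    moreover have "w \<in> {w \<in> W. P w \<in> U}" using w U(2) by simp
    ultimately obtain A where A: "A \<in> B" "w \<in> A" "A \<subseteq> {w \<in> W. P w \<in> U}"
      using topological_basisE[OF B(2)] by blast
    have "P ` (W \<inter> A) \<in> BB" using A(1) WP(1) by (auto simp: BB_def)
    moreover have "x \<in> P ` (W \<inter> A)" using w A(2) by blast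
    moreover have "P ` (W \<inter> A) \<subseteq> U" using A(3) by auto
    ultimately show ?thesis by (intro bexI[of _ "P ` (W \<inter> A)"] conjI)
  qed
  ultimately show ?thesis unfolding second_countable_def by blast
qed

definition conf_chart :: "point set \<Rightarrow> (point \<Rightarrow> complex) \<Rightarrow> bool" where
  "conf_chart V g \<longleftrightarrow> conf_fun V g \<and> inj_on g V"

lemma conf_chartD:
  assumes "conf_chart V g"
  shows "openin X V" "conf_fun V g" "inj_on g V" "V \<subseteq> topspace X"
  using assms openin_subset by (auto simp: conf_chart_def conf_fun_def)

lemma conf_fun_subset:
  assumes "conf_fun V g" "openin X U" "U \<subseteq> V"
  shows "conf_fun U g"
  unfolding conf_fun_def
proof (intro conjI ballI)
  show "continuous_map (subtopology X U) euclidean g"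
    using assms(1) continuous_map_from_subtopology_mono[OF _ assms(3)] unfolding conf_fun_def by blast
  fix F assume "F \<in> Fs"
  then have "(\<lambda>z. g (pr (F, z))) holomorphic_on {z \<in> ball 0 1. pr (F, z) \<in> V}"
    using assms(1) by (simp add: conf_fun_def)
  then show "(\<lambda>z. g (pr (F, z))) holomorphic_on {z \<in> ball 0 1. pr (F, z) \<in> U}"
    by (rule holomorphic_on_subset) (use assms(3) in auto)
qed (rule assms(2))

lemma conf_par_chart:
  assumes "conf_par W P"
  shows "is_chart X (P ` W, inv_into W P)" "conf_chart (P ` W) (inv_into W P)"
    "inv_into W P ` (P ` W) = W"
proof -
  have W: "open W" "inj_on P W" "P ` W \<subseteq> topspace X" and
    op: "\<And>V. open V \<Longrightarrow> V \<subseteq> W \<Longrightarrow> openin X (P ` V)" and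
    ct: "\<And>U. openin X U \<Longrightarrow> open {w \<in> W. P w \<in> U}"
    using assms by (auto simp: conf_par_def)
  let ?g = "inv_into W P"
  have opW: "openin X (P ` W)" by (rule op[OF W(1) order_refl])
  show img: "?g ` (P ` W) = W" using W(2) by (simp add: inv_into_image_cancel)
  have cont: "continuous_map (subtopology X (P ` W)) euclidean ?g"
    unfolding continuous_map_def
  proof (intro conjI allI impI)
    fix V :: "complex set" assume "openin euclidean V"
    then have "openin X (P ` (W \<inter> V))" using op[of "W \<inter> V"] W(1) by (simp add: open_Int)
    moreover have "{x \<in> topspace (subtopology X (P ` W)). ?g x \<in> V} = P ` (W \<inter> V)"
    proof (intro set_eqI iffI)
      fix p assume "p \<in> {x \<in> topspace (subtopology X (P ` W)). ?g x \<in> V}"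
      then obtain w where "w \<in> W" "p = P w" "?g p \<in> V" by auto
      then show "p \<in> P ` (W \<inter> V)" using inv_into_f_f[OF W(2)] by auto
    next
      fix p assume "p \<in> P ` (W \<inter> V)"
      then show "p \<in> {x \<in> topspace (subtopology X (P ` W)). ?g x \<in> V}"
        using inv_into_f_f[OF W(2)] W(3) by auto
    qed
    ultimately show "openin (subtopology X (P ` W)) {x \<in> topspace (subtopology X (P ` W)). ?g x \<in> V}"
      using opW by (auto simp: openin_open_subtopology)
  qed simp
  have contP: "continuous_map (top_of_set W) (subtopology X (P ` W)) P"
    unfolding continuous_map_in_subtopology
  proof
    show "continuous_map (top_of_set W) X P"
      unfolding continuous_map_def
    proof (intro conjI allI impI)
      fix U assume "openin X U"
      then have "open {w \<in> W. P w \<in> U}" by (rule ct)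
      then show "openin (top_of_set W) {x \<in> topspace (top_of_set W). P x \<in> U}"
        using W(1) by (auto simp: openin_open_eq)
    qed (use W in auto)
  qed auto
  have "homeomorphic_maps (subtopology X (P ` W)) (top_of_set W) ?g P"
    unfolding homeomorphic_maps_def
  proof (intro conjI ballI)
    show "continuous_map (subtopology X (P ` W)) (top_of_set W) ?g"
      using cont img by (auto simp: continuous_map_in_subtopology)
    show "P (?g x) = x" if "x \<in> topspace (subtopology X (P ` W))" for x
      using that by (auto simp: f_inv_into_f)
    show "?g (P y) = y" if "y \<in> topspace (top_of_set W)" for y
      using that by (simp add: inv_into_f_f[OF W(2)])
  qed (rule contP)
  then show "is_chart X (P ` W, ?g)"
    unfolding is_chart_def using opW W(1) img homeomorphic_map_maps[THEN iffD2, OF exI] by simp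
  have "\<And>F. F \<in> Fs \<Longrightarrow> (\<lambda>z. ?g (pr (F, z))) holomorphic_on {z \<in> ball 0 1. pr (F, z) \<in> P ` W}"
    using assms by (simp add: conf_par_def)
  then show "conf_chart (P ` W) ?g"
    unfolding conf_chart_def conf_fun_def using opW cont by (simp add: inj_on_inv_into)
qed

lemma conf_fun_par:
  assumes "conf_par W P" "conf_fun V g"
  shows "open {w \<in> W. P w \<in> V}" "(\<lambda>w. g (P w)) holomorphic_on {w \<in> W. P w \<in> V}"
  using assms by (auto simp: conf_par_def conf_fun_def)

lemma conf_chart_par_inj:
  assumes "conf_par W P" "inj_on g V"
  shows "inj_on (\<lambda>w. g (P w)) {w \<in> W. P w \<in> V}"
proof (rule inj_onI)
  fix w w' assume w: "w \<in> {w \<in> W. P w \<in> V}" "w' \<in> {w \<in> W. P w \<in> V}" "g (P w) = g (P w')"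
  then have "P w = P w'" using inj_onD[OF assms(2)] by simp
  moreover have "inj_on P W" using assms(1) by (simp add: conf_par_def)
  ultimately show "w = w'" using inj_onD w(1,2) by fastforce
qed

text \<open>In the coordinate \<open>P\<close> both functions are holomorphic, and the first is injective, so it has a
  holomorphic inverse.\<close>

lemma conf_transition_par:
  assumes "(W, P) \<in> std" "conf_chart U g" "conf_fun V h"
  defines "S \<equiv> (\<lambda>w. g (P w)) ` {w \<in> W. P w \<in> U \<inter> V}"
  shows "open S" "(\<lambda>z. h (inv_into U g z)) holomorphic_on S"
proof -
  let ?T = "{w \<in> W. P w \<in> U \<inter> V}"
  have par: "conf_par W P" by (rule std_conf_par[OF assms(1)])
  have op: "openin X (U \<inter> V)" using assms(2,3) by (auto simp: conf_chart_def conf_fun_def)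
  have g: "conf_fun (U \<inter> V) g" using conf_fun_subset[OF conf_chartD(2)[OF assms(2)] op] by blast
  have h: "conf_fun (U \<inter> V) h" using conf_fun_subset[OF assms(3) op] by blast
  have inj: "inj_on (\<lambda>w. g (P w)) ?T"
    by (rule conf_chart_par_inj[OF par]) (rule inj_on_subset[OF conf_chartD(3)[OF assms(2)]], simp)
  show "open S" unfolding S_def
    by (rule open_mapping_thm3[OF conf_fun_par(2,1)[OF par g] inj])
  obtain e where e: "e holomorphic_on S"
    "\<And>w. w \<in> ?T \<Longrightarrow> deriv (\<lambda>w. g (P w)) w * deriv e (g (P w)) = 1"
    "\<And>w. w \<in> ?T \<Longrightarrow> e (g (P w)) = w"
    by (rule holomorphic_has_inverse[OF conf_fun_par(2,1)[OF par g] inj, folded S_def]) (rule that)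
  have "(\<lambda>z. h (P (e z))) holomorphic_on S"
    by (rule holomorphic_on_compose_gen[OF e(1) conf_fun_par(2)[OF par h], unfolded o_def])
      (use e(3) in \<open>auto simp: S_def\<close>)
  then show "(\<lambda>z. h (inv_into U g z)) holomorphic_on S"
  proof (rule holomorphic_transform)
    fix z assume "z \<in> S"
    then obtain w where w: "w \<in> ?T" "z = g (P w)" by (auto simp: S_def)
    then show "h (P (e z)) = h (inv_into U g z)"
      using e(3)[OF w(1)] inv_into_f_f[OF conf_chartD(3)[OF assms(2)], of "P w"] by simp
  qed
qed

lemma conf_transition:
  assumes "conf_chart U g" "conf_fun V h"
  shows "open (g ` (U \<inter> V))" "(\<lambda>z. h (inv_into U g z)) holomorphic_on g ` (U \<inter> V)"
proof -
  have eq: "g ` (U \<inter> V) = (\<Union>(W, P)\<in>std. (\<lambda>w. g (P w)) ` {w \<in> W. P w \<in> U \<inter> V})"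
  proof (intro set_eqI iffI)
    fix z assume "z \<in> g ` (U \<inter> V)"
    then obtain p where p: "p \<in> U \<inter> V" "z = g p" by blast
    then have "p \<in> topspace X" using conf_chartD(4)[OF assms(1)] by blast
    then obtain W P where WP: "(W, P) \<in> std" "p \<in> P ` W" using std_cover by blast
    then obtain w where "w \<in> W" "p = P w" by blast
    then have "z \<in> (\<lambda>w. g (P w)) ` {w \<in> W. P w \<in> U \<inter> V}" using p by blast
    then show "z \<in> (\<Union>(W, P)\<in>std. (\<lambda>w. g (P w)) ` {w \<in> W. P w \<in> U \<inter> V})" using WP(1) by blast
  qed auto
  show "open (g ` (U \<inter> V))"
    unfolding eq using conf_transition_par(1)[OF _ assms] by (auto intro!: open_UN)
  show "(\<lambda>z. h (inv_into U g z)) holomorphic_on g ` (U \<inter> V)"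
    unfolding eq
    by (rule holomorphic_on_UN_open) (use conf_transition_par[OF _ assms] in auto)
qed

lemma conf_transition_inj:
  assumes "conf_chart U g" "inj_on h V"
  shows "inj_on (\<lambda>z. h (inv_into U g z)) (g ` (U \<inter> V))"
proof (rule inj_onI)
  fix z z' assume "z \<in> g ` (U \<inter> V)" "z' \<in> g ` (U \<inter> V)" "h (inv_into U g z) = h (inv_into U g z')"
  then show "z = z'"
    using inv_into_f_f[OF conf_chartD(3)[OF assms(1)]] inj_onD[OF assms(2)] by fastforce
qed

text \<open>Two charts that are holomorphic inside all polygons are compatible, whatever smoothing
  they come from.\<close>

lemma conf_oriented_smooth:
  assumes "conf_chart U g" "conf_chart V h"
  shows "oriented_smooth_on (h \<circ> inv_into U g) (g ` (U \<inter> V))"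
  unfolding o_def
  by (rule oriented_smooth_on_holomorphic[OF conf_transition[OF assms(1) conf_chartD(2)[OF assms(2)]]
        conf_transition_inj[OF assms(1) conf_chartD(3)[OF assms(2)]]])

definition std_atlas :: "point chart set" where
  "std_atlas = (\<lambda>(W, P). (P ` W, inv_into W P)) ` std"

lemma std_atlas_cases:
  assumes "(U, \<phi>) \<in> std_atlas"
  obtains W P where "(W, P) \<in> std" "conf_par W P" "U = P ` W" "\<phi> = inv_into W P" "conf_chart U \<phi>" "is_chart X (U, \<phi>)"
proof -
  obtain W P where "(W, P) \<in> std" "U = P ` W" "\<phi> = inv_into W P"
    using assms by (auto simp: std_atlas_def)
  then show thesis using that std_conf_par conf_par_chart by metis
qed

lemma smoothing_std_atlas: "smoothing \<mu> n C b std_atlas"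
  unfolding smoothing_def oriented_smooth_surface_def
proof (intro conjI ballI)
  show "(\<Union>\<kappa>\<in>std_atlas. fst \<kappa>) = topspace X"
  proof
    show "(\<Union>\<kappa>\<in>std_atlas. fst \<kappa>) \<subseteq> topspace X"
      by (auto elim!: std_atlas_cases dest!: conf_chartD(4))
    show "topspace X \<subseteq> (\<Union>\<kappa>\<in>std_atlas. fst \<kappa>)"
    proof
      fix p assume "p \<in> topspace X"
      then obtain W P where "(W, P) \<in> std" "p \<in> P ` W" using std_cover by blast
      then have "(P ` W, inv_into W P) \<in> std_atlas" by (auto simp: std_atlas_def)
      then show "p \<in> (\<Union>\<kappa>\<in>std_atlas. fst \<kappa>)" using \<open>p \<in> P ` W\<close> by (metis UN_I fst_conv)
    qed
  qed
  show "is_chart X \<kappa>" if "\<kappa> \<in> std_atlas" for \<kappa>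
    using that by (cases \<kappa>) (auto elim!: std_atlas_cases)
  show "case \<kappa> of (U, \<phi>) \<Rightarrow> \<forall>(V, \<psi>)\<in>std_atlas. oriented_smooth_on (\<psi> \<circ> inv_into U \<phi>) (\<phi> ` (U \<inter> V))"
    if "\<kappa> \<in> std_atlas" for \<kappa>
    using that by (cases \<kappa>) (auto elim!: std_atlas_cases intro!: conf_oriented_smooth)
  show "case \<kappa> of (U, \<phi>) \<Rightarrow> (\<lambda>z. \<phi> (pr (F, z))) holomorphic_on {z \<in> ball 0 1. pr (F, z) \<in> U}"
    if "F \<in> Fs" "\<kappa> \<in> std_atlas" for F \<kappa>
    using that by (cases \<kappa>) (auto elim!: std_atlas_cases simp: conf_chart_def conf_fun_def)
qed (use Hausdorff_X second_countable_X in auto)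

lemma smoothing_conf_chart:
  assumes "smoothing \<mu> n C b A" "(U, \<phi>) \<in> A"
  shows "conf_chart U \<phi>"
proof -
  have ch: "is_chart X (U, \<phi>)" using assms by (auto simp: smoothing_def oriented_smooth_surface_def)
  then have op: "openin X U" and hom: "homeomorphic_map (subtopology X U) (top_of_set (\<phi> ` U)) \<phi>"
    by (auto simp: is_chart_def)
  have "topspace (subtopology X U) = U" using openin_subset[OF op] by auto
  then have inj: "inj_on \<phi> U" using homeomorphic_imp_injective_map[OF hom] by simp
  have "continuous_map (subtopology X U) euclidean \<phi>"
    using homeomorphic_imp_continuous_map[OF hom] by (simp add: continuous_map_in_subtopology)
  then show ?thesis
    unfolding conf_chart_def conf_fun_def using op inj assms by (auto simp: smoothing_def)
qed

lemma smoothing_cover: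
  assumes "smoothing \<mu> n C b A" "p \<in> topspace X"
  obtains U \<phi> where "(U, \<phi>) \<in> A" "p \<in> U"
proof -
  have "(\<Union>\<kappa>\<in>A. fst \<kappa>) = topspace X"
    using assms(1) by (simp add: smoothing_def oriented_smooth_surface_def)
  then obtain \<kappa> where "\<kappa> \<in> A" "p \<in> fst \<kappa>" using assms(2) by blast
  then show thesis using that[of "fst \<kappa>" "snd \<kappa>"] by simp
qed

section \<open>Curves in the surface\<close>

lemma conf_regular_curve:
  fixes \<gamma> :: "real \<Rightarrow> point"
  assumes "conf_chart U g" "conf_chart V h" "open T" "\<gamma> ` T \<subseteq> U \<inter> V"
    "regular_curve (\<lambda>t. g (\<gamma> t)) T"
  shows "regular_curve (\<lambda>t. h (\<gamma> t)) T"
proof -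
  have "regular_curve (\<lambda>t. h (inv_into U g (g (\<gamma> t)))) T"
    by (rule regular_curve_holomorphic_compose[OF
        conf_transition[OF assms(1) conf_chartD(2)[OF assms(2)]]
        conf_transition_inj[OF assms(1) conf_chartD(3)[OF assms(2)]] assms(3,5)])
      (use assms(4) in auto)
  then show ?thesis
  proof (rule regular_curve_cong[OF assms(3), rotated])
    fix s assume "s \<in> T"
    then have "\<gamma> s \<in> U" using assms(4) by blast
    then show "h (inv_into U g (g (\<gamma> s))) = h (\<gamma> s)"
      using inv_into_f_f[OF conf_chartD(3)[OF assms(1)]] by simp
  qed
qed

text \<open>All velocities at a vertex are read off from the vertex coordinate.\<close>

lemma vertex_velocity:
  assumes "x \<in> SL" "conf_chart V h" "pt x 1 \<in> V"
  shows "\<exists>\<delta>. \<delta> \<noteq> 0 \<and> (\<forall>(\<gamma> :: real \<Rightarrow> point) w t v S. (w has_vector_derivative v) (at t) \<longrightarrow> w t = 0 \<longrightarrow>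
     open S \<longrightarrow> t \<in> S \<longrightarrow> (\<forall>s\<in>S. norm (w s) < 1/2 \<and> \<gamma> s = vpt x (w s)) \<longrightarrow>
     ((\<lambda>s. h (\<gamma> s)) has_vector_derivative \<delta> * v) (at t))"
proof -
  let ?W = "ball 0 (1/2) :: complex set"
  let ?S = "{w \<in> ?W. vpt x w \<in> V}"
  have par: "conf_par ?W (vpt x)" by (rule conf_par_vertex(1)[OF assms(1)])
  note hol = conf_fun_par[OF par conf_chartD(2)[OF assms(2)]]
  have z: "0 \<in> ?S" using assms vpt_0 by simp
  define \<delta> where "\<delta> = deriv (\<lambda>w. h (vpt x w)) 0"
  have "\<delta> \<noteq> 0" unfolding \<delta>_def
    by (rule holomorphic_injective_imp_regular[OF hol(2,1) conf_chart_par_inj[OF par conf_chartD(3)[OF assms(2)]] z])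
  moreover have "((\<lambda>s. h (\<gamma> s)) has_vector_derivative \<delta> * v) (at t)"
    if w: "(w has_vector_derivative v) (at t)" "w t = 0" and S: "open S" "t \<in> S"
      "\<forall>s\<in>S. norm (w s) < 1/2 \<and> \<gamma> s = vpt x (w s)" for \<gamma> :: "real \<Rightarrow> point" and w t v S
  proof -
    have "((\<lambda>s. h (vpt x (w s))) has_vector_derivative deriv (\<lambda>w. h (vpt x w)) (w t) * v) (at t)"
      by (rule vector_derivative_holomorphic_compose[OF hol]) (use w z in auto)
    then have "((\<lambda>s. h (vpt x (w s))) has_vector_derivative \<delta> * v) (at t)" by (simp add: w(2) \<delta>_def)
    then show ?thesis
      by (rule has_vector_derivative_transform_within_open[OF _ S(1,2)]) (use S(3) in auto)
  qed
  ultimately show ?thesis by blast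
qed

end

section \<open>Increasing bijections of the line\<close>

lemma strict_mono_surj_continuous:
  fixes T :: "real \<Rightarrow> real"
  assumes "strict_mono T" "surj T"
  shows "continuous_on S T"
proof -
  have "continuous_on UNIV T"
    by (rule continuous_onI_mono) (use assms in \<open>auto simp: strict_mono_less_eq\<close>)
  then show ?thesis by (rule continuous_on_subset) simp
qed

lemma strict_mono_surj_inv:
  fixes T :: "real \<Rightarrow> real"
  assumes "strict_mono T" "surj T"
  shows "strict_mono (inv T)" "surj (inv T)" "T (inv T t) = t" "inv T (T s) = s"
proof -
  have inj: "inj T" using assms(1) by (rule strict_mono_imp_inj_on)
  show a: "T (inv T t) = t" for t using assms(2) by (rule surj_f_inv_f)
  show b: "inv T (T s) = s" for s using inj by (rule inv_f_f)
  show "strict_mono (inv T)"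
    by (rule strict_monoI) (metis a assms(1) strict_mono_less)
  show "surj (inv T)" using b by (rule surjI)
qed

lemma strict_mono_on_inverse_of_continuous:
  fixes g :: "real \<Rightarrow> real"
  assumes "\<alpha> \<le> \<beta>" "continuous_on {\<alpha>..\<beta>} g" "strict_mono_on {\<alpha>..\<beta>} g" "g \<alpha> = 0" "g \<beta> = 1"
  obtains h where "\<And>s. s \<in> {0..1} \<Longrightarrow> h s \<in> {\<alpha>..\<beta>} \<and> g (h s) = s" "\<And>t. t \<in> {\<alpha>..\<beta>} \<Longrightarrow> h (g t) = t"
    "strict_mono_on {0..1} h" "h 0 = \<alpha>" "h 1 = \<beta>" "\<And>t. t \<in> {\<alpha>..\<beta>} \<Longrightarrow> g t \<in> {0..1}"
proof -
  have inj: "inj_on g {\<alpha>..\<beta>}" using assms(3) by (rule strict_mono_on_imp_inj_on)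
  have img: "g ` {\<alpha>..\<beta>} = {0..1}"
  proof
    show "g ` {\<alpha>..\<beta>} \<subseteq> {0..1}"
    proof
      fix y assume "y \<in> g ` {\<alpha>..\<beta>}"
      then obtain t where t: "t \<in> {\<alpha>..\<beta>}" "y = g t" by blast
      then show "y \<in> {0..1}"
        using strict_mono_on_leD[OF assms(3), of \<alpha> t] strict_mono_on_leD[OF assms(3), of t \<beta>] assms(1,4,5) by simp
    qed
    show "{0..1} \<subseteq> g ` {\<alpha>..\<beta>}"
    proof
      fix y :: real assume "y \<in> {0..1}"
      then obtain t where "\<alpha> \<le> t" "t \<le> \<beta>" "g t = y"
        using IVT'[of g \<alpha> y \<beta>] assms(1,2,4,5) by auto
      then show "y \<in> g ` {\<alpha>..\<beta>}" by auto
    qed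
  qed
  define h where "h = inv_into {\<alpha>..\<beta>} g"
  have 1: "h s \<in> {\<alpha>..\<beta>} \<and> g (h s) = s" if "s \<in> {0..1}" for s
    using that img unfolding h_def by (metis f_inv_into_f inv_into_into)
  have 2: "h (g t) = t" if "t \<in> {\<alpha>..\<beta>}" for t
    using inv_into_f_f[OF inj that] by (simp add: h_def)
  have 3: "strict_mono_on {0..1} h"
  proof (rule strict_mono_onI)
    fix r s :: real assume rs: "r \<in> {0..1}" "s \<in> {0..1}" "r < s"
    show "h r < h s"
    proof (rule ccontr)
      assume "\<not> h r < h s"
      then have "g (h s) \<le> g (h r)"
        using strict_mono_on_leD[OF assms(3), of "h s" "h r"] 1[OF rs(1)] 1[OF rs(2)] by simp
      then show False using 1[OF rs(1)] 1[OF rs(2)] rs(3) by simp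
    qed
  qed
  show thesis
    by (rule that[OF 1 2 3]) (use 2[of \<alpha>] 2[of \<beta>] assms img in auto)
qed

context pdb
begin

section \<open>The circuits of the graph\<close>

text \<open>The edges of the circuit \<open>c\<close> in their order, numbered periodically by the integers; the edge
  number 0 is \<open>(c, 1)\<close>.\<close>

definition lab :: "nat \<Rightarrow> int \<Rightarrow> label" where
  "lab c i = (c, nat (i mod int (n c)) + 1)"

definition path :: "nat \<Rightarrow> real \<Rightarrow> point" where
  "path c s = pt (Plus (lab c \<lfloor>s\<rfloor>)) (of_real (frac s))"

lemma fst_lab [simp]: "fst (lab c i) = c"
  by (simp add: lab_def)

lemma lab_in: "c \<in> {1..\<mu>} \<Longrightarrow> lab c i \<in> L"
  using n_pos[of c] by (simp add: lab_def labels_def Suc_le_eq nat_less_iff)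

lemma lab_SL: "c \<in> {1..\<mu>} \<Longrightarrow> Plus (lab c i) \<in> SL" "c \<in> {1..\<mu>} \<Longrightarrow> Minus (lab c i) \<in> SL"
  using lab_in by (simp_all add: signed_labels_iff)

lemma lab_eq_iff: "c \<in> {1..\<mu>} \<Longrightarrow> lab c i = lab c j \<longleftrightarrow> i mod int (n c) = j mod int (n c)"
  using n_pos[of c] by (auto simp: lab_def nat_eq_iff)

lemma lab_surj:
  assumes "l \<in> L"
  shows "lab (fst l) (int (snd l) - 1) = l"
proof -
  have l: "fst l \<in> {1..\<mu>}" "1 \<le> snd l" "snd l \<le> n (fst l)" using assms by (auto simp: labels_def)
  then have "(int (snd l) - 1) mod int (n (fst l)) = int (snd l) - 1" by simp
  then show ?thesis using l by (simp add: lab_def prod_eq_iff)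
qed

lemma lab_period: "lab c (i + j * int (n c)) = lab c i"
  by (simp add: lab_def)

lemma lab_Suc:
  assumes "c \<in> {1..\<mu>}"
  shows "next_label n (lab c i) = lab c (i + 1)"
proof -
  have N: "0 < int (n c)" using n_pos[OF assms] by simp
  have "int ((nat (i mod int (n c)) + 1) mod n c) = (i mod int (n c) + 1) mod int (n c)"
    using N by (simp add: zmod_int add.commute)
  also have "\<dots> = (i + 1) mod int (n c)" by (simp add: mod_add_left_eq)
  finally have "(nat (i mod int (n c)) + 1) mod n c = nat ((i + 1) mod int (n c))" by linarith
  then show ?thesis by (simp add: lab_def next_label_def)
qed

lemma turn2_lab: "c \<in> {1..\<mu>} \<Longrightarrow> turn C 2 (Plus (lab c i)) = Minus (lab c (i + 1))"
  using turn2_Plus[OF lab_in] lab_Suc by simp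

lemma path_floor: "of_int i \<le> s \<Longrightarrow> s < of_int i + 1 \<Longrightarrow> path c s = pt (Plus (lab c i)) (of_real (s - of_int i))"
proof -
  assume "of_int i \<le> s" "s < of_int i + 1"
  then have "\<lfloor>s\<rfloor> = i" by linarith
  then show ?thesis by (simp add: path_def frac_def)
qed

text \<open>At an integer the circuit is at the end of one edge and at the beginning of the next, two opposite ends
  at the same vertex.\<close>

lemma path_int:
  assumes "c \<in> {1..\<mu>}"
  shows "path c (of_int i) = pt (Minus (lab c i)) 1" "path c (of_int i) = pt (Plus (lab c (i - 1))) 1"
proof -
  have "path c (of_int i) = pt (Plus (lab c i)) 0" using path_floor[of i "of_int i" c] by simp
  then show *: "path c (of_int i) = pt (Minus (lab c i)) 1"
    using pt_glue[OF lab_SL(1)[OF assms], of 0] by simp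
  show "path c (of_int i) = pt (Plus (lab c (i - 1))) 1"
    using * pt_corner[OF lab_SL(1)[OF assms], of 2 "i - 1"] turn2_lab[OF assms, of "i - 1"] by simp
qed

lemma path_period: "path c (s + of_int j * real (n c)) = path c s"
proof -
  have "s + of_int j * real (n c) = s + of_int (j * int (n c))" by simp
  moreover have "\<lfloor>s + of_int (j * int (n c))\<rfloor> = \<lfloor>s\<rfloor> + j * int (n c)" by linarith
  ultimately show ?thesis by (simp only: path_def frac_def lab_period) simp
qed

lemma abs_sqrt: "\<bar>sqrt r\<bar> = sqrt \<bar>r\<bar>"
  by (cases "0 \<le> r") (simp_all add: abs_if real_sqrt_minus)

text \<open>In the vertex coordinate based at the end through which the circuit arrives, the
  circuit is the real axis run through from right to left.  The square root on the reals is an odd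
  function, so a single formula covers both sides of the vertex.\<close>

lemma path_vpt:
  assumes c: "c \<in> {1..\<mu>}" and s: "\<bar>s - of_int i\<bar> < 1/4"
  shows "norm (complex_of_real (sqrt (of_int i - s))) < 1/2"
    and "path c s = vpt (Plus (lab c (i - 1))) (of_real (sqrt (of_int i - s)))"
proof -
  let ?x = "Plus (lab c (i - 1))"
  have x: "?x \<in> SL" by (rule lab_SL[OF c])
  have "sqrt \<bar>of_int i - s\<bar> < 1/2"
    by (rule real_less_lsqrt) (use s in \<open>simp_all add: power2_eq_square abs_minus_commute\<close>)
  then show nrm: "norm (complex_of_real (sqrt (of_int i - s))) < 1/2"
    using abs_sqrt[of "of_int i - s"] by simp
  consider "s < of_int i" | "s = of_int i" | "s > of_int i" by linarith
  then show "path c s = vpt ?x (of_real (sqrt (of_int i - s)))"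
  proof cases
    case 1
    have "(- \<i>) ^ 0 * complex_of_real (sqrt (of_int i - s)) \<in> Q1" using 1 by (simp add: Q1_def)
    from conf_par_vertex(2)[OF x nrm this]
    have "vpt ?x (of_real (sqrt (of_int i - s))) = pt ?x (1 - (of_real (sqrt (of_int i - s)))\<^sup>2)"
      using x by simp
    also have "(complex_of_real (sqrt (of_int i - s)))\<^sup>2 = of_real (of_int i - s)"
      using 1 by (simp only: of_real_power[symmetric]) simp
    also have "pt ?x (1 - of_real (of_int i - s)) = path c s"
      using path_floor[of "i - 1" s c] 1 s by (simp add: algebra_simps)
    finally show ?thesis by simp
  next
    case 2
    then show ?thesis using path_int(2)[OF c] vpt_0[OF x] by simp
  next
    case 3
    let ?w = "complex_of_real (sqrt (of_int i - s))"
    have w: "?w = - of_real (sqrt (s - of_int i))" by (metis minus_diff_eq of_real_minus real_sqrt_minus)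
    have "(- \<i>) ^ 2 * ?w \<in> Q1" unfolding minus_i_power w using 3 by (simp add: Q1_def)
    from conf_par_vertex(2)[OF x nrm this]
    have "vpt ?x ?w = pt (Minus (lab c i)) (1 - (of_real (sqrt (s - of_int i)))\<^sup>2)"
      using turn2_lab[OF c, of "i - 1"] unfolding minus_i_power w by simp
    also have "(complex_of_real (sqrt (s - of_int i)))\<^sup>2 = of_real (s - of_int i)"
      using 3 by (simp only: of_real_power[symmetric]) simp
    also have "pt (Minus (lab c i)) (1 - of_real (s - of_int i)) = pt (Plus (lab c i)) (of_real (s - of_int i))"
      using pt_glue[OF lab_SL(1)[OF c], of "s - of_int i" i] 3 s by simp
    also have "\<dots> = path c s" using path_floor[of i s c] 3 s by simp
    finally show ?thesis by simp
  qed
qed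

lemma path_ept:
  assumes "c \<in> {1..\<mu>}" "of_int i < s" "s < of_int i + 1"
  shows "complex_of_real (s - of_int i) \<in> strip"
    and "path c s = ept (Plus (lab c i)) (of_real (s - of_int i))"
  using path_floor[of i s c] ept_real[OF lab_SL(1)[OF assms(1)], of "s - of_int i" i] assms
  by (simp_all add: strip_def)

lemma path_vertex_imp_int:
  assumes "c \<in> {1..\<mu>}" "x \<in> SL" "path c s = pt x 1"
  shows "s = of_int \<lfloor>s\<rfloor>"
proof (rule ccontr)
  assume "s \<noteq> of_int \<lfloor>s\<rfloor>"
  then have "0 < frac s" "frac s < 1" by (auto simp: frac_def) linarith+
  then show False
    using edge_neq_corner[OF lab_in[OF assms(1)] _ _ assms(2)] assms(3) by (simp add: path_def)
qed

lemma frac_pos: "s \<noteq> of_int \<lfloor>s\<rfloor> \<Longrightarrow> 0 < frac s" "frac (s::real) < 1"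
  by (auto simp: frac_def) linarith+

lemma path_in_edge:
  assumes "c \<in> {1..\<mu>}" "l \<in> L" "0 < u" "u < 1" "path c s = pt (Plus l) (of_real u)"
  shows "lab c \<lfloor>s\<rfloor> = l" "frac s = u"
proof -
  have "s \<noteq> of_int \<lfloor>s\<rfloor>"
  proof
    assume "s = of_int \<lfloor>s\<rfloor>"
    then have "path c s = pt (Minus (lab c \<lfloor>s\<rfloor>)) 1" using path_int(1)[OF assms(1), of "\<lfloor>s\<rfloor>"] by simp
    then show False using edge_neq_corner[OF assms(2-4) lab_SL(2)[OF assms(1)]] assms(5) by simp
  qed
  from frac_pos(1)[OF this] frac_pos(2)[of s] show "lab c \<lfloor>s\<rfloor> = l" "frac s = u"
    using edge_inj[OF lab_in[OF assms(1)] _ _ assms(2-4), of "frac s" "\<lfloor>s\<rfloor>"] assms(5)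
    by (auto simp: path_def)
qed

lemma path_inj:
  assumes "c \<in> {1..\<mu>}" "c' \<in> {1..\<mu>}" "path c s = path c' s'" "s \<noteq> of_int \<lfloor>s\<rfloor>"
  shows "c = c' \<and> (\<exists>j. s' = s + of_int j * real (n c))"
proof -
  have "lab c' \<lfloor>s'\<rfloor> = lab c \<lfloor>s\<rfloor> \<and> frac s' = frac s"
    using path_in_edge[OF assms(2) lab_in[OF assms(1)] frac_pos(1)[OF assms(4)] frac_pos(2), of s' "\<lfloor>s\<rfloor>"] assms(3)
    by (simp add: path_def)
  moreover from this have "c = c'" by (metis fst_lab)
  ultimately have "\<lfloor>s'\<rfloor> mod int (n c) = \<lfloor>s\<rfloor> mod int (n c)" and fr: "frac s' = frac s"
    using lab_eq_iff[OF assms(1)] by auto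
  then obtain j where "\<lfloor>s'\<rfloor> = \<lfloor>s\<rfloor> + j * int (n c)"
    by (metis mod_eqE mult.commute add.commute diff_add_cancel)
  then have "real_of_int \<lfloor>s'\<rfloor> = of_int (\<lfloor>s\<rfloor> + j * int (n c))" by simp
  then have "s' = s + of_int j * real (n c)"
    using fr by (simp add: frac_def)
  then show ?thesis using \<open>c = c'\<close> by blast
qed

section \<open>Parametrizations of the circuits\<close>

text \<open>The point that the circle has reached at the parameter \<open>T c s\<close> is the point \<open>path c s\<close> of the
  circuit; here the integral part of \<open>s\<close> counts the edges passed since the start at \<open>(c, 1)\<close>, and
  its fractional part is the parameter on the current edge.\<close>

definition param_of :: "(nat \<times> complex \<Rightarrow> point) \<Rightarrow> nat \<Rightarrow> (real \<Rightarrow> real) \<Rightarrow> bool" where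
  "param_of d c T \<longleftrightarrow> strict_mono T \<and> surj T \<and> (\<forall>s. T (s + real (n c)) = T s + 2 * pi) \<and>
     (\<forall>s. d (c, cis (T s)) = path c s)"

text \<open>The inverses \<open>h i\<close> of the monotone edge parametrizations, put side by side and continued
  periodically, give an increasing bijection.\<close>

lemma traverses_param_of:
  assumes "traverses \<mu> n C b d" "c \<in> {1..\<mu>}"
  shows "\<exists>T. param_of d c T"
proof -
  define N where "N = n c"
  have N: "0 < N" using n_pos[OF assms(2)] by (simp add: N_def)
  have card: "card (orbit (next_edge C) (c, 1)) = N"
    unfolding orbit_next_edge[OF assms(2)] by (simp add: card_cartesian_product N_def)
  obtain \<theta> :: "nat \<Rightarrow> real" where \<theta>: "\<theta> N = \<theta> 0 + 2 * pi" and \<theta>k: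
    "\<forall>k<N. \<theta> k < \<theta> (k + 1) \<and> (\<exists>g. continuous_on {\<theta> k..\<theta> (k + 1)} g \<and> strict_mono_on {\<theta> k..\<theta> (k + 1)} g \<and>
       g (\<theta> k) = 0 \<and> g (\<theta> (k + 1)) = 1 \<and>
       (\<forall>t\<in>{\<theta> k..\<theta> (k + 1)}. d (c, cis t) = edge_path \<mu> n C b ((next_edge C ^^ k) (c, 1)) (g t)))"
    using bspec[OF assms(1)[unfolded traverses_def] assms(2)] unfolding card by blast
  have less: "\<theta> i < \<theta> (i + 1)" if "i < N" for i using \<theta>k that by blast
  define Q where "Q i h \<longleftrightarrow> (\<forall>s\<in>{0..1}. h s \<in> {\<theta> i..\<theta> (i + 1)}) \<and> strict_mono_on {0..1} h \<and> h 0 = \<theta> i \<and>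
      h 1 = \<theta> (i + 1) \<and> (\<forall>t\<in>{\<theta> i..\<theta> (i + 1)}. \<exists>s\<in>{0..1}. h s = t) \<and>
      (\<forall>s\<in>{0..1}. d (c, cis (h s)) = pt (Plus (lab c (int i))) (of_real s))" for i h
  have "\<exists>h. Q i h" if i: "i < N" for i
  proof -
    obtain g where g: "continuous_on {\<theta> i..\<theta> (i + 1)} g" "strict_mono_on {\<theta> i..\<theta> (i + 1)} g"
      "g (\<theta> i) = 0" "g (\<theta> (i + 1)) = 1"
      "\<forall>t\<in>{\<theta> i..\<theta> (i + 1)}. d (c, cis t) = edge_path \<mu> n C b ((next_edge C ^^ i) (c, 1)) (g t)"
      using \<theta>k i by blast
    obtain h where h: "\<And>s. s \<in> {0..1} \<Longrightarrow> h s \<in> {\<theta> i..\<theta> (i + 1)} \<and> g (h s) = s"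
      "\<And>t. t \<in> {\<theta> i..\<theta> (i + 1)} \<Longrightarrow> h (g t) = t"
      "strict_mono_on {0..1} h" "h 0 = \<theta> i" "h 1 = \<theta> (i + 1)" "\<And>t. t \<in> {\<theta> i..\<theta> (i + 1)} \<Longrightarrow> g t \<in> {0..1}"
      by (rule strict_mono_on_inverse_of_continuous[OF less_imp_le[OF less[OF i]] g(1-4)]) (rule that)
    have e: "(next_edge C ^^ i) (c, 1) = lab c (int i)"
      unfolding next_edge_funpow[OF assms(2)] lab_def by (simp add: zmod_int[symmetric])
    have "d (c, cis (h s)) = pt (Plus (lab c (int i))) (of_real s)" if "s \<in> {0..1}" for s
      using g(5) h(1)[OF that] unfolding e edge_path_eq by simp
    moreover have "\<forall>t\<in>{\<theta> i..\<theta> (i + 1)}. \<exists>s\<in>{0..1}. h s = t"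
      using h(2,6) by blast
    ultimately have "Q i h" unfolding Q_def using h(1,3,4,5) by blast
    then show ?thesis by blast
  qed
  then obtain h where "\<And>i. i < N \<Longrightarrow> Q i (h i)" by metis
  then have h1: "\<And>i s. i < N \<Longrightarrow> s \<in> {0..1} \<Longrightarrow> h i s \<in> {\<theta> i..\<theta> (i + 1)}" and
    h2: "\<And>i. i < N \<Longrightarrow> strict_mono_on {0..1} (h i)" and
    h3: "\<And>i. i < N \<Longrightarrow> h i 0 = \<theta> i" "\<And>i. i < N \<Longrightarrow> h i 1 = \<theta> (i + 1)" and
    h4: "\<And>i t. i < N \<Longrightarrow> t \<in> {\<theta> i..\<theta> (i + 1)} \<Longrightarrow> \<exists>s\<in>{0..1}. h i s = t" and
    h5: "\<And>i s. i < N \<Longrightarrow> s \<in> {0..1} \<Longrightarrow> d (c, cis (h i s)) = pt (Plus (lab c (int i))) (of_real s)"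
    unfolding Q_def by blast+
  \<comment> \<open>The edges are now numbered by all integers; \<open>\<Theta> i\<close> is the parameter at which the edge number \<open>i\<close> begins.\<close>
  define ix where "ix i = nat (i mod int N)" for i
  define \<Theta> where "\<Theta> i = \<theta> (ix i) + 2 * pi * of_int (i div int N)" for i
  define T where "T s = h (ix \<lfloor>s\<rfloor>) (frac s) + 2 * pi * of_int (\<lfloor>s\<rfloor> div int N)" for s
  have ix: "ix i < N" for i using N by (simp add: ix_def nat_less_iff)
  have \<Theta>_Suc: "\<Theta> (i + 1) = \<theta> (ix i + 1) + 2 * pi * of_int (i div int N)" for i
  proof (cases "ix i + 1 = N")
    case True
    have "0 \<le> i mod int N" using N by simp
    then have "i mod int N = int N - 1" using True unfolding ix_def by linarith
    then have "i + 1 = (i div int N + 1) * int N"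
      using div_mult_mod_eq[of i "int N"] unfolding distrib_right by linarith
    then have "(i + 1) mod int N = 0" "(i + 1) div int N = i div int N + 1" using N by simp_all
    then show ?thesis using True \<theta> by (simp add: \<Theta>_def ix_def algebra_simps)
  next
    case False
    have "0 \<le> i mod int N" using N by simp
    then have "i mod int N + 1 < int N" using False ix[of i] unfolding ix_def by linarith
    define q r where "q = i div int N" and "r = i mod int N + 1"
    have r: "0 \<le> r" "r < int N" using N \<open>i mod int N + 1 < int N\<close> by (simp_all add: r_def add_nonneg_nonneg)
    have "i + 1 = r + q * int N" by (simp add: r_def q_def)
    then have "(i + 1) mod int N = r" "(i + 1) div int N = q" using r N by simp_all
    then have "(i + 1) mod int N = i mod int N + 1" "(i + 1) div int N = i div int N"
      by (simp_all add: r_def q_def)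
    then show ?thesis using N by (simp add: \<Theta>_def ix_def nat_add_distrib)
  qed
  have \<Theta>_less: "\<Theta> i < \<Theta> (i + 1)" for i
    unfolding \<Theta>_Suc using less[OF ix[of i]] by (simp add: \<Theta>_def)
  have \<Theta>_mono: "\<Theta> i \<le> \<Theta> j" if "i \<le> j" for i j
    using that by (induction j rule: int_ge_induct) (use \<Theta>_less in \<open>auto intro: order.trans less_imp_le\<close>)
  have T_bounds: "\<Theta> \<lfloor>s\<rfloor> \<le> T s" "T s < \<Theta> (\<lfloor>s\<rfloor> + 1)" for s
  proof -
    have fs: "frac s \<in> {0..1}" "frac s < 1" using frac_pos(2)[of s] by (simp_all add: less_imp_le)
    have "\<theta> (ix \<lfloor>s\<rfloor>) \<le> h (ix \<lfloor>s\<rfloor>) (frac s)" using h1[OF ix fs(1)] by simp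
    moreover have "h (ix \<lfloor>s\<rfloor>) (frac s) < h (ix \<lfloor>s\<rfloor>) 1"
      using strict_mono_onD[OF h2[OF ix] fs(1)] fs(2) by simp
    ultimately show "\<Theta> \<lfloor>s\<rfloor> \<le> T s" "T s < \<Theta> (\<lfloor>s\<rfloor> + 1)"
      unfolding T_def \<Theta>_Suc h3(2)[OF ix] by (simp_all add: \<Theta>_def)
  qed
  have mono: "strict_mono T"
  proof (rule strict_monoI)
    fix s s' :: real assume "s < s'"
    show "T s < T s'"
    proof (cases "\<lfloor>s\<rfloor> = \<lfloor>s'\<rfloor>")
      case True
      then have "frac s < frac s'" using \<open>s < s'\<close> by (simp add: frac_def)
      then have "h (ix \<lfloor>s\<rfloor>) (frac s) < h (ix \<lfloor>s\<rfloor>) (frac s')"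
        using strict_mono_onD[OF h2[OF ix], of "frac s" "frac s'"] frac_pos(2)[of s] frac_pos(2)[of s']
        by (simp add: less_imp_le)
      then show ?thesis using True by (simp add: T_def)
    next
      case False
      then have "\<lfloor>s\<rfloor> + 1 \<le> \<lfloor>s'\<rfloor>" using \<open>s < s'\<close> floor_mono[of s s'] by linarith
      then have "\<Theta> (\<lfloor>s\<rfloor> + 1) \<le> \<Theta> \<lfloor>s'\<rfloor>" by (rule \<Theta>_mono)
      then show ?thesis using T_bounds(2)[of s] T_bounds(1)[of s'] by linarith
    qed
  qed
  have per: "T (s + real N) = T s + 2 * pi" for s
  proof -
    have "\<lfloor>s + real N\<rfloor> = \<lfloor>s\<rfloor> + int N" "frac (s + real N) = frac s"
      by (simp_all add: frac_def)
    then show ?thesis using N by (simp add: T_def ix_def algebra_simps)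
  qed
  have surj: "surj T"
  proof (rule surjI)
    fix t :: real
    show "T (SOME s. T s = t) = t"
    proof (rule someI_ex)
      \<comment> \<open>Reduce \<open>t\<close> by full turns into the first turn and look for the edge met there.\<close>
      define a where "a = \<lfloor>(t - \<theta> 0) / (2 * pi)\<rfloor>"
      define t' where "t' = t - 2 * pi * of_int a"
      have "of_int a \<le> (t - \<theta> 0) / (2 * pi)" "(t - \<theta> 0) / (2 * pi) < of_int a + 1"
        unfolding a_def by linarith+
      then have t': "\<theta> 0 \<le> t'" "t' < \<theta> N"
        unfolding \<theta> t'_def using pi_gt_zero by (simp_all add: field_simps)
      define i where "i = (LEAST j. t' < \<theta> j)"
      have i1: "t' < \<theta> i" unfolding i_def by (rule LeastI[of _ N]) (rule t'(2))
      have "i \<le> N" unfolding i_def by (rule Least_le) (rule t'(2))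
      moreover have "i \<noteq> 0"
      proof
        assume "i = 0"
        then show False using i1 t'(1) by simp
      qed
      ultimately obtain j where j: "i = j + 1" "j < N" by (metis Suc_eq_plus1 Suc_le_eq not0_implies_Suc)
      have "\<not> t' < \<theta> j" using not_less_Least[of j "\<lambda>j. t' < \<theta> j"] j(1) by (simp add: i_def)
      then have "t' \<in> {\<theta> j..\<theta> (j + 1)}" using i1 j(1) by simp
      then obtain u where u: "u \<in> {0..1}" "h j u = t'" using h4[OF j(2)] by blast
      have "u \<noteq> 1" using u(2) h3(2)[OF j(2)] i1 j(1) by auto
      then have u1: "0 \<le> u" "u < 1" using u(1) by auto
      let ?s = "real_of_int (a * int N + int j) + u"
      have fl: "\<lfloor>?s\<rfloor> = a * int N + int j" using u1 by linarith
      then have fr: "frac ?s = u" unfolding frac_def fl by simp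
      have "(a * int N + int j) mod int N = int j" "(a * int N + int j) div int N = a" using j(2) by simp_all
      then have "T ?s = t" unfolding T_def fl fr ix_def using u(2) by (simp add: t'_def)
      then show "\<exists>s. T s = t" by blast
    qed
  qed
  have "d (c, cis (T s)) = path c s" for s
  proof -
    have "frac s \<in> {0..1}" using frac_pos(2)[of s] by (simp add: less_imp_le)
    note h5[OF ix this]
    moreover have "cis (T s) = cis (h (ix \<lfloor>s\<rfloor>) (frac s))"
      unfolding T_def by (simp add: cis_mult[symmetric] cis_multiple_2pi)
    moreover have "lab c (int (ix \<lfloor>s\<rfloor>)) = lab c \<lfloor>s\<rfloor>"
      using N by (simp add: lab_def ix_def N_def[symmetric])
    ultimately show ?thesis by (simp add: path_def)
  qed
  then show ?thesis using mono surj per by (auto simp: param_of_def N_def)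
qed

end

section \<open>Local coordinates along the circuits\<close>

lemma regular_curve_of_real:
  fixes a :: "real \<Rightarrow> real"
  assumes "open S" "regular_curve (\<lambda>t. of_real (a t)) S"
  shows "smooth_on a S" "\<And>t. t \<in> S \<Longrightarrow> vector_derivative a (at t) \<noteq> 0"
    "\<And>t. t \<in> S \<Longrightarrow> (a has_real_derivative vector_derivative a (at t)) (at t)"
proof -
  have sm: "smooth_on (\<lambda>t. complex_of_real (a t)) S" using assms(2) by (simp add: regular_curve_def)
  have "Ck_on k (\<lambda>t. Re (complex_of_real (a t))) S" for k
    by (rule Ck_on_bounded_linear[OF bounded_linear_Re assms(1) smooth_onD[OF sm]])
  then show sa: "smooth_on a S" by (simp add: smooth_on_def)
  fix t assume t: "t \<in> S"
  have d: "(a has_vector_derivative vector_derivative a (at t)) (at t)"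
    by (rule smooth_on_has_vector_derivative[OF assms(1) sa t])
  then show "(a has_real_derivative vector_derivative a (at t)) (at t)"
    by (simp add: has_real_derivative_iff_has_vector_derivative)
  have "((\<lambda>t. complex_of_real (a t)) has_vector_derivative of_real (vector_derivative a (at t))) (at t)"
    by (rule bounded_linear.has_vector_derivative[OF bounded_linear_of_real d])
  then have "vector_derivative (\<lambda>t. complex_of_real (a t)) (at t) = of_real (vector_derivative a (at t))"
    by (rule vector_derivative_at)
  then show "vector_derivative a (at t) \<noteq> 0" using assms(2) t by (auto simp: regular_curve_def)
qed

text \<open>A positive derivative would make the function increase immediately to the right of the point.\<close>

lemma strict_antimono_derivative_nonpos:
  fixes a :: "real \<Rightarrow> real"
  assumes "(a has_real_derivative D) (at t)" "open S" "t \<in> S" "\<And>s. s \<in> S \<Longrightarrow> t < s \<Longrightarrow> a s < a t"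
  shows "D \<le> 0"
proof (rule ccontr)
  assume "\<not> D \<le> 0"
  then obtain e where e: "0 < e" "\<And>h. 0 < h \<Longrightarrow> h < e \<Longrightarrow> a t < a (t + h)"
    using DERIV_pos_inc_right[OF assms(1)] by auto
  obtain e' where e': "0 < e'" "ball t e' \<subseteq> S" using assms(2,3) openE by blast
  define h where "h = min e e' / 2"
  have h: "0 < h" "h < e" "h < e'" using e(1) e'(1) by (auto simp: h_def min_def)
  then have "t + h \<in> S" using e'(2) by (auto simp: dist_real_def)
  then show False using assms(4)[of "t + h"] e(2)[OF h(1,2)] h(1) by simp
qed

text \<open>Around \<open>s0\<close>, the circuit is given in a coordinate of the surface by a real function
  \<open>loc_coord s0\<close> that depends only on \<open>s0\<close>: the coordinate of an edge, or of a vertex if \<open>s0\<close> is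
  an integer.\<close>

definition loc_int :: "real \<Rightarrow> real set" where
  "loc_int s0 = (if s0 = of_int \<lfloor>s0\<rfloor> then {s0 - 1/4<..<s0 + 1/4} else {of_int \<lfloor>s0\<rfloor><..<of_int \<lfloor>s0\<rfloor> + 1})"

definition loc_coord :: "real \<Rightarrow> real \<Rightarrow> real" where
  "loc_coord s0 s = (if s0 = of_int \<lfloor>s0\<rfloor> then sqrt (s0 - s) else s - of_int \<lfloor>s0\<rfloor>)"

lemma loc_int: "open (loc_int s0)" "s0 \<in> loc_int s0"
  by (auto simp: loc_int_def) linarith+

context pdb
begin

lemma path_par:
  assumes c: "c \<in> {1..\<mu>}"
  shows "\<exists>W P. conf_par W P \<and> (\<forall>s\<in>loc_int s0. of_real (loc_coord s0 s) \<in> W \<and> path c s = P (of_real (loc_coord s0 s)))"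
proof (cases "s0 = of_int \<lfloor>s0\<rfloor>")
  case True
  let ?x = "Plus (lab c (\<lfloor>s0\<rfloor> - 1))"
  have "complex_of_real (loc_coord s0 s) \<in> ball 0 (1/2) \<and> path c s = vpt ?x (of_real (loc_coord s0 s))"
    if s: "s \<in> loc_int s0" for s
  proof -
    have "s0 - 1/4 < s" "s < s0 + 1/4" using s True unfolding loc_int_def by simp_all
    then have "\<bar>s - of_int \<lfloor>s0\<rfloor>\<bar> < 1/4" using True by linarith
    note p = path_vpt[OF c this]
    have e: "loc_coord s0 s = sqrt (of_int \<lfloor>s0\<rfloor> - s)" using True by (simp add: loc_coord_def)
    show ?thesis using p unfolding e by simp
  qed
  then show ?thesis using conf_par_vertex(1)[OF lab_SL(1)[OF c]] by blast
next
  case False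
  let ?x = "Plus (lab c \<lfloor>s0\<rfloor>)"
  have "complex_of_real (loc_coord s0 s) \<in> strip \<and> path c s = ept ?x (of_real (loc_coord s0 s))"
    if s: "s \<in> loc_int s0" for s
  proof -
    have "of_int \<lfloor>s0\<rfloor> < s" "s < of_int \<lfloor>s0\<rfloor> + 1" using s False by (simp_all add: loc_int_def)
    note p = path_ept[OF c this]
    have e: "loc_coord s0 s = s - of_int \<lfloor>s0\<rfloor>" using False by (simp add: loc_coord_def)
    show ?thesis using p unfolding e by simp
  qed
  then show ?thesis using conf_par_edge(1)[OF lab_SL(1)[OF c]] by blast
qed

lemma path_coord:
  assumes c: "c \<in> {1..\<mu>}"
  shows "\<exists>V h. conf_chart V h \<and> (\<forall>s\<in>loc_int s0. path c s \<in> V \<and> h (path c s) = of_real (loc_coord s0 s))"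
proof -
  obtain W P where WP: "conf_par W P \<and>
      (\<forall>s\<in>loc_int s0. of_real (loc_coord s0 s) \<in> W \<and> path c s = P (of_real (loc_coord s0 s)))"
    using path_par[OF c, of s0] by (elim exE)
  then have par: "conf_par W P" and
    P: "\<And>s. s \<in> loc_int s0 \<Longrightarrow> of_real (loc_coord s0 s) \<in> W \<and> path c s = P (of_real (loc_coord s0 s))"
    by simp_all
  have inj: "inj_on P W" using par by (simp add: conf_par_def)
  have "path c s \<in> P ` W \<and> inv_into W P (path c s) = of_real (loc_coord s0 s)" if "s \<in> loc_int s0" for s
    using P[OF that] inv_into_f_f[OF inj] by simp
  then show ?thesis using conf_par_chart(2)[OF par] by blast
qed

text \<open>Basing the vertex coordinate at another end rotates it by a multiple of the right angle.\<close>

lemma vpt_turn: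
  assumes "x \<in> SL" "norm w < 1/2"
  shows "vpt (turn C j x) w = vpt x (\<i> ^ j * w)"
proof -
  obtain l where l: "l < 4" "(- \<i>) ^ l * w \<in> Q1" using quadrant_cover by blast
  have n: "norm (\<i> ^ j * w) < 1/2" using assms(2) by (simp add: norm_mult norm_power)
  have e: "(- \<i>) ^ (l + j) * (\<i> ^ j * w) = (- \<i>) ^ l * w"
  proof -
    have "(- \<i>) ^ (l + j) * (\<i> ^ j * w) = (- \<i>) ^ l * (((- \<i>) * \<i>) ^ j * w)"
      by (simp only: power_add power_mult_distrib mult.assoc)
    then show ?thesis by simp
  qed
  have "vpt x (\<i> ^ j * w) = pt (turn C (l + j) x) (1 - ((- \<i>) ^ l * w)\<^sup>2)"
    using conf_par_vertex(2)[OF assms(1) n, of "l + j"] l(2) unfolding e by simp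
  also have "\<dots> = vpt (turn C j x) w"
    using conf_par_vertex(2)[of "turn C j x" w l] assms l(2) turn_turn[OF assms(1)] by simp
  finally show ?thesis by simp
qed

end

lemma circles_points: "p \<in> topspace (circles \<mu>) \<longleftrightarrow> fst p \<in> {1..\<mu>} \<and> norm (snd p) = 1"
  by (cases p) (auto simp: circles_def)

lemma continuous_map_circle:
  assumes "c \<in> {1..\<mu>}"
  shows "continuous_map euclideanreal (circles \<mu>) (\<lambda>t. (c, cis t))"
proof -
  have "continuous_map euclideanreal (top_of_set (sphere 0 1)) cis"
    by (auto simp: continuous_map_in_subtopology intro!: continuous_intros)
  moreover have "continuous_map (top_of_set (sphere 0 1)) (circles \<mu>) (\<lambda>z. (c, z))"
    unfolding circles_def by (rule continuous_map_component_injection[OF assms])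
  ultimately show ?thesis using continuous_map_compose by (fastforce simp: o_def)
qed

lemma cis_eq_iff: "cis s = cis t \<longleftrightarrow> (\<exists>j::int. s = t + 2 * pi * of_int j)"
proof -
  have "cis s = cis t \<longleftrightarrow> exp (\<i> * of_real s) = exp (\<i> * of_real t)" by (simp add: cis_conv_exp)
  also have "\<dots> \<longleftrightarrow> (\<exists>j::int. \<i> * of_real s = \<i> * of_real t + (of_int (2 * j) * pi) * \<i>)" by (rule exp_eq)
  also have "\<dots> \<longleftrightarrow> (\<exists>j::int. s = t + 2 * pi * of_int j)"
    by (rule ex_cong1) (auto simp: complex_eq_iff algebra_simps)
  finally show ?thesis .
qed

locale immersed = pdb +
  fixes A :: "point chart set" and d :: "nat \<times> complex \<Rightarrow> point"
  assumes smoothing: "smoothing \<mu> n C b A"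
    and immersion: "smooth_immersion X A \<mu> d"
    and traversing: "traverses \<mu> n C b d"
begin

text \<open>The functions \<open>T c\<close> and \<open>G c\<close> translate between positions on the circuit and parameters of
  the circle.\<close>

definition T :: "nat \<Rightarrow> real \<Rightarrow> real" where "T c = (SOME T. param_of d c T)"
definition G :: "nat \<Rightarrow> real \<Rightarrow> real" where "G c = inv (T c)"

lemma param: "c \<in> {1..\<mu>} \<Longrightarrow> param_of d c (T c)"
  unfolding T_def using someI_ex[OF traverses_param_of[OF traversing]] .

lemma T_mono: "c \<in> {1..\<mu>} \<Longrightarrow> strict_mono (T c)" and T_surj: "c \<in> {1..\<mu>} \<Longrightarrow> surj (T c)"
  and T_period: "c \<in> {1..\<mu>} \<Longrightarrow> T c (s + real (n c)) = T c s + 2 * pi"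
  and d_T: "c \<in> {1..\<mu>} \<Longrightarrow> d (c, cis (T c s)) = path c s"
  using param by (auto simp: param_of_def)

lemma G_mono: "c \<in> {1..\<mu>} \<Longrightarrow> strict_mono (G c)" and G_surj: "c \<in> {1..\<mu>} \<Longrightarrow> surj (G c)"
  and T_G [simp]: "c \<in> {1..\<mu>} \<Longrightarrow> T c (G c t) = t" and G_T [simp]: "c \<in> {1..\<mu>} \<Longrightarrow> G c (T c s) = s"
  unfolding G_def using strict_mono_surj_inv[OF T_mono T_surj] by auto

lemma d_G: "c \<in> {1..\<mu>} \<Longrightarrow> d (c, cis t) = path c (G c t)"
  using d_T[of c "G c t"] by simp

lemma T_period_int: "c \<in> {1..\<mu>} \<Longrightarrow> T c (s + of_int j * real (n c)) = T c s + 2 * pi * of_int j"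
proof (induction j rule: int_induct[where k=0])
  case (step1 i)
  then show ?case using T_period[of c "s + of_int i * real (n c)"] by (simp add: algebra_simps)
next
  case (step2 i)
  then show ?case using T_period[of c "s + of_int (i - 1) * real (n c)"] by (simp add: algebra_simps)
qed simp

lemma G_period_int: "c \<in> {1..\<mu>} \<Longrightarrow> G c (t + 2 * pi * of_int j) = G c t + of_int j * real (n c)"
  using T_period_int[of c "G c t" j] G_T[of c "G c t + of_int j * real (n c)"] by simp

lemma open_G: "c \<in> {1..\<mu>} \<Longrightarrow> open B \<Longrightarrow> open {t. G c t \<in> B}"
  using open_vimage[of B "G c"] strict_mono_surj_continuous[OF G_mono G_surj] by (simp add: vimage_def)

lemma d_in_X: "c \<in> {1..\<mu>} \<Longrightarrow> d (c, cis t) \<in> topspace X"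
  using immersion continuous_map_image_subset_topspace[of "circles \<mu>" X d]
  by (auto simp: smooth_immersion_def circles_points image_subset_iff)

lemma open_d:
  assumes "c \<in> {1..\<mu>}" "openin X V"
  shows "open {t. d (c, cis t) \<in> V}"
proof -
  have "continuous_map euclideanreal X (d \<circ> (\<lambda>t. (c, cis t)))"
    by (rule continuous_map_compose[OF continuous_map_circle[OF assms(1)]])
      (use immersion in \<open>simp add: smooth_immersion_def\<close>)
  then have "openin euclideanreal {t \<in> topspace euclideanreal. (d \<circ> (\<lambda>t. (c, cis t))) t \<in> V}"
    using assms(2) unfolding continuous_map_def by blast
  then show ?thesis by simp
qed

text \<open>Being a regular smooth curve does not depend on the conformal chart.\<close>

lemma regular:
  assumes c: "c \<in> {1..\<mu>}" and h: "conf_chart V h" and S: "open S" "\<And>t. t \<in> S \<Longrightarrow> d (c, cis t) \<in> V"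
  shows "regular_curve (\<lambda>t. h (d (c, cis t))) S"
proof (rule regular_curve_local)
  fix t assume t: "t \<in> S"
  obtain U \<phi> where U: "(U, \<phi>) \<in> A" "d (c, cis t) \<in> U"
    using smoothing_cover[OF smoothing d_in_X[OF c]] .
  have ch: "conf_chart U \<phi>" by (rule smoothing_conf_chart[OF smoothing U(1)])
  let ?S = "S \<inter> {t. d (c, cis t) \<in> U}"
  have op: "open ?S" using S(1) open_d[OF c conf_chartD(1)[OF ch]] by blast
  have "\<forall>(U, \<phi>)\<in>A. smooth_on (\<lambda>t. \<phi> (d (c, cis t))) {t. d (c, cis t) \<in> U} \<and>
      (\<forall>t. d (c, cis t) \<in> U \<longrightarrow> velocity \<phi> d c t \<noteq> 0)"
    using immersion c unfolding smooth_immersion_def by blast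
  from bspec[OF this U(1)]
  have "smooth_on (\<lambda>t. \<phi> (d (c, cis t))) {t. d (c, cis t) \<in> U}"
    "\<forall>t. d (c, cis t) \<in> U \<longrightarrow> velocity \<phi> d c t \<noteq> 0"
    by simp_all
  then have "regular_curve (\<lambda>t. \<phi> (d (c, cis t))) ?S"
    unfolding regular_curve_def velocity_def by (auto elim: smooth_on_subset)
  then have "regular_curve (\<lambda>t. h (d (c, cis t))) ?S"
    by (rule conf_regular_curve[OF ch h op, rotated]) (use S(2) in auto)
  then show "\<exists>R. open R \<and> t \<in> R \<and> regular_curve (\<lambda>t. h (d (c, cis t))) R"
    using op t U(2) by (intro exI[of _ ?S]) auto
qed

text \<open>The immersion is regular in the given smoothing, hence in the standard coordinates, where
  it is real.\<close>

lemma coord_regular: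
  fixes s0 :: real
  assumes c: "c \<in> {1..\<mu>}"
  defines "S \<equiv> {t. G c t \<in> loc_int s0}"
  shows "open S" "regular_curve (\<lambda>t. of_real (loc_coord s0 (G c t))) S"
proof -
  show S: "open S" unfolding S_def by (rule open_G[OF c loc_int(1)])
  obtain V h where V: "conf_chart V h"
    "\<And>s. s \<in> loc_int s0 \<Longrightarrow> path c s \<in> V" "\<And>s. s \<in> loc_int s0 \<Longrightarrow> h (path c s) = of_real (loc_coord s0 s)"
    using path_coord[OF c] by blast
  have "regular_curve (\<lambda>t. h (d (c, cis t))) S"
    by (rule regular[OF c V(1) S]) (use V(2) d_G[OF c] in \<open>simp add: S_def\<close>)
  then show "regular_curve (\<lambda>t. of_real (loc_coord s0 (G c t))) S"
    by (rule regular_curve_cong[OF S, rotated]) (use V(3) d_G[OF c] in \<open>simp add: S_def\<close>)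
qed

section \<open>Passages through the vertices\<close>

text \<open>The coordinate decreases and is regular, so its derivative is negative.\<close>

lemma vertex_curve:
  assumes c: "c \<in> {1..\<mu>}" and t: "G c t = of_int i"
  shows "\<exists>\<alpha>>0. ((\<lambda>s. complex_of_real (sqrt (of_int i - G c s))) has_vector_derivative of_real (- \<alpha>)) (at t)"
proof -
  let ?a = "\<lambda>s. sqrt (of_int i - G c s)"
  have e: "loc_coord (of_int i) = (\<lambda>s. sqrt (of_int i - s))" by (simp add: loc_coord_def fun_eq_iff)
  let ?S = "{t. G c t \<in> loc_int (of_int i)}"
  note reg = coord_regular[OF c, of "of_int i", unfolded e]
  have tS: "t \<in> ?S" using t loc_int(2) by simp
  note a = regular_curve_of_real[OF reg]
  have "vector_derivative ?a (at t) \<le> 0"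
    by (rule strict_antimono_derivative_nonpos[OF a(3)[OF tS] reg(1) tS])
      (use strict_monoD[OF G_mono[OF c]] in auto)
  then have "0 < - vector_derivative ?a (at t)" using a(2)[OF tS] by simp
  moreover have "((\<lambda>s. complex_of_real (?a s)) has_vector_derivative of_real (vector_derivative ?a (at t))) (at t)"
    by (rule bounded_linear.has_vector_derivative[OF bounded_linear_of_real])
      (use a(3)[OF tS] in \<open>simp add: has_real_derivative_iff_has_vector_derivative\<close>)
  ultimately show ?thesis by (intro exI[of _ "- vector_derivative ?a (at t)"]) simp
qed

text \<open>In the vertex coordinate based at \<open>z\<close>, a strand arriving through the end \<open>turn C j z\<close> comes
  in along the half axis through \<open>\<i> ^ j\<close> and so moves in the direction opposite to it.  The
  factor \<open>\<delta>\<close>, the derivative of the coordinate change, is common to all strands.\<close>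

lemma passage_velocity:
  assumes z: "z \<in> SL" and h: "conf_chart V h" "pt z 1 \<in> V"
  shows "\<exists>\<delta>. \<delta> \<noteq> 0 \<and> (\<forall>c\<in>{1..\<mu>}. \<forall>t i j. G c t = of_int i \<longrightarrow> Plus (lab c (i - 1)) = turn C j z \<longrightarrow>
     (\<exists>\<alpha>>0. ((\<lambda>s. h (d (c, cis s))) has_vector_derivative \<delta> * (- (\<i> ^ j) * of_real \<alpha>)) (at t)))"
proof -
  obtain \<delta> where \<delta>: "\<delta> \<noteq> 0" "\<And>\<gamma> w t v S. (w has_vector_derivative v) (at t) \<Longrightarrow> w t = 0 \<Longrightarrow>
     open S \<Longrightarrow> t \<in> S \<Longrightarrow> (\<forall>s\<in>S. norm (w s) < 1/2 \<and> \<gamma> s = vpt z (w s)) \<Longrightarrow>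
     ((\<lambda>s. h (\<gamma> s)) has_vector_derivative \<delta> * v) (at t)"
    using vertex_velocity[OF z h] by blast
  have "\<exists>\<alpha>>0. ((\<lambda>s. h (d (c, cis s))) has_vector_derivative \<delta> * (- (\<i> ^ j) * of_real \<alpha>)) (at t)"
    if c: "c \<in> {1..\<mu>}" and t: "G c t = of_int i" and j: "Plus (lab c (i - 1)) = turn C j z" for c t i j
  proof -
    let ?a = "\<lambda>s. complex_of_real (sqrt (of_int i - G c s))"
    obtain \<alpha> where \<alpha>: "0 < \<alpha>" "(?a has_vector_derivative of_real (- \<alpha>)) (at t)"
      using vertex_curve[OF c t] by blast
    let ?S = "{s. G c s \<in> ball (of_int i) (1/4)}"
    have "((\<lambda>s. \<i> ^ j * ?a s) has_vector_derivative \<i> ^ j * of_real (- \<alpha>)) (at t)"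
      using \<alpha>(2) by (rule has_vector_derivative_mult_right)
    then have "((\<lambda>s. h (d (c, cis s))) has_vector_derivative \<delta> * (\<i> ^ j * of_real (- \<alpha>))) (at t)"
    proof (rule \<delta>(2))
      show "open ?S" by (rule open_G[OF c]) simp
      show "\<forall>s\<in>?S. norm (\<i> ^ j * ?a s) < 1/2 \<and> d (c, cis s) = vpt z (\<i> ^ j * ?a s)"
      proof
        fix s assume "s \<in> ?S"
        then have "\<bar>G c s - of_int i\<bar> < 1/4" by (simp add: dist_real_def abs_minus_commute)
        note p = path_vpt[OF c this]
        have "d (c, cis s) = vpt z (\<i> ^ j * ?a s)"
          unfolding d_G[OF c] p(2) j by (rule vpt_turn[OF z p(1)])
        then show "norm (\<i> ^ j * ?a s) < 1/2 \<and> d (c, cis s) = vpt z (\<i> ^ j * ?a s)"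
          using p(1) by (simp add: norm_mult norm_power)
      qed
    qed (use t in auto)
    then show ?thesis using \<alpha>(1) by auto
  qed
  then show ?thesis using \<delta>(1) by blast
qed

end

section \<open>Pairs of strands at a vertex\<close>

context pdb
begin

lemma Plus_ends_of_vertex:
  assumes "x \<in> SL" "y \<in> SL" "is_Plus x" "is_Plus y" "vertex_of C x = vertex_of C y" "x \<noteq> y"
  shows "y = turn C 1 x \<or> y = turn C 3 x"
proof -
  obtain i where i: "i < 4" "y = turn C i x" using same_vertex[OF assms(1,2,5)] by blast
  have "i \<noteq> 0" using i(2) turn_0[OF assms(1)] assms(6) by metis
  moreover have "i \<noteq> 2" using i(2) assms(3,4) opposite_sign[OF assms(1)] by auto
  ultimately have "i = 1 \<or> i = 3" using i(1) by linarith
  then show ?thesis using i(2) by blast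
qed

lemma turn_3: "x \<in> SL \<Longrightarrow> turn C 3 x = turn C 2 (turn C 1 x)" "x \<in> SL \<Longrightarrow> turn C 1 (turn C 3 x) = x"
  "x \<in> SL \<Longrightarrow> turn C 3 (turn C 1 x) = x"
  by (simp_all add: turn_turn)

lemma other_Plus:
  assumes "x \<in> SL"
  shows "is_Plus (turn C 1 x) \<longleftrightarrow> \<not> is_Plus (turn C 3 x)"
  using opposite_sign[of "turn C 1 x"] assms unfolding turn_3(1)[OF assms] by simp

lemma turn_1_neq_3: "x \<in> SL \<Longrightarrow> turn C 1 x \<noteq> turn C 3 x"
  using other_Plus by metis

text \<open>The orientation of the frame formed by the strands arriving through \<open>x\<close> and through \<open>y\<close>.\<close>

definition ori :: "slabel \<Rightarrow> slabel \<Rightarrow> real" where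
  "ori x y = (if y = turn C 1 x then 1 else - 1)"

lemma ori_antisym:
  assumes "x \<in> SL" "y \<in> SL" "is_Plus x" "is_Plus y" "vertex_of C x = vertex_of C y" "x \<noteq> y"
  shows "ori y x = - ori x y"
  using Plus_ends_of_vertex[OF assms]
proof
  assume y: "y = turn C 1 x"
  then have "x = turn C 3 y" using turn_3(3)[OF assms(1)] by simp
  then have "x \<noteq> turn C 1 y" using turn_1_neq_3[OF assms(2)] by simp
  then show ?thesis using y unfolding ori_def by simp
next
  assume y: "y = turn C 3 x"
  then have "x = turn C 1 y" using turn_3(2)[OF assms(1)] by simp
  moreover have "y \<noteq> turn C 1 x" using y turn_1_neq_3[OF assms(1)] by simp
  ultimately show ?thesis unfolding ori_def by simp
qed

end

context immersed
begin

text \<open>The positive end through which the circle \<open>c\<close> arrives at the vertex that it passes at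
  the point \<open>z\<close>.\<close>

definition arrive :: "nat \<Rightarrow> complex \<Rightarrow> slabel" where
  "arrive c z = Plus (lab c (\<lfloor>G c (Arg z)\<rfloor> - 1))"

lemma circle_cis: "norm z = 1 \<Longrightarrow> z = cis (Arg z)"
  by (cases "z = 0") (simp_all add: cis_Arg sgn_div_norm)

lemma arrive:
  assumes c: "c \<in> {1..\<mu>}" and i: "G c \<theta> = of_int i"
  shows "arrive c (cis \<theta>) = Plus (lab c (i - 1))"
proof -
  have "cis (Arg (cis \<theta>)) = cis \<theta>" using circle_cis[of "cis \<theta>"] by simp
  then obtain j where "Arg (cis \<theta>) = \<theta> + 2 * pi * of_int j" unfolding cis_eq_iff by blast
  then have "G c (Arg (cis \<theta>)) = of_int (i + j * int (n c))"
    using G_period_int[OF c, of \<theta> j] i by simp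
  then have "\<lfloor>G c (Arg (cis \<theta>))\<rfloor> - 1 = (i - 1) + j * int (n c)" by (simp only: floor_of_int)
  then show ?thesis unfolding arrive_def by (simp only: lab_period)
qed

lemma vertex_int:
  assumes "c \<in> {1..\<mu>}" "x \<in> SL" "d (c, cis \<theta>) = pt x 1"
  obtains i where "G c \<theta> = of_int i" "arrive c (cis \<theta>) = Plus (lab c (i - 1))"
    "arrive c (cis \<theta>) \<in> SL" "vertex_of C (arrive c (cis \<theta>)) = vertex_of C x"
proof -
  define i where "i = \<lfloor>G c \<theta>\<rfloor>"
  have i: "G c \<theta> = of_int i"
    unfolding i_def by (rule path_vertex_imp_int[OF assms(1,2)]) (use assms(3) d_G[OF assms(1)] in simp)
  note a = arrive[OF assms(1) i]
  have "pt (Plus (lab c (i - 1))) 1 = pt x 1"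
    using assms(3) d_G[OF assms(1), of \<theta>] i path_int(2)[OF assms(1), of i] by simp
  then have "vertex_of C (Plus (lab c (i - 1))) = vertex_of C x"
    using pt_corner_eq_iff[OF lab_SL(1)[OF assms(1)] assms(2)] by simp
  then show thesis using that[OF i a] lab_SL(1)[OF assms(1)] a by simp
qed

lemma arrive_point:
  assumes "c \<in> {1..\<mu>}" "G c \<theta> = of_int i"
  shows "d (c, cis \<theta>) = pt (arrive c (cis \<theta>)) 1" "arrive c (cis \<theta>) \<in> SL" "is_Plus (arrive c (cis \<theta>))"
  using d_G[OF assms(1)] assms(2) path_int(2)[OF assms(1)] arrive[OF assms] lab_SL(1)[OF assms(1)] by simp_all

lemma arrive_inj:
  assumes "c \<in> {1..\<mu>}" "c' \<in> {1..\<mu>}" "G c \<theta> = of_int i" "G c' \<theta>' = of_int i'"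
    "arrive c (cis \<theta>) = arrive c' (cis \<theta>')"
  shows "(c, cis \<theta>) = (c', cis \<theta>')"
proof -
  have l: "lab c (i - 1) = lab c' (i' - 1)" using assms(5) arrive assms(1-4) by simp
  then have cc: "c = c'" by (metis fst_lab)
  then have "(i - 1) mod int (n c) = (i' - 1) mod int (n c)" using l lab_eq_iff[OF assms(1)] by simp
  then obtain j where "i - 1 = (i' - 1) + int (n c) * j" by (metis mod_eqE diff_eq_eq add.commute)
  then have "i = i' + j * int (n c)" by (simp add: mult.commute)
  then have "real_of_int i = of_int i' + of_int j * real (n c)" by simp
  then have "T c (of_int i) = T c (of_int i') + 2 * pi * of_int j" using T_period_int[OF assms(1)] by simp
  moreover have "\<theta> = T c (of_int i)" "\<theta>' = T c (of_int i')"
    using T_G[OF assms(1), of \<theta>] T_G[OF assms(2), of \<theta>'] assms(3,4) cc by simp_all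
  ultimately have "\<theta> = \<theta>' + 2 * pi * of_int j" by simp
  then have "cis \<theta> = cis \<theta>'" using cis_eq_iff by blast
  then show ?thesis using cc by simp
qed

lemma arrive_surj:
  assumes "Plus l \<in> SL"
  obtains \<theta> i where "fst l \<in> {1..\<mu>}" "G (fst l) \<theta> = of_int i" "arrive (fst l) (cis \<theta>) = Plus l"
    "d (fst l, cis \<theta>) = pt (Plus l) 1"
proof -
  have l: "l \<in> L" using assms by (simp add: signed_labels_iff)
  then have c: "fst l \<in> {1..\<mu>}" by (auto simp: labels_def)
  let ?i = "int (snd l)"
  have i: "G (fst l) (T (fst l) (of_int ?i)) = of_int ?i" by (rule G_T[OF c])
  have "arrive (fst l) (cis (T (fst l) (of_int ?i))) = Plus l"
    using arrive[OF c i] lab_surj[OF l] by simp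
  then show thesis using that[OF c i] arrive_point(1)[OF c i] by simp
qed

text \<open>Inside the edges the circuits are injective up to full turns, so two different points of the
  circles are mapped to the same point only at a vertex, arriving there through different ends.\<close>

lemma double_point:
  assumes "c \<in> {1..\<mu>}" "c' \<in> {1..\<mu>}" "d (c, cis \<theta>) = d (c', cis \<theta>')" "(c, cis \<theta>) \<noteq> (c', cis \<theta>')"
  obtains i i' where "G c \<theta> = of_int i" "G c' \<theta>' = of_int i'"
    "arrive c (cis \<theta>) \<noteq> arrive c' (cis \<theta>')"
    "vertex_of C (arrive c (cis \<theta>)) = vertex_of C (arrive c' (cis \<theta>'))"
proof -
  have "G c \<theta> = of_int \<lfloor>G c \<theta>\<rfloor>"
  proof (rule ccontr)
    assume "G c \<theta> \<noteq> of_int \<lfloor>G c \<theta>\<rfloor>"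
    moreover have "path c (G c \<theta>) = path c' (G c' \<theta>')" using assms(1-3) d_G by metis
    ultimately obtain j where j: "c = c'" "G c' \<theta>' = G c \<theta> + of_int j * real (n c)"
      using path_inj[OF assms(1,2)] by blast
    then have "T c (G c \<theta>') = T c (G c \<theta>) + 2 * pi * of_int j" using T_period_int[OF assms(1)] by simp
    then have "\<theta>' = \<theta> + 2 * pi * of_int j" using T_G[OF assms(1)] by simp
    then have "cis \<theta>' = cis \<theta>" using cis_eq_iff by blast
    then show False using j(1) assms(4) by simp
  qed
  then obtain i where i: "G c \<theta> = of_int i" by blast
  note a = arrive_point[OF assms(1) i]
  have "d (c', cis \<theta>') = pt (arrive c (cis \<theta>)) 1" using a(1) assms(3) by simp
  then obtain i' where i': "G c' \<theta>' = of_int i'"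
    "vertex_of C (arrive c' (cis \<theta>')) = vertex_of C (arrive c (cis \<theta>))"
    using vertex_int[OF assms(2) a(2)] by metis
  have "arrive c (cis \<theta>) \<noteq> arrive c' (cis \<theta>')"
    using arrive_inj[OF assms(1,2) i i'(1)] assms(4) by blast
  then show thesis using that[OF i i'(1)] i'(2) by simp
qed

lemma has_velocity: "((\<lambda>s. h (d (c, cis s))) has_vector_derivative v) (at t) \<Longrightarrow> velocity h d c t = v"
  unfolding velocity_def by (rule vector_derivative_at)

lemma det2_powers:
  "det2 (- (\<i> ^ 0) * of_real \<alpha>) (- (\<i> ^ 1) * of_real \<beta>) = \<alpha> * \<beta>"
  "det2 (- (\<i> ^ 0) * of_real \<alpha>) (- (\<i> ^ 3) * of_real \<beta>) = - (\<alpha> * \<beta>)"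
  by (simp_all add: det2_def power3_eq_cube)

text \<open>Both velocities contain the same factor \<open>\<delta>\<close>, which multiplies the determinant by the
  positive number \<open>(norm \<delta>)\<^sup>2\<close>; so its sign is the same in all charts.\<close>

lemma pair_velocity:
  assumes "c \<in> {1..\<mu>}" "c' \<in> {1..\<mu>}" "d (c, cis \<theta>) = d (c', cis \<theta>')" "(c, cis \<theta>) \<noteq> (c', cis \<theta>')"
    "conf_chart V h" "d (c, cis \<theta>) \<in> V"
  shows "\<exists>\<kappa>>0. det2 (velocity h d c \<theta>) (velocity h d c' \<theta>') = \<kappa> * ori (arrive c (cis \<theta>)) (arrive c' (cis \<theta>'))"
proof -
  obtain i i' where i: "G c \<theta> = of_int i" "G c' \<theta>' = of_int i'"
    "arrive c (cis \<theta>) \<noteq> arrive c' (cis \<theta>')"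
    "vertex_of C (arrive c (cis \<theta>)) = vertex_of C (arrive c' (cis \<theta>'))"
    using double_point[OF assms(1-4)] .
  note a = arrive_point[OF assms(1) i(1)] and a' = arrive_point[OF assms(2) i(2)]
  let ?x = "arrive c (cis \<theta>)" and ?y = "arrive c' (cis \<theta>')"
  obtain \<delta> where \<delta>: "\<delta> \<noteq> 0" "\<And>c t i j. c \<in> {1..\<mu>} \<Longrightarrow> G c t = of_int i \<Longrightarrow> Plus (lab c (i - 1)) = turn C j ?x \<Longrightarrow>
     (\<exists>\<alpha>>0. ((\<lambda>s. h (d (c, cis s))) has_vector_derivative \<delta> * (- (\<i> ^ j) * of_real \<alpha>)) (at t))"
    using passage_velocity[OF a(2) assms(5)] assms(6) a(1) by auto
  have "Plus (lab c (i - 1)) = turn C 0 ?x" using arrive[OF assms(1) i(1)] a(2) by simp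
  from \<delta>(2)[OF assms(1) i(1) this]
  obtain \<alpha> where \<alpha>: "0 < \<alpha>" "velocity h d c \<theta> = \<delta> * (- (\<i> ^ 0) * of_real \<alpha>)" using has_velocity by blast
  have *: "\<exists>\<beta>>0. velocity h d c' \<theta>' = \<delta> * (- (\<i> ^ j) * of_real \<beta>)" if "?y = turn C j ?x" for j
    using \<delta>(2)[OF assms(2) i(2), of j] arrive[OF assms(2) i(2)] that has_velocity by auto
  have pos: "0 < (norm \<delta>)\<^sup>2" using \<delta>(1) by simp
  from Plus_ends_of_vertex[OF a(2) a'(2) a(3) a'(3) i(4,3)]
  show ?thesis
  proof
    assume y: "?y = turn C 1 ?x"
    from *[OF y] obtain \<beta> where \<beta>: "0 < \<beta>" "velocity h d c' \<theta>' = \<delta> * (- (\<i> ^ 1) * of_real \<beta>)" by blast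
    have "det2 (velocity h d c \<theta>) (velocity h d c' \<theta>') = (norm \<delta>)\<^sup>2 * (\<alpha> * \<beta>) * ori ?x ?y"
      unfolding \<alpha>(2) \<beta>(2) det2_mult det2_powers using y by (simp add: ori_def)
    then show ?thesis using pos \<alpha>(1) \<beta>(1) by (intro exI[of _ "(norm \<delta>)\<^sup>2 * (\<alpha> * \<beta>)"]) simp
  next
    assume y: "?y = turn C 3 ?x"
    then have "?y \<noteq> turn C 1 ?x" using turn_1_neq_3[OF a(2)] by simp
    then have o: "ori ?x ?y = - 1" by (simp add: ori_def)
    from *[OF y] obtain \<beta> where \<beta>: "0 < \<beta>" "velocity h d c' \<theta>' = \<delta> * (- (\<i> ^ 3) * of_real \<beta>)" by blast
    have "det2 (velocity h d c \<theta>) (velocity h d c' \<theta>') = (norm \<delta>)\<^sup>2 * (\<alpha> * \<beta>) * ori ?x ?y"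
      unfolding \<alpha>(2) \<beta>(2) det2_mult det2_powers o by simp
    then show ?thesis using pos \<alpha>(1) \<beta>(1) by (intro exI[of _ "(norm \<delta>)\<^sup>2 * (\<alpha> * \<beta>)"]) simp
  qed
qed

section \<open>The crossings are the vertices\<close>

text \<open>Opposite ends have opposite signs, so exactly one end of each of the two opposite pairs
  is positive.\<close>

lemma Plus_end_of_vertex:
  assumes "x \<in> SL"
  obtains l l' where "Plus l \<in> SL" "Plus l' \<in> SL" "l \<noteq> l'"
    "vertex_of C (Plus l) = vertex_of C x" "vertex_of C (Plus l') = vertex_of C x"
    "\<And>y. y \<in> SL \<Longrightarrow> is_Plus y \<Longrightarrow> vertex_of C y = vertex_of C x \<Longrightarrow> y = Plus l \<or> y = Plus l'"
proof -
  define x0 where "x0 = (if is_Plus x then x else turn C 2 x)"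
  have x0: "x0 \<in> SL" "is_Plus x0" "vertex_of C x0 = vertex_of C x"
    using assms opposite_sign[OF assms] by (auto simp: x0_def)
  define x1 where "x1 = (if is_Plus (turn C 1 x0) then turn C 1 x0 else turn C 3 x0)"
  have x1: "x1 \<in> SL" "is_Plus x1" "vertex_of C x1 = vertex_of C x"
    using x0 other_Plus[OF x0(1)] by (auto simp: x1_def)
  have ne: "x0 \<noteq> x1"
  proof
    assume "x0 = x1"
    then have "turn C 0 x0 = turn C 1 x0 \<or> turn C 0 x0 = turn C 3 x0"
      using x0(1) by (auto simp: x1_def split: if_splits)
    then show False using turn_inj[OF x0(1), of 0 1] turn_inj[OF x0(1), of 0 3] by auto
  qed
  have "y = x0 \<or> y = x1" if y: "y \<in> SL" "is_Plus y" "vertex_of C y = vertex_of C x" for y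
  proof (cases "y = x0")
    case False
    then have "y = turn C 1 x0 \<or> y = turn C 3 x0"
      using Plus_ends_of_vertex[OF x0(1) y(1) x0(2) y(2)] x0(3) y(3) by auto
    then show ?thesis using y(2) other_Plus[OF x0(1)] by (auto simp: x1_def)
  qed simp
  moreover obtain l l' where "x0 = Plus l" "x1 = Plus l'" using x0(2) x1(2) by (cases x0; cases x1) auto
  ultimately show thesis using that[of l l'] x0 x1 ne by auto
qed

lemma vertex_preimage:
  assumes "x \<in> SL"
  obtains c \<theta> c' \<theta>' where "c \<in> {1..\<mu>}" "c' \<in> {1..\<mu>}" "(c, cis \<theta>) \<noteq> (c', cis \<theta>')"
    "{p \<in> topspace (circles \<mu>). d p = pt x 1} = {(c, cis \<theta>), (c', cis \<theta>')}"
proof -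
  obtain l l' where l: "Plus l \<in> SL" "Plus l' \<in> SL" "l \<noteq> l'"
    "vertex_of C (Plus l) = vertex_of C x" "vertex_of C (Plus l') = vertex_of C x"
    "\<And>y. y \<in> SL \<Longrightarrow> is_Plus y \<Longrightarrow> vertex_of C y = vertex_of C x \<Longrightarrow> y = Plus l \<or> y = Plus l'"
    by (rule Plus_end_of_vertex[OF assms]) (rule that)
  obtain \<theta> i where \<theta>: "fst l \<in> {1..\<mu>}" "G (fst l) \<theta> = of_int i" "arrive (fst l) (cis \<theta>) = Plus l"
    "d (fst l, cis \<theta>) = pt (Plus l) 1" using arrive_surj[OF l(1)] .
  obtain \<theta>' i' where \<theta>': "fst l' \<in> {1..\<mu>}" "G (fst l') \<theta>' = of_int i'" "arrive (fst l') (cis \<theta>') = Plus l'"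
    "d (fst l', cis \<theta>') = pt (Plus l') 1" using arrive_surj[OF l(2)] .
  have img: "d (fst l, cis \<theta>) = pt x 1" "d (fst l', cis \<theta>') = pt x 1"
    using \<theta>(4) \<theta>'(4) pt_corner_eq_iff[OF l(1) assms] pt_corner_eq_iff[OF l(2) assms] l(4,5) by simp_all
  have "{p \<in> topspace (circles \<mu>). d p = pt x 1} = {(fst l, cis \<theta>), (fst l', cis \<theta>')}"
  proof (intro set_eqI iffI)
    fix p assume "p \<in> {p \<in> topspace (circles \<mu>). d p = pt x 1}"
    then have p: "fst p \<in> {1..\<mu>}" "norm (snd p) = 1" "d p = pt x 1" by (auto simp: circles_points)
    define t where "t = Arg (snd p)"
    have pt: "p = (fst p, cis t)" using circle_cis[OF p(2)] by (simp add: t_def prod_eq_iff)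
    then have "d (fst p, cis t) = pt x 1" using p(3) by simp
    then obtain j where j: "G (fst p) t = of_int j" "arrive (fst p) (cis t) \<in> SL"
      "vertex_of C (arrive (fst p) (cis t)) = vertex_of C x"
      using vertex_int[OF p(1) assms] by metis
    from l(6)[OF j(2) arrive_point(3)[OF p(1) j(1)] j(3)]
    have "(fst p, cis t) = (fst l, cis \<theta>) \<or> (fst p, cis t) = (fst l', cis \<theta>')"
      using arrive_inj[OF p(1) \<theta>(1) j(1) \<theta>(2)] arrive_inj[OF p(1) \<theta>'(1) j(1) \<theta>'(2)] \<theta>(3) \<theta>'(3) by auto
    then show "p \<in> {(fst l, cis \<theta>), (fst l', cis \<theta>')}" using pt by auto
  next
    fix p assume "p \<in> {(fst l, cis \<theta>), (fst l', cis \<theta>')}"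
    then show "p \<in> {p \<in> topspace (circles \<mu>). d p = pt x 1}"
      using img \<theta>(1) \<theta>'(1) by (auto simp: circles_points)
  qed
  moreover have "(fst l, cis \<theta>) \<noteq> (fst l', cis \<theta>')"
  proof
    assume "(fst l, cis \<theta>) = (fst l', cis \<theta>')"
    then have "Plus l = Plus l'" using \<theta>(3) \<theta>'(3) by (metis prod.inject)
    then show False using l(3) by simp
  qed
  ultimately show thesis using that \<theta>(1) \<theta>'(1) by blast
qed

lemma crossings_eq: "crossings \<mu> d = (\<lambda>x. pt x 1) ` SL"
proof (intro set_eqI iffI)
  fix q assume "q \<in> crossings \<mu> d"
  then obtain p p' where p: "p \<in> topspace (circles \<mu>)" "p' \<in> topspace (circles \<mu>)" "p' \<noteq> p" "d p' = d p" "q = d p"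
    by (auto simp: crossings_def)
  have e: "p = (fst p, cis (Arg (snd p)))" "p' = (fst p', cis (Arg (snd p')))"
    using circle_cis p(1,2) by (simp_all add: circles_points prod_eq_iff)
  have c: "fst p \<in> {1..\<mu>}" "fst p' \<in> {1..\<mu>}" using p(1,2) by (auto simp: circles_points)
  have dd: "d (fst p, cis (Arg (snd p))) = d (fst p', cis (Arg (snd p')))"
    "(fst p, cis (Arg (snd p))) \<noteq> (fst p', cis (Arg (snd p')))"
    using p(3,4) unfolding e[symmetric] by simp_all
  obtain i where "G (fst p) (Arg (snd p)) = of_int i"
    by (rule double_point[OF c dd]) (rule that)
  note a = arrive_point[OF c(1) this]
  have "q = d (fst p, cis (Arg (snd p)))" unfolding p(5) by (rule arg_cong[OF e(1)])
  then show "q \<in> (\<lambda>x. pt x 1) ` SL" unfolding a(1) using a(2) by (rule image_eqI)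
next
  fix q assume "q \<in> (\<lambda>x. pt x 1) ` SL"
  then obtain x where x: "x \<in> SL" "q = pt x 1" by blast
  obtain c \<theta> c' \<theta>' where v: "(c, cis \<theta>) \<noteq> (c', cis \<theta>')"
    "{p \<in> topspace (circles \<mu>). d p = pt x 1} = {(c, cis \<theta>), (c', cis \<theta>')}"
    by (rule vertex_preimage[OF x(1)]) (rule that)
  have "(c, cis \<theta>) \<in> {p \<in> topspace (circles \<mu>). d p = pt x 1}"
    "(c', cis \<theta>') \<in> {p \<in> topspace (circles \<mu>). d p = pt x 1}" unfolding v(2) by simp_all
  then show "q \<in> crossings \<mu> d" unfolding crossings_def mem_Collect_eq
    using x(2) v(1)[symmetric] by (intro exI[of _ "(c, cis \<theta>)"] conjI bexI[of _ "(c', cis \<theta>')"]) simp_all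
qed

lemma transverse: "transverse_double_points A \<mu> d"
  unfolding transverse_double_points_def
proof (intro conjI ballI allI impI)
  show "finite (crossings \<mu> d)" unfolding crossings_eq by simp
  fix q assume "q \<in> crossings \<mu> d"
  then obtain x where x: "x \<in> SL" "q = pt x 1" unfolding crossings_eq by blast
  obtain c \<theta> c' \<theta>' where v: "(c, cis \<theta>) \<noteq> (c', cis \<theta>')"
    "{p \<in> topspace (circles \<mu>). d p = pt x 1} = {(c, cis \<theta>), (c', cis \<theta>')}"
    by (rule vertex_preimage[OF x(1)]) (rule that)
  show "card {p \<in> topspace (circles \<mu>). d p = q} = 2"
    unfolding x(2) v(2) using v(1) by (simp only: card_2_iff) blast
next
  fix c c' \<theta> \<theta>' \<kappa>
  assume c: "c \<in> {1..\<mu>}" "c' \<in> {1..\<mu>}" "(c, cis \<theta>) \<noteq> (c', cis \<theta>')" "d (c, cis \<theta>) = d (c', cis \<theta>')" and "\<kappa> \<in> A"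
  obtain U \<phi> where \<kappa>: "\<kappa> = (U, \<phi>)" by (cases \<kappa>)
  have ch: "conf_chart U \<phi>" using smoothing_conf_chart[OF smoothing] \<open>\<kappa> \<in> A\<close> \<kappa> by simp
  have "det2 (velocity \<phi> d c \<theta>) (velocity \<phi> d c' \<theta>') \<noteq> 0" if "d (c, cis \<theta>) \<in> U"
    using pair_velocity[OF c(1,2,4,3) ch that] by (auto simp: ori_def split: if_splits)
  then show "case \<kappa> of (U, \<phi>) \<Rightarrow> d (c, cis \<theta>) \<in> U \<longrightarrow> det2 (velocity \<phi> d c \<theta>) (velocity \<phi> d c' \<theta>') \<noteq> 0"
    using \<kappa> by simp
qed

lemma edge_labeling:
  assumes E: "\<forall>l\<in>L. E l = edge_path \<mu> n C b l ` {0<..<1}"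
  shows "edge_labeling \<mu> n d E"
  unfolding edge_labeling_def
proof (intro ballI exI conjI)
  fix c assume c: "c \<in> {1..\<mu>}"
  let ?\<theta> = "\<lambda>k. T c (real k - 1)"
  have N: "0 < n c" using n_pos[OF c] by simp
  show "?\<theta> k < ?\<theta> (k + 1)" for k using strict_monoD[OF T_mono[OF c]] by simp
  show "?\<theta> (n c + 1) = ?\<theta> 1 + 2 * pi" using T_period[OF c, of 0] by simp
  show "{z \<in> sphere 0 1. d (c, z) \<in> crossings \<mu> d} = (\<lambda>k. cis (?\<theta> k)) ` {1..n c}"
  proof (intro set_eqI iffI)
    fix z assume "z \<in> {z \<in> sphere 0 1. d (c, z) \<in> crossings \<mu> d}"
    then have z: "norm z = 1" "d (c, z) \<in> crossings \<mu> d" by simp_all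
    define t where "t = Arg z"
    have zt: "z = cis t" using circle_cis[OF z(1)] by (simp add: t_def)
    obtain x where "x \<in> SL" "d (c, cis t) = pt x 1" using z(2) unfolding crossings_eq zt by blast
    then obtain i where i: "G c t = of_int i" using vertex_int[OF c] by metis
    let ?r = "i mod int (n c)"
    have "real_of_int i = of_int ?r + of_int (i div int (n c)) * real (n c)"
      by (metis add.commute mult_div_mod_eq mult.commute of_int_add of_int_mult of_int_of_nat_eq)
    then have "t = T c (of_int ?r) + 2 * pi * of_int (i div int (n c))"
      using T_period_int[OF c, of "of_int ?r" "i div int (n c)"] T_G[OF c, of t] i by simp
    then have z': "z = cis (T c (of_int ?r))" unfolding zt cis_eq_iff by blast
    have r: "of_int ?r = real (nat ?r + 1) - 1" using N by simp
    have "nat ?r + 1 \<in> {1..n c}" using N by (simp add: Suc_le_eq nat_less_iff)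
    then show "z \<in> (\<lambda>k. cis (?\<theta> k)) ` {1..n c}" unfolding z' r by (rule imageI)
  next
    fix z assume "z \<in> (\<lambda>k. cis (?\<theta> k)) ` {1..n c}"
    then obtain k where k: "1 \<le> k" "z = cis (?\<theta> k)" by auto
    have "G c (?\<theta> k) = of_int (int k - 1)" using G_T[OF c] by simp
    note a = arrive_point[OF c this]
    then show "z \<in> {z \<in> sphere 0 1. d (c, z) \<in> crossings \<mu> d}"
      unfolding crossings_eq using k(2) by auto
  qed
  fix k assume k: "k \<in> {1..n c}"
  have l: "lab c (int k - 1) = (c, k)" "(c, k) \<in> L"
    using lab_surj[of "(c, k)"] k c by (simp_all add: labels_def)
  have path: "path c s = edge_path \<mu> n C b (c, k) (s - (real k - 1))" if "real k - 1 < s" "s < real k" for s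
    using path_floor[of "int k - 1" s c] that unfolding l(1) edge_path_eq by simp
  have "edge_path \<mu> n C b (c, k) ` {0<..<1} = (\<lambda>t. d (c, cis t)) ` {?\<theta> k<..<?\<theta> (k + 1)}"
  proof (intro set_eqI iffI)
    fix q assume "q \<in> edge_path \<mu> n C b (c, k) ` {0<..<1}"
    then obtain u where u: "0 < u" "u < 1" "q = edge_path \<mu> n C b (c, k) u" by auto
    let ?s = "real k - 1 + u"
    have "q = d (c, cis (T c ?s))" using path[of ?s] u d_T[OF c] by simp
    moreover have "T c ?s \<in> {?\<theta> k<..<?\<theta> (k + 1)}"
      using strict_monoD[OF T_mono[OF c], of "real k - 1" ?s] strict_monoD[OF T_mono[OF c], of ?s "real k"] u by simp
    ultimately show "q \<in> (\<lambda>t. d (c, cis t)) ` {?\<theta> k<..<?\<theta> (k + 1)}" by blast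
  next
    fix q assume "q \<in> (\<lambda>t. d (c, cis t)) ` {?\<theta> k<..<?\<theta> (k + 1)}"
    then obtain t where t: "?\<theta> k < t" "t < ?\<theta> (k + 1)" "q = d (c, cis t)" by auto
    have "real k - 1 < G c t" "G c t < real k"
      using strict_monoD[OF G_mono[OF c] t(1)] strict_monoD[OF G_mono[OF c] t(2)] G_T[OF c] by simp_all
    then have "q = edge_path \<mu> n C b (c, k) (G c t - (real k - 1))" "G c t - (real k - 1) \<in> {0<..<1}"
      using path t(3) d_G[OF c] by simp_all
    then show "q \<in> edge_path \<mu> n C b (c, k) ` {0<..<1}" by blast
  qed
  then show "E (c, k) = (\<lambda>t. d (c, cis t)) ` {?\<theta> k<..<?\<theta> (k + 1)}" using E l(2) by simp
qed

section \<open>Cyclic order and over-strands\<close>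

text \<open>Just before (or after) \<open>\<theta>\<close> the circle is on the open edge of \<open>x\<close>; as edges are disjoint, this
  identifies the edge that the circuit runs through before (or after) the integer \<open>G c \<theta>\<close>.\<close>

lemma at_end_label:
  assumes "x \<in> SL" "at_end \<mu> n C b d x \<theta>"
  defines "c \<equiv> fst (label_of x)"
  shows "\<exists>i. G c \<theta> = of_int i \<and> x = (if is_Plus x then Plus (lab c (i - 1)) else Minus (lab c i))"
proof -
  have l: "label_of x \<in> L" using assms(1) by (simp add: signed_labels_iff)
  then have c: "c \<in> {1..\<mu>}" by (auto simp: labels_def c_def)
  have "d (c, cis \<theta>) = pt x 1" using assms(2) end_point_eq[OF assms(1)] by (simp add: at_end_def c_def)
  then obtain i where i: "G c \<theta> = of_int i" using vertex_int[OF c assms(1)] by metis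
  obtain e where e: "0 < e" "\<forall>t\<in>(if is_Plus x then {\<theta> - e<..<\<theta>} else {\<theta><..<\<theta> + e}).
      d (c, cis t) \<in> edge_path \<mu> n C b (label_of x) ` {0<..<1}"
    using assms(2) unfolding at_end_def c_def by blast
  have th: "\<theta> = T c (of_int i)" using T_G[OF c, of \<theta>] i by simp
  have lab: "lab c \<lfloor>G c t\<rfloor> = label_of x" if "d (c, cis t) \<in> edge_path \<mu> n C b (label_of x) ` {0<..<1}" for t
  proof -
    obtain u where "0 < u" "u < 1" "path c (G c t) = pt (Plus (label_of x)) (of_real u)"
      using \<open>d (c, cis t) \<in> _\<close> by (auto simp: edge_path_eq d_G[OF c])
    then show ?thesis using path_in_edge(1)[OF c l] by blast
  qed
  show ?thesis
  proof (cases "is_Plus x")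
    case True
    define t where "t = max (\<theta> - e / 2) (T c (of_int i - 1/2))"
    have t: "T c (of_int i - 1/2) \<le> t" "t < \<theta>" "\<theta> - e < t"
      using e(1) strict_monoD[OF T_mono[OF c], of "of_int i - 1/2" "of_int i"] th by (auto simp: t_def)
    have "of_int i - 1/2 \<le> G c t" "G c t < of_int i"
      using t(1,2) strict_mono_less_eq[OF G_mono[OF c]] strict_monoD[OF G_mono[OF c], of t \<theta>] G_T[OF c] i by metis+
    then have "\<lfloor>G c t\<rfloor> = i - 1" by linarith
    moreover have "lab c \<lfloor>G c t\<rfloor> = label_of x" by (rule lab) (use e(2) True t in auto)
    ultimately have "x = Plus (lab c (i - 1))" using True by (cases x) auto
    then show ?thesis using i True by (intro exI[of _ i]) simp
  next
    case False
    define t where "t = min (\<theta> + e / 2) (T c (of_int i + 1/2))"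
    have t: "t \<le> T c (of_int i + 1/2)" "\<theta> < t" "t < \<theta> + e"
      using e(1) strict_monoD[OF T_mono[OF c], of "of_int i" "of_int i + 1/2"] th by (auto simp: t_def)
    have "G c t \<le> of_int i + 1/2" "of_int i < G c t"
      using t(1,2) strict_mono_less_eq[OF G_mono[OF c]] strict_monoD[OF G_mono[OF c], of \<theta> t] G_T[OF c] i by metis+
    then have "\<lfloor>G c t\<rfloor> = i" by linarith
    moreover have "lab c \<lfloor>G c t\<rfloor> = label_of x" by (rule lab) (use e(2) False t in auto)
    ultimately have "x = Minus (lab c i)" using False by (cases x) auto
    then show ?thesis using i False by (intro exI[of _ i]) simp
  qed
qed

text \<open>A strand arriving through an end moves against its outward direction, and a strand leaving
  through an end moves along it; in both cases the outward direction is that of the half axis.\<close>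

lemma outward_direction:
  assumes z: "z \<in> SL" and h: "conf_chart V h" "pt z 1 \<in> V"
  shows "\<exists>\<delta>. \<delta> \<noteq> 0 \<and> (\<forall>j \<theta>. at_end \<mu> n C b d (turn C j z) \<theta> \<longrightarrow>
    (\<exists>\<alpha>>0. outward h d (turn C j z) \<theta> = \<delta> * (\<i> ^ j * of_real \<alpha>)))"
proof -
  obtain \<delta> where \<delta>: "\<delta> \<noteq> 0" "\<And>c t i j. c \<in> {1..\<mu>} \<Longrightarrow> G c t = of_int i \<Longrightarrow> Plus (lab c (i - 1)) = turn C j z \<Longrightarrow>
     (\<exists>\<alpha>>0. ((\<lambda>s. h (d (c, cis s))) has_vector_derivative \<delta> * (- (\<i> ^ j) * of_real \<alpha>)) (at t))"
    using passage_velocity[OF z h] by auto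
  have "\<exists>\<alpha>>0. outward h d (turn C j z) \<theta> = \<delta> * (\<i> ^ j * of_real \<alpha>)" if a: "at_end \<mu> n C b d (turn C j z) \<theta>" for j \<theta>
  proof -
    let ?e = "turn C j z"
    let ?c = "fst (label_of ?e)"
    have e: "?e \<in> SL" using z by simp
    then have "label_of ?e \<in> L" by (simp add: signed_labels_iff)
    then have c: "?c \<in> {1..\<mu>}" by (auto simp: labels_def)
    obtain i where i: "G ?c \<theta> = of_int i" "?e = (if is_Plus ?e then Plus (lab ?c (i - 1)) else Minus (lab ?c i))"
      using at_end_label[OF e a] by blast
    show ?thesis
    proof (cases "is_Plus ?e")
      case True
      then have "Plus (lab ?c (i - 1)) = turn C j z" using i(2) by simp
      from \<delta>(2)[OF c i(1) this]
      obtain \<alpha> where "0 < \<alpha>" "velocity h d ?c \<theta> = \<delta> * (- (\<i> ^ j) * of_real \<alpha>)" using has_velocity by blast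
      then show ?thesis using True by (intro exI[of _ \<alpha>]) (simp add: outward_def)
    next
      case False
      then have "turn C 2 (Plus (lab ?c (i - 1))) = ?e" using i(2) turn2_lab[OF c, of "i - 1"] by simp
      then have "turn C 2 ?e = Plus (lab ?c (i - 1))"
        using turn_turn[OF lab_SL(1)[OF c], of 2 2 "i - 1"] lab_SL(1)[OF c] by simp
      then have "Plus (lab ?c (i - 1)) = turn C (2 + j) z" using turn_turn[OF z] by simp
      from \<delta>(2)[OF c i(1) this]
      obtain \<alpha> where "0 < \<alpha>" "velocity h d ?c \<theta> = \<delta> * (- (\<i> ^ (2 + j)) * of_real \<alpha>)" using has_velocity by blast
      then show ?thesis using False by (intro exI[of _ \<alpha>]) (simp add: outward_def power_add)
    qed
  qed
  then show ?thesis using \<delta>(1) by blast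
qed

lemma cyclic_order:
  assumes "x \<in> SL" "at_end \<mu> n C b d x \<theta>" "at_end \<mu> n C b d (turn C 1 x) \<theta>'"
    "conf_chart V h" "pt x 1 \<in> V"
  shows "det2 (outward h d x \<theta>) (outward h d (turn C 1 x) \<theta>') > 0"
proof -
  obtain \<delta> where \<delta>: "\<delta> \<noteq> 0" "\<And>j \<theta>. at_end \<mu> n C b d (turn C j x) \<theta> \<Longrightarrow>
    (\<exists>\<alpha>>0. outward h d (turn C j x) \<theta> = \<delta> * (\<i> ^ j * of_real \<alpha>))"
    using outward_direction[OF assms(1,4,5)] by blast
  obtain \<alpha> where \<alpha>: "0 < \<alpha>" "outward h d x \<theta> = \<delta> * (\<i> ^ 0 * of_real \<alpha>)"
    using \<delta>(2)[of 0 \<theta>] assms(1,2) by auto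
  obtain \<beta> where \<beta>: "0 < \<beta>" "outward h d (turn C 1 x) \<theta>' = \<delta> * (\<i> ^ 1 * of_real \<beta>)"
    using \<delta>(2)[of 1 \<theta>'] assms(3) by blast
  have "det2 (\<i> ^ 0 * of_real \<alpha>) (\<i> ^ 1 * of_real \<beta>) = \<alpha> * \<beta>" by (simp add: det2_def)
  then show ?thesis unfolding \<alpha>(2) \<beta>(2) det2_mult using \<delta>(1) \<alpha>(1) \<beta>(1) by simp
qed

text \<open>The only other point over the same crossing is \<open>(c', cis \<theta>')\<close>, and by \<open>pair_velocity\<close> the sign of
  the frame is the same in all charts and for all parameters of these points.\<close>

lemma over_strand_iff:
  assumes D: "imm D = d" "atlas D = A" and c: "c \<in> {1..\<mu>}" "c' \<in> {1..\<mu>}"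
    and ne: "(c, cis \<theta>) \<noteq> (c', cis \<theta>')"
    and pre: "{p \<in> topspace (circles \<mu>). d p = q} = {(c, cis \<theta>), (c', cis \<theta>')}"
  shows "over_strand \<mu> D (c, cis \<theta>) \<longleftrightarrow>
    of_int (csign D q) * ori (arrive c (cis \<theta>)) (arrive c' (cis \<theta>')) > 0"
proof -
  have "(c, cis \<theta>) \<in> {p \<in> topspace (circles \<mu>). d p = q}" "(c', cis \<theta>') \<in> {p \<in> topspace (circles \<mu>). d p = q}"
    unfolding pre by simp_all
  then have q: "d (c, cis \<theta>) = q" "d (c', cis \<theta>') = q" by simp_all
  let ?o = "ori (arrive c (cis \<theta>)) (arrive c' (cis \<theta>'))"
  have det: "of_int (csign D q) * det2 (velocity \<phi> d c \<phi>1) (velocity \<phi> d c'' \<phi>2) > 0 \<longleftrightarrow> of_int (csign D q) * ?o > 0"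
    if r: "c'' \<in> {1..\<mu>}" "(c, cis \<theta>) = (c, cis \<phi>1)" "(c'', cis \<phi>2) \<noteq> (c, cis \<theta>)" "d (c'', cis \<phi>2) = q"
      "(U, \<phi>) \<in> A" "q \<in> U" for c'' \<phi>1 \<phi>2 U \<phi>
  proof -
    have "(c'', cis \<phi>2) \<in> {p \<in> topspace (circles \<mu>). d p = q}" using r(1,4) by (simp add: circles_points)
    then have e: "c'' = c'" "cis \<phi>2 = cis \<theta>'" using pre r(3) by auto
    have e1: "cis \<phi>1 = cis \<theta>" using r(2) by simp
    have "conf_chart U \<phi>" by (rule smoothing_conf_chart[OF smoothing r(5)])
    then obtain \<kappa> where "0 < \<kappa>" "det2 (velocity \<phi> d c \<phi>1) (velocity \<phi> d c'' \<phi>2) = \<kappa> * ?o"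
      using pair_velocity[of c c' \<phi>1 \<phi>2 U \<phi>] c q ne r(6) unfolding e e1 by auto
    then show ?thesis by (simp add: zero_less_mult_iff mult.left_commute)
  qed
  have qX: "q \<in> topspace X" using d_in_X[OF c(1)] q(1) by blast
  obtain U \<phi> where U: "(U, \<phi>) \<in> A" "q \<in> U" using smoothing_cover[OF smoothing qX] .
  show ?thesis
  proof
    assume "over_strand \<mu> D (c, cis \<theta>)"
    then have "of_int (csign D q) * det2 (velocity \<phi> d c \<theta>) (velocity \<phi> d c' \<theta>') > 0"
    proof -
      assume o: "over_strand \<mu> D (c, cis \<theta>)"
      have "\<forall>(U, \<phi>)\<in>A. d (c, cis \<theta>) \<in> U \<longrightarrow>
          0 < of_int (csign D (d (c, cis \<theta>))) * det2 (velocity \<phi> d c \<theta>) (velocity \<phi> d c' \<theta>')"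
        by (rule o[unfolded over_strand_def D, THEN bspec, OF c(1), THEN bspec, OF c(2),
            THEN spec[of _ \<theta>], THEN spec[of _ \<theta>'], THEN mp, OF refl, THEN mp, THEN mp])
          (use ne q in auto)
      from bspec[OF this U(1)] show ?thesis using U(2) q(1) by simp
    qed
    then show "of_int (csign D q) * ?o > 0" using det[OF c(2) refl _ q(2) U] ne by auto
  next
    assume o: "of_int (csign D q) * ?o > 0"
    show "over_strand \<mu> D (c, cis \<theta>)"
      unfolding over_strand_def D
    proof (intro ballI allI impI)
      fix c1 c2 \<phi>1 \<phi>2 \<kappa>
      assume r: "c1 \<in> {1..\<mu>}" "c2 \<in> {1..\<mu>}" "(c, cis \<theta>) = (c1, cis \<phi>1)" "(c2, cis \<phi>2) \<noteq> (c, cis \<theta>)"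
        "d (c2, cis \<phi>2) = d (c, cis \<theta>)" "\<kappa> \<in> A"
      obtain U \<phi> where \<kappa>: "\<kappa> = (U, \<phi>)" by (cases \<kappa>)
      show "case \<kappa> of (U, \<phi>) \<Rightarrow> d (c, cis \<theta>) \<in> U \<longrightarrow>
          0 < of_int (csign D (d (c, cis \<theta>))) * det2 (velocity \<phi> d c1 \<phi>1) (velocity \<phi> d c2 \<phi>2)"
        unfolding \<kappa> prod.case q(1)
      proof
        assume "q \<in> U"
        then show "0 < of_int (csign D q) * det2 (velocity \<phi> d c1 \<phi>1) (velocity \<phi> d c2 \<phi>2)"
          using det[of c2 \<phi>1 \<phi>2 U \<phi>] r \<kappa> q(1) o by simp
      qed
    qed
  qed
qed

text \<open>Exchanging the two strands reverses the frame, so for either crossing sign exactly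
  one of them satisfies the condition.\<close>

lemma over_strand_unique:
  assumes D: "imm D = d" "atlas D = A" and x: "x \<in> SL" and sign: "csign D (pt x 1) \<in> {1, -1}"
  shows "\<exists>!p. p \<in> topspace (circles \<mu>) \<and> imm D p = pt x 1 \<and> over_strand \<mu> D p"
proof -
  let ?q = "pt x 1"
  obtain c \<theta> c' \<theta>' where p: "c \<in> {1..\<mu>}" "c' \<in> {1..\<mu>}" "(c, cis \<theta>) \<noteq> (c', cis \<theta>')"
    "{p \<in> topspace (circles \<mu>). d p = ?q} = {(c, cis \<theta>), (c', cis \<theta>')}"
    using vertex_preimage[OF x] .
  have "(c, cis \<theta>) \<in> {p \<in> topspace (circles \<mu>). d p = ?q}" "(c', cis \<theta>') \<in> {p \<in> topspace (circles \<mu>). d p = ?q}"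
    unfolding p(4) by simp_all
  then have q: "d (c, cis \<theta>) = ?q" "d (c', cis \<theta>') = ?q" by simp_all
  let ?P = "(c, cis \<theta>)" and ?P' = "(c', cis \<theta>')"
  let ?x = "arrive c (cis \<theta>)" and ?y = "arrive c' (cis \<theta>')"
  obtain i i' where i: "G c \<theta> = of_int i" "G c' \<theta>' = of_int i'" "?x \<noteq> ?y" "vertex_of C ?x = vertex_of C ?y"
    by (rule double_point[OF p(1,2) _ p(3)]) (use q that in auto)
  have anti: "ori ?y ?x = - ori ?x ?y"
    by (rule ori_antisym) (use arrive_point[OF p(1) i(1)] arrive_point[OF p(2) i(2)] i(3,4) in auto)
  have o: "over_strand \<mu> D ?P \<longleftrightarrow> of_int (csign D ?q) * ori ?x ?y > 0"
    by (rule over_strand_iff[OF D p])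
  have "{p \<in> topspace (circles \<mu>). d p = ?q} = {?P', ?P}" unfolding p(4) by (rule insert_commute)
  from over_strand_iff[OF D p(2,1) p(3)[symmetric] this]
  have o': "over_strand \<mu> D ?P' \<longleftrightarrow> of_int (csign D ?q) * ori ?y ?x > 0" .
  have one: "over_strand \<mu> D ?P' \<longleftrightarrow> \<not> over_strand \<mu> D ?P"
    unfolding o o' anti using sign by (auto simp: ori_def split: if_splits)
  have mem: "p \<in> topspace (circles \<mu>) \<and> imm D p = ?q \<longleftrightarrow> p = ?P \<or> p = ?P'" for p
  proof -
    have "p \<in> topspace (circles \<mu>) \<and> imm D p = ?q \<longleftrightarrow> p \<in> {p \<in> topspace (circles \<mu>). d p = ?q}"
      unfolding D(1) by simp
    then show ?thesis unfolding p(4) by simp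
  qed
  show ?thesis
  proof (cases "over_strand \<mu> D ?P")
    case True
    show ?thesis
    proof (rule ex1I[of _ ?P])
      show "?P \<in> topspace (circles \<mu>) \<and> imm D ?P = ?q \<and> over_strand \<mu> D ?P" using True mem[of ?P] by simp
      fix r assume r: "r \<in> topspace (circles \<mu>) \<and> imm D r = ?q \<and> over_strand \<mu> D r"
      then have "r = ?P \<or> r = ?P'" using mem[of r] by simp
      then show "r = ?P" using r one True by auto
    qed
  next
    case False
    show ?thesis
    proof (rule ex1I[of _ ?P'])
      show "?P' \<in> topspace (circles \<mu>) \<and> imm D ?P' = ?q \<and> over_strand \<mu> D ?P'"
        using False one mem[of ?P'] by simp
      fix r assume r: "r \<in> topspace (circles \<mu>) \<and> imm D r = ?q \<and> over_strand \<mu> D r"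
      then have "r = ?P \<or> r = ?P'" using mem[of r] by simp
      then show "r = ?P'" using r False by auto
    qed
  qed
qed

end

section \<open>A smooth traversal\<close>

text \<open>The path \<open>path c\<close> stops being smooth in the coordinates at the integers, where it behaves
  like a square root.  Slowing down quadratically at the integers by \<open>warp\<close> compensates for this: in the
  vertex coordinate, the warped path is a sine (\<open>warp_near_int\<close>).\<close>

definition warp :: "real \<Rightarrow> real" where
  "warp \<sigma> = of_int \<lfloor>\<sigma>\<rfloor> + (sin (pi * frac \<sigma> / 2))\<^sup>2"

lemma sin_half_pi_bounds:
  assumes "0 < u" "u < 1"
  shows "0 < sin (pi * u / 2)" "sin (pi * u / 2) < 1" "0 < cos (pi * u / 2)"
proof -
  have u: "0 < pi * u / 2" "pi * u / 2 < pi / 2" using assms pi_gt_zero by (simp_all add: field_simps)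
  show "0 < sin (pi * u / 2)" by (rule sin_gt_zero) (use u pi_gt_zero in linarith)+
  show c: "0 < cos (pi * u / 2)" by (rule cos_gt_zero) (use u in auto)
  show "sin (pi * u / 2) < 1"
    using sin_monotone_2pi[of "pi * u / 2" "pi / 2"] u pi_gt_zero by simp
qed

lemma sin_half_pi_square:
  assumes "0 \<le> u" "u < 1"
  shows "0 \<le> (sin (pi * u / 2))\<^sup>2" "(sin (pi * u / 2))\<^sup>2 < 1"
proof -
  show "(sin (pi * u / 2))\<^sup>2 < 1"
  proof (cases "u = 0")
    case False
    then show ?thesis using sin_half_pi_bounds[of u] assms by (simp add: power_less_one_iff)
  qed simp
qed simp

lemma floor_warp: "\<lfloor>warp \<sigma>\<rfloor> = \<lfloor>\<sigma>\<rfloor>"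
  using sin_half_pi_square[OF frac_ge_0 frac_lt_1, of \<sigma>] unfolding warp_def by linarith

lemma warp_int [simp]: "warp (of_int i) = of_int i"
  by (simp add: warp_def)

lemma warp_shift: "warp (\<sigma> + of_int j) = warp \<sigma> + of_int j"
proof -
  have "\<lfloor>\<sigma> + of_int j\<rfloor> = \<lfloor>\<sigma>\<rfloor> + j" by linarith
  then show ?thesis by (simp add: warp_def frac_def)
qed

lemma warp_eq:
  assumes "of_int i \<le> \<sigma>" "\<sigma> < of_int i + 1"
  shows "warp \<sigma> = of_int i + (sin (pi * (\<sigma> - of_int i) / 2))\<^sup>2"
proof -
  have "\<lfloor>\<sigma>\<rfloor> = i" using assms by linarith
  then show ?thesis by (simp add: warp_def frac_def)
qed

lemma warp_integer_iff: "warp \<sigma> = of_int \<lfloor>warp \<sigma>\<rfloor> \<longleftrightarrow> \<sigma> = of_int \<lfloor>\<sigma>\<rfloor>"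
proof
  assume a: "warp \<sigma> = of_int \<lfloor>warp \<sigma>\<rfloor>"
  show "\<sigma> = of_int \<lfloor>\<sigma>\<rfloor>"
  proof (rule ccontr)
    assume "\<sigma> \<noteq> of_int \<lfloor>\<sigma>\<rfloor>"
    then have "of_int \<lfloor>\<sigma>\<rfloor> < \<sigma>" using of_int_floor_le[of \<sigma>] by linarith
    then have "0 < frac \<sigma>" by (simp add: frac_def)
    then have "0 < sin (pi * frac \<sigma> / 2)" using sin_half_pi_bounds(1) frac_lt_1 by blast
    moreover have "warp \<sigma> = of_int \<lfloor>\<sigma>\<rfloor>" using a unfolding floor_warp .
    ultimately show False unfolding warp_def by simp
  qed
next
  assume "\<sigma> = of_int \<lfloor>\<sigma>\<rfloor>"
  then show "warp \<sigma> = of_int \<lfloor>warp \<sigma>\<rfloor>" by (metis floor_of_int warp_int)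
qed

lemma warp_near_int:
  assumes "\<bar>\<sigma> - of_int i\<bar> < 1"
  shows "sqrt (of_int i - warp \<sigma>) = - sin (pi * (\<sigma> - of_int i) / 2)"
    and "\<bar>warp \<sigma> - of_int i\<bar> = (sin (pi * (\<sigma> - of_int i) / 2))\<^sup>2"
proof -
  let ?u = "\<sigma> - of_int i"
  have "sqrt (of_int i - warp \<sigma>) = - sin (pi * ?u / 2) \<and> \<bar>warp \<sigma> - of_int i\<bar> = (sin (pi * ?u / 2))\<^sup>2"
  proof (cases "0 \<le> ?u")
    case True
    then have w: "warp \<sigma> = of_int i + (sin (pi * ?u / 2))\<^sup>2" using assms by (intro warp_eq) auto
    have "0 \<le> sin (pi * ?u / 2)"
    proof (cases "?u = 0")
      case False
      then show ?thesis using sin_half_pi_bounds(1)[of ?u] True assms by simp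
    qed simp
    then show ?thesis using w by (simp add: real_sqrt_minus)
  next
    case False
    then have "warp \<sigma> = of_int (i - 1) + (sin (pi * (\<sigma> - of_int (i - 1)) / 2))\<^sup>2"
      using assms by (intro warp_eq) auto
    also have "pi * (\<sigma> - of_int (i - 1)) / 2 = pi * ?u / 2 + pi / 2" by (simp add: field_simps)
    also have "(sin (pi * ?u / 2 + pi / 2))\<^sup>2 = 1 - (sin (pi * ?u / 2))\<^sup>2"
      by (simp add: sin_add cos_squared_eq)
    finally have w: "of_int i - warp \<sigma> = (sin (pi * ?u / 2))\<^sup>2" by simp
    have "0 < sin (pi * (- ?u) / 2)" by (rule sin_half_pi_bounds(1)) (use False assms in auto)
    moreover have "pi * (- ?u) / 2 = - (pi * ?u / 2)" by (simp only: mult_minus_right minus_divide_left)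
    ultimately have "sin (pi * ?u / 2) < 0" by (simp only: sin_minus)
    then have "sqrt ((sin (pi * ?u / 2))\<^sup>2) = - sin (pi * ?u / 2)" by simp
    moreover have "\<bar>warp \<sigma> - of_int i\<bar> = \<bar>of_int i - warp \<sigma>\<bar>" by (rule abs_minus_commute)
    ultimately show ?thesis unfolding w by simp
  qed
  then show "sqrt (of_int i - warp \<sigma>) = - sin (pi * ?u / 2)" "\<bar>warp \<sigma> - of_int i\<bar> = (sin (pi * ?u / 2))\<^sup>2"
    by simp_all
qed

text \<open>In the local coordinate the warped path is the restriction to the reals of an entire function \<open>F\<close>,
  with nonzero derivative near the point.\<close>

lemma warp_coord:
  fixes r :: real
  assumes "0 < r"
  shows "\<exists>S. open S \<and> t0 \<in> S \<and> (\<forall>t\<in>S. warp (r * t) \<in> loc_int (warp (r * t0))) \<and>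
    regular_curve (\<lambda>t. of_real (loc_coord (warp (r * t0)) (warp (r * t)))) S"
proof -
  have lin: "((\<lambda>t. complex_of_real (r * t)) has_vector_derivative of_real r) (at t)" for t
    by (rule bounded_linear.has_vector_derivative[OF bounded_linear_of_real])
      (auto intro!: derivative_eq_intros simp: has_real_derivative_iff_has_vector_derivative[symmetric])
  have lin_smooth: "Ck_on k (\<lambda>t. complex_of_real (r * t)) S" if "open S" for k S
  proof -
    have "Ck_on k (\<lambda>t::real. t) S" for k
    proof (cases k)
      case (Suc k)
      show ?thesis unfolding Suc
        by (rule Ck_on_SucI[OF that, where D="\<lambda>_ v. v"]) (auto intro: Ck_on_const[OF that])
    qed simp
    moreover have "bounded_linear (\<lambda>t. complex_of_real (r * t))"
      using bounded_linear_compose[OF bounded_linear_of_real bounded_linear_mult_right[of r]] .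
    ultimately show ?thesis using Ck_on_bounded_linear[OF _ that] by blast
  qed
  have reg: "regular_curve (\<lambda>t. F (complex_of_real (r * t))) S"
    if "open S" "F holomorphic_on UNIV" "\<And>t. t \<in> S \<Longrightarrow> (F has_field_derivative F' t) (at (of_real (r * t)))"
      "\<And>t. t \<in> S \<Longrightarrow> F' t \<noteq> 0" for F F' and S :: "real set"
    unfolding regular_curve_def
  proof (intro conjI ballI)
    show "smooth_on (\<lambda>t. F (complex_of_real (r * t))) S"
      unfolding smooth_on_def
      using Ck_on_holomorphic_compose[OF open_UNIV that(1,2) lin_smooth[OF that(1)]] by simp
    fix t assume t: "t \<in> S"
    have "((F \<circ> (\<lambda>t. complex_of_real (r * t))) has_vector_derivative of_real r * F' t) (at t)"
      by (rule field_vector_diff_chain_at[OF lin that(3)[OF t]])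
    then have "vector_derivative (\<lambda>t. F (complex_of_real (r * t))) (at t) = of_real r * F' t"
      by (intro vector_derivative_at) (simp add: o_def)
    then show "vector_derivative (\<lambda>t. F (complex_of_real (r * t))) (at t) \<noteq> 0"
      using assms that(4)[OF t] by simp
  qed
  define i where "i = \<lfloor>r * t0\<rfloor>"
  show ?thesis
  proof (cases "r * t0 = of_int i")
    case True
    have w: "warp (r * t0) = of_int i" unfolding True by simp
    define S where "S = {t. \<bar>r * t - of_int i\<bar> < 1 \<and> (sin (pi * (r * t - of_int i) / 2))\<^sup>2 < 1/4}"
    have op: "open S" unfolding S_def by (intro open_Collect_conj open_Collect_less continuous_intros) auto
    let ?F = "\<lambda>u. - sin (of_real pi * (u - of_int i) / 2) :: complex"
    let ?F' = "\<lambda>t. - (cos (of_real pi * (of_real (r * t) - of_int i) / 2) * (of_real pi / 2)) :: complex"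
    have "regular_curve (\<lambda>t. ?F (complex_of_real (r * t))) S"
    proof (rule reg[OF op, where F'="?F'"])
      show "?F holomorphic_on UNIV" by (intro holomorphic_intros) auto
      show "(?F has_field_derivative ?F' t) (at (of_real (r * t)))" for t
        by (auto intro!: derivative_eq_intros)
      fix t assume t: "t \<in> S"
      have u: "- 1 < r * t - of_int i" "r * t - of_int i < 1" using t by (auto simp: S_def)
      have "pi * (- 1) < pi * (r * t - of_int i)" "pi * (r * t - of_int i) < pi * 1"
        by (rule mult_strict_left_mono[OF u(1) pi_gt_zero]) (rule mult_strict_left_mono[OF u(2) pi_gt_zero])
      then have "0 < cos (pi * (r * t - of_int i) / 2)"
        by (intro cos_gt_zero_pi) linarith+
      moreover have "cos (of_real pi * (of_real (r * t) - of_int i) / 2) =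
          complex_of_real (cos (pi * (r * t - of_int i) / 2))"
        by (simp add: cos_of_real[symmetric])
      ultimately show "?F' t \<noteq> 0" by simp
    qed
    then have "regular_curve (\<lambda>t. of_real (loc_coord (warp (r * t0)) (warp (r * t)))) S"
    proof (rule regular_curve_cong[OF op, rotated])
      fix t assume t: "t \<in> S"
      have "loc_coord (warp (r * t0)) (warp (r * t)) = - sin (pi * (r * t - of_int i) / 2)"
        unfolding w loc_coord_def using warp_near_int(1)[of "r * t" i] t by (simp add: S_def)
      then show "?F (complex_of_real (r * t)) = of_real (loc_coord (warp (r * t0)) (warp (r * t)))"
        by (simp add: sin_of_real[symmetric])
    qed
    moreover have "\<forall>t\<in>S. warp (r * t) \<in> loc_int (warp (r * t0))"
      unfolding w
    proof
      fix t assume "t \<in> S"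
      then have "\<bar>warp (r * t) - of_int i\<bar> < 1/4" using warp_near_int(2)[of "r * t" i] by (simp add: S_def)
      then have "of_int i - 1/4 < warp (r * t)" "warp (r * t) < of_int i + 1/4" by linarith+
      then show "warp (r * t) \<in> loc_int (of_int i)" by (simp add: loc_int_def)
    qed
    moreover have "t0 \<in> S" by (simp add: S_def True)
    ultimately show ?thesis using op by blast
  next
    case False
    define S where "S = {t. of_int i < r * t \<and> r * t < of_int i + 1}"
    have op: "open S" unfolding S_def by (intro open_Collect_conj open_Collect_less continuous_intros)
    have fl: "\<lfloor>warp (r * t0)\<rfloor> = i" unfolding floor_warp i_def ..
    have nw: "warp (r * t0) \<noteq> of_int \<lfloor>warp (r * t0)\<rfloor>" unfolding warp_integer_iff using False by (simp add: i_def)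
    have weq: "warp (r * t) = of_int i + (sin (pi * (r * t - of_int i) / 2))\<^sup>2" if "t \<in> S" for t
      by (rule warp_eq) (use that in \<open>auto simp: S_def\<close>)
    have u: "0 < r * t - of_int i" "r * t - of_int i < 1" if "t \<in> S" for t
      using that by (auto simp: S_def)
    let ?F = "\<lambda>u. (sin (of_real pi * (u - of_int i) / 2))\<^sup>2 :: complex"
    let ?F' = "\<lambda>t. 2 * sin (of_real pi * (of_real (r * t) - of_int i) / 2) *
        (cos (of_real pi * (of_real (r * t) - of_int i) / 2) * (of_real pi / 2)) :: complex"
    have "regular_curve (\<lambda>t. ?F (complex_of_real (r * t))) S"
    proof (rule reg[OF op, where F'="?F'"])
      show "?F holomorphic_on UNIV" by (intro holomorphic_intros) auto
      show "(?F has_field_derivative ?F' t) (at (of_real (r * t)))" for t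
        by (auto intro!: derivative_eq_intros)
      fix t assume t: "t \<in> S"
      have "cos (of_real pi * (of_real (r * t) - of_int i) / 2) =
          complex_of_real (cos (pi * (r * t - of_int i) / 2))"
        "sin (of_real pi * (of_real (r * t) - of_int i) / 2) =
          complex_of_real (sin (pi * (r * t - of_int i) / 2))"
        by (simp_all add: cos_of_real[symmetric] sin_of_real[symmetric])
      then show "?F' t \<noteq> 0" using sin_half_pi_bounds[OF u[OF t]] by simp
    qed
    then have "regular_curve (\<lambda>t. of_real (loc_coord (warp (r * t0)) (warp (r * t)))) S"
    proof (rule regular_curve_cong[OF op, rotated])
      fix t assume t: "t \<in> S"
      have "loc_coord (warp (r * t0)) (warp (r * t)) = (sin (pi * (r * t - of_int i) / 2))\<^sup>2"
        using nw unfolding loc_coord_def fl weq[OF t] by simp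
      then show "?F (complex_of_real (r * t)) = of_real (loc_coord (warp (r * t0)) (warp (r * t)))"
        by (simp add: sin_of_real[symmetric])
    qed
    moreover have "\<forall>t\<in>S. warp (r * t) \<in> loc_int (warp (r * t0))"
    proof
      fix t assume t: "t \<in> S"
      have "0 < sin (pi * (r * t - of_int i) / 2)" using sin_half_pi_bounds(1)[OF u[OF t]] .
      then have "of_int i < warp (r * t)" unfolding weq[OF t] by simp
      moreover have "warp (r * t) < of_int i + 1"
        using sin_half_pi_square(2)[of "r * t - of_int i"] u[OF t] unfolding weq[OF t] by simp
      ultimately show "warp (r * t) \<in> loc_int (warp (r * t0))"
        using nw unfolding loc_int_def fl by simp
    qed
    moreover have "t0 \<in> S"
    proof -
      have "of_int i \<le> r * t0" "r * t0 < of_int i + 1" unfolding i_def by linarith+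
      then show ?thesis using False by (simp add: S_def)
    qed
    ultimately show ?thesis using op by blast
  qed
qed

context pdb
begin

definition circ :: "nat \<times> complex \<Rightarrow> point" where
  "circ p = path (fst p) (warp (real (n (fst p)) / (2 * pi) * Arg (snd p)))"

lemma circ_cis: "circ (c, cis t) = path c (warp (real (n c) / (2 * pi) * t))"
proof -
  have "cis (Arg (cis t)) = cis t" by (simp add: cis_Arg)
  then obtain j where j: "Arg (cis t) = t + 2 * pi * of_int j" unfolding cis_eq_iff by blast
  have "real (n c) / (2 * pi) * Arg (cis t) = real (n c) / (2 * pi) * t + of_int (j * int (n c))"
    unfolding j by (simp add: field_simps)
  then have "circ (c, cis t) = path c (warp (real (n c) / (2 * pi) * t) + of_int (j * int (n c)))"
    unfolding circ_def fst_conv snd_conv by (simp only: warp_shift)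
  then show ?thesis using path_period[of c _ j] by simp
qed

lemma circ_local:
  assumes c: "c \<in> {1..\<mu>}"
  obtains S W P a where "open S" "t0 \<in> S" "conf_par W P" "regular_curve (\<lambda>t. of_real (a t)) S"
    "\<forall>t\<in>S. of_real (a t) \<in> W \<and> circ (c, cis t) = P (of_real (a t))"
proof -
  define r where "r = real (n c) / (2 * pi)"
  have r: "0 < r" using n_pos[OF c] by (simp add: r_def)
  obtain S where S: "open S" "t0 \<in> S" "\<forall>t\<in>S. warp (r * t) \<in> loc_int (warp (r * t0))"
    "regular_curve (\<lambda>t. of_real (loc_coord (warp (r * t0)) (warp (r * t)))) S"
    using warp_coord[OF r] by blast
  obtain W P where "conf_par W P \<and> (\<forall>s\<in>loc_int (warp (r * t0)). of_real (loc_coord (warp (r * t0)) s) \<in> W \<and>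
      path c s = P (of_real (loc_coord (warp (r * t0)) s)))"
    using path_par[OF c, of "warp (r * t0)"] by (elim exE)
  then show thesis
    using that[OF S(1,2) _ S(4), of W P] S(3) by (simp add: circ_cis r_def)
qed

lemma regular_curve_continuous:
  assumes "open S" "regular_curve \<gamma> S"
  shows "continuous_on S \<gamma>"
  using smooth_onD[of \<gamma> S 0] assms by (simp add: regular_curve_def)

lemma open_circ:
  assumes c: "c \<in> {1..\<mu>}" and V: "openin X V"
  shows "open {t. circ (c, cis t) \<in> V}"
proof (subst open_subopen, intro ballI)
  fix t0 assume t0: "t0 \<in> {t. circ (c, cis t) \<in> V}"
  obtain S W P a where S: "open S" "t0 \<in> S" "conf_par W P" "regular_curve (\<lambda>t. of_real (a t)) S"
    "\<forall>t\<in>S. of_real (a t) \<in> W \<and> circ (c, cis t) = P (of_real (a t))"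
    using circ_local[OF c, of t0] .
  have "open {w \<in> W. P w \<in> V}" using S(3) V by (simp add: conf_par_def)
  then have "open (S \<inter> (\<lambda>t. of_real (a t)) -` {w \<in> W. P w \<in> V})"
    by (rule continuous_open_preimage[OF regular_curve_continuous[OF S(1,4)] S(1)])
  moreover have "t0 \<in> S \<inter> (\<lambda>t. of_real (a t)) -` {w \<in> W. P w \<in> V}" using S(2,5) t0 by auto
  moreover have "S \<inter> (\<lambda>t. of_real (a t)) -` {w \<in> W. P w \<in> V} \<subseteq> {t. circ (c, cis t) \<in> V}" using S(5) by auto
  ultimately show "\<exists>T. open T \<and> t0 \<in> T \<and> T \<subseteq> {t. circ (c, cis t) \<in> V}" by blast
qed

lemma circ_in_X: "c \<in> {1..\<mu>} \<Longrightarrow> circ (c, cis t) \<in> topspace X"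
proof -
  assume c: "c \<in> {1..\<mu>}"
  obtain S W P a where "open S" "t \<in> S" "conf_par W P" "regular_curve (\<lambda>t. of_real (a t)) S"
    "\<forall>t\<in>S. of_real (a t) \<in> W \<and> circ (c, cis t) = P (of_real (a t))"
    using circ_local[OF c, of t] .
  then show ?thesis by (auto simp: conf_par_def)
qed

lemma regular_circ:
  assumes c: "c \<in> {1..\<mu>}" and h: "conf_chart V h"
  shows "regular_curve (\<lambda>t. h (circ (c, cis t))) {t. circ (c, cis t) \<in> V}"
proof (rule regular_curve_local)
  fix t0 assume t0: "t0 \<in> {t. circ (c, cis t) \<in> V}"
  obtain S W P a where S: "open S" "t0 \<in> S" "conf_par W P" "regular_curve (\<lambda>t. of_real (a t)) S"
    "\<forall>t\<in>S. of_real (a t) \<in> W \<and> circ (c, cis t) = P (of_real (a t))"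
    using circ_local[OF c, of t0] .
  let ?S = "S \<inter> {t. circ (c, cis t) \<in> V}"
  have op: "open ?S" using S(1) open_circ[OF c conf_chartD(1)[OF h]] by blast
  have inj: "inj_on P W" using S(3) by (simp add: conf_par_def)
  have "regular_curve (\<lambda>t. of_real (a t)) ?S"
    using S(4) unfolding regular_curve_def by (auto elim: smooth_on_subset)
  then have "regular_curve (\<lambda>t. inv_into W P (circ (c, cis t))) ?S"
    by (rule regular_curve_cong[OF op, rotated]) (use S(5) inv_into_f_f[OF inj] in auto)
  then have "regular_curve (\<lambda>t. h (circ (c, cis t))) ?S"
    by (rule conf_regular_curve[OF conf_par_chart(2)[OF S(3)] h op, rotated]) (use S(5) in auto)
  then show "\<exists>R. open R \<and> t0 \<in> R \<and> regular_curve (\<lambda>t. h (circ (c, cis t))) R"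
    using op t0 S(2) by blast
qed

lemma cis_image: "cis ` {0..2 * pi} = sphere 0 1"
proof
  show "sphere 0 1 \<subseteq> cis ` {0..2 * pi}"
  proof
    fix z :: complex assume "z \<in> sphere 0 1"
    then have "z = cis (Arg2pi z)" using Arg2pi_eq[of z] by (simp add: cis_conv_exp)
    moreover have "Arg2pi z \<in> {0..2 * pi}" using Arg2pi[of z] by simp
    ultimately show "z \<in> cis ` {0..2 * pi}" by blast
  qed
qed auto

text \<open>The circle is a quotient of a closed interval by \<open>cis\<close>, so continuity can be tested on the parameter.\<close>

lemma continuous_map_circ: "continuous_map (circles \<mu>) X circ"
  unfolding continuous_map_def
proof (intro conjI allI impI)
  show "circ \<in> topspace (circles \<mu>) \<rightarrow> topspace X"
  proof
    fix p assume "p \<in> topspace (circles \<mu>)"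
    then have p: "fst p \<in> {1..\<mu>}" "norm (snd p) = 1" by (auto simp: circles_points)
    then have "snd p \<noteq> 0" by auto
    then have "snd p = cis (Arg (snd p))" using p(2) by (simp add: cis_Arg sgn_div_norm)
    then have "p = (fst p, cis (Arg (snd p)))" by (simp add: prod_eq_iff)
    then show "circ p \<in> topspace X" using circ_in_X[OF p(1)] by metis
  qed
  fix V assume V: "openin X V"
  show "openin (circles \<mu>) {p \<in> topspace (circles \<mu>). circ p \<in> V}"
    unfolding circles_def openin_sum_topology
  proof (intro conjI ballI)
    fix c assume c: "c \<in> {1..\<mu>}"
    let ?U = "{z \<in> sphere 0 1. circ (c, z) \<in> V}"
    have "{0..2 * pi} \<inter> cis -` ?U = {0..2 * pi} \<inter> {t. circ (c, cis t) \<in> V}" by auto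
    then have op: "openin (top_of_set {0..2 * pi}) ({0..2 * pi} \<inter> cis -` ?U)"
      using open_circ[OF c V] by (simp add: openin_open_Int)
    have iff: "openin (top_of_set {0..2 * pi}) ({0..2 * pi} \<inter> cis -` ?U) \<longleftrightarrow>
        openin (top_of_set (sphere 0 1)) ?U"
      by (rule Abstract_Topology_2.continuous_imp_quotient_map)
        (use cis_image in \<open>auto intro!: continuous_intros\<close>)
    have "openin (top_of_set (sphere 0 1)) ?U" by (rule iffD1[OF iff op])
    moreover have "{z. (c, z) \<in> {p \<in> topspace (sum_topology (\<lambda>c. top_of_set (sphere 0 1)) {1..\<mu>}). circ p \<in> V}} = ?U"
      using c by auto
    ultimately show "openin (top_of_set (sphere 0 1))
        {z. (c, z) \<in> {p \<in> topspace (sum_topology (\<lambda>c. top_of_set (sphere 0 1)) {1..\<mu>}). circ p \<in> V}}" by simp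
  qed auto
qed

lemma smooth_immersion_circ: "smooth_immersion X std_atlas \<mu> circ"
  unfolding smooth_immersion_def
proof (intro conjI ballI)
  fix c \<kappa> assume c: "c \<in> {1..\<mu>}" and "\<kappa> \<in> std_atlas"
  obtain U \<phi> where \<kappa>: "\<kappa> = (U, \<phi>)" by (cases \<kappa>)
  then have "conf_chart U \<phi>" using \<open>\<kappa> \<in> std_atlas\<close> by (auto elim: std_atlas_cases)
  from regular_circ[OF c this]
  show "case \<kappa> of (U, \<phi>) \<Rightarrow> smooth_on (\<lambda>t. \<phi> (circ (c, cis t))) {t. circ (c, cis t) \<in> U} \<and>
      (\<forall>t. circ (c, cis t) \<in> U \<longrightarrow> velocity \<phi> circ c t \<noteq> 0)"
    unfolding \<kappa> by (simp add: regular_curve_def velocity_def)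
qed (rule continuous_map_circ)

lemma traverses_circ: "traverses \<mu> n C b circ"
  unfolding traverses_def
proof (intro ballI)
  fix c assume c: "c \<in> {1..\<mu>}"
  define N where "N = n c"
  have N: "0 < N" using n_pos[OF c] by (simp add: N_def)
  have card: "card (orbit (next_edge C) (c, 1)) = N"
    unfolding orbit_next_edge[OF c] by (simp add: card_cartesian_product N_def)
  define r where "r = real N / (2 * pi)"
  have r: "0 < r" using N by (simp add: r_def)
  let ?\<theta> = "\<lambda>i. real i / r"
  have "\<exists>g. continuous_on {?\<theta> i..?\<theta> (i + 1)} g \<and> strict_mono_on {?\<theta> i..?\<theta> (i + 1)} g \<and>
      g (?\<theta> i) = 0 \<and> g (?\<theta> (i + 1)) = 1 \<and>
      (\<forall>t\<in>{?\<theta> i..?\<theta> (i + 1)}. circ (c, cis t) = edge_path \<mu> n C b ((next_edge C ^^ i) (c, 1)) (g t))"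
    if i: "i < N" for i
  proof (intro exI conjI ballI)
    let ?g = "\<lambda>t. (sin (pi * (r * t - real i) / 2))\<^sup>2"
    show "continuous_on {?\<theta> i..?\<theta> (i + 1)} ?g" by (intro continuous_intros) auto
    have u: "0 \<le> r * t - real i" "r * t - real i \<le> 1" if "t \<in> {?\<theta> i..?\<theta> (i + 1)}" for t
      using that r by (auto simp: field_simps)
    show "strict_mono_on {?\<theta> i..?\<theta> (i + 1)} ?g"
    proof (rule strict_mono_onI)
      fix s t assume st: "s \<in> {?\<theta> i..?\<theta> (i + 1)}" "t \<in> {?\<theta> i..?\<theta> (i + 1)}" "s < t"
      let ?a = "r * s - real i" and ?b = "r * t - real i"
      have ab: "0 \<le> ?a" "?a < ?b" "?b \<le> 1" using u st r by (auto simp: mult_strict_left_mono)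
      have h: "0 \<le> pi * ?a / 2" "pi * ?a / 2 < pi * ?b / 2" "pi * ?b / 2 \<le> pi / 2"
        using ab pi_gt_zero by (simp_all add: mult_left_mono)
      have "sin (pi * ?a / 2) < sin (pi * ?b / 2)"
        by (rule sin_monotone_2pi) (use h pi_gt_zero in linarith)+
      moreover have "0 \<le> sin (pi * ?a / 2)"
        by (rule sin_ge_zero) (use h pi_gt_zero in linarith)+
      ultimately show "?g s < ?g t" by (simp add: power_strict_mono)
    qed
    show "?g (?\<theta> i) = 0" "?g (?\<theta> (i + 1)) = 1" using r by simp_all
    fix t assume t: "t \<in> {?\<theta> i..?\<theta> (i + 1)}"
    have e: "(next_edge C ^^ i) (c, 1) = lab c (int i)"
      unfolding next_edge_funpow[OF c] lab_def by (simp add: zmod_int[symmetric])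
    have cc: "circ (c, cis t) = path c (warp (r * t))" unfolding circ_cis r_def N_def ..
    show "circ (c, cis t) = edge_path \<mu> n C b ((next_edge C ^^ i) (c, 1)) (?g t)"
    proof (cases "r * t - real i = 1")
      case True
      then have rt: "r * t = of_int (int i + 1)" by simp
      have "circ (c, cis t) = path c (of_int (int i + 1))" unfolding cc rt warp_int ..
      also have "\<dots> = pt (Plus (lab c (int i))) 1" using path_int(2)[OF c, of "int i + 1"] by simp
      finally show ?thesis unfolding e edge_path_eq using True by simp
    next
      case False
      then have u': "0 \<le> r * t - real i" "r * t - real i < 1" using u[OF t] by simp_all
      have w: "warp (r * t) = of_int (int i) + ?g t"
        using warp_eq[of "int i" "r * t"] u' by simp
      have "path c (of_int (int i) + ?g t) = pt (Plus (lab c (int i))) (of_real (?g t))"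
        using path_floor[of "int i" "of_int (int i) + ?g t" c] sin_half_pi_square[OF u'] by simp
      then show ?thesis unfolding e edge_path_eq cc w .
    qed
  qed
  moreover have "?\<theta> i < ?\<theta> (i + 1)" for i using r by (simp add: divide_strict_right_mono)
  moreover have "?\<theta> N = ?\<theta> 0 + 2 * pi" using N by (simp add: r_def)
  ultimately show "\<exists>\<theta> :: nat \<Rightarrow> real. \<theta> (card (orbit (next_edge C) (c, 1))) = \<theta> 0 + 2 * pi \<and>
      (\<forall>k<card (orbit (next_edge C) (c, 1)). \<theta> k < \<theta> (k + 1) \<and>
        (\<exists>g. continuous_on {\<theta> k..\<theta> (k + 1)} g \<and> strict_mono_on {\<theta> k..\<theta> (k + 1)} g \<and>
          g (\<theta> k) = 0 \<and> g (\<theta> (k + 1)) = 1 \<and>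
          (\<forall>t\<in>{\<theta> k..\<theta> (k + 1)}. circ (c, cis t) = edge_path \<mu> n C b ((next_edge C ^^ k) (c, 1)) (g t))))"
    unfolding card by (intro exI[of _ ?\<theta>]) blast
qed

lemma reconstruction_exists: "\<exists>D. reconstruction \<mu> n C b D"
proof
  define sg where "sg p = color (vertex_of C (SOME x. x \<in> SL \<and> pt x 1 = p))" for p
  have "sg (end_point \<mu> n C b x) = color (vertex_of C x)" if x: "x \<in> SL" for x
  proof -
    let ?y = "SOME y. y \<in> SL \<and> pt y 1 = pt x 1"
    have "?y \<in> SL \<and> pt ?y 1 = pt x 1" by (rule someI[of _ x]) (use x in simp)
    then have "vertex_of C ?y = vertex_of C x" using pt_corner_eq_iff x by blast
    then show ?thesis by (simp add: sg_def end_point_eq[OF x])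
  qed
  then show "reconstruction \<mu> n C b \<lparr>surf = X, atlas = std_atlas, imm = circ,
      edge = (\<lambda>l. edge_path \<mu> n C b l ` {0<..<1}), csign = sg\<rparr>"
    unfolding reconstruction_def
    using base smoothing_std_atlas smooth_immersion_circ traverses_circ by simp
qed

end

section \<open>Changing the base points of the polygons\<close>

locale rebased = B: pdb \<mu> n C b + B': pdb \<mu> n C b' for \<mu> n C b b'
begin

abbreviation "F \<equiv> face_succ C"

text \<open>The rotation of a polygon that moves the side numbering based at \<open>b\<close> to the one based at \<open>b'\<close>.
  The value 1 outside the polygons keeps \<open>rot\<close> injective on all pairs.\<close>

definition shift :: "slabel set \<Rightarrow> complex" where
  "shift Q = (if Q \<in> faces \<mu> n C then exp (- (2 * of_real pi * \<i> * of_nat (B'.k (b Q)) / of_nat (card Q))) else 1)"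

definition rot :: "slabel set \<times> complex \<Rightarrow> slabel set \<times> complex" where
  "rot p = (fst p, shift (fst p) * snd p)"

text \<open>The two numberings of the sides of a polygon increase together along the orbit, so they
  differ by a constant modulo the number of sides.\<close>

lemma k_shift:
  assumes x: "x \<in> signed_labels \<mu> n"
  shows "\<exists>j::int. of_nat (B'.k x) = (of_nat (B.k x) + of_nat (B'.k (b (orbit F x))) + of_int j * of_nat (card (orbit F x)) :: complex)"
proof -
  have k': "B'.k ((F ^^ i) y) mod card (orbit F y) = (B'.k y + i) mod card (orbit F y)"
    if y: "y \<in> signed_labels \<mu> n" for i y
  proof (induction i)
    case (Suc i)
    have orb: "(F ^^ i) y \<in> orbit F y" by (rule funpow_in_orbit[OF B.self_in_orbit[OF y]])
    then have SL: "(F ^^ i) y \<in> signed_labels \<mu> n" using B.orbit_subset_SL[OF y] by blast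
    have eq: "orbit F ((F ^^ i) y) = orbit F y" by (rule B.orbit_eq[OF y orb])
    have "B'.k ((F ^^ Suc i) y) mod card (orbit F y) = (B'.k ((F ^^ i) y) + 1) mod card (orbit F y)"
      using B'.k_f[OF SL] by (simp add: B'.m_def eq)
    also have "\<dots> = ((B'.k y + i) + 1) mod card (orbit F y)" using Suc by (metis mod_add_left_eq)
    finally show ?case by simp
  qed simp
  let ?a = "b (orbit F x)"
  have a: "?a \<in> orbit F x" by (rule B.b_in[OF x])
  have aSL: "?a \<in> signed_labels \<mu> n" using a B.orbit_subset_SL[OF x] by blast
  have aorb: "orbit F ?a = orbit F x" by (rule B.orbit_eq[OF x a])
  have "B'.k x mod card (orbit F x) = (B'.k ?a + B.k x) mod card (orbit F x)"
    using k'[OF aSL, of "B.k x"] unfolding B.funpow_k[OF x] aorb .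
  then have "int (B'.k x) mod int (card (orbit F x)) = int (B'.k ?a + B.k x) mod int (card (orbit F x))"
    by (metis zmod_int)
  then obtain j where "int (B'.k x) = int (B'.k ?a + B.k x) + j * int (card (orbit F x))"
    by (metis mod_eqE add.commute diff_add_cancel mult.commute)
  then have "(of_int (int (B'.k x)) :: complex) = of_int (int (B'.k ?a + B.k x) + j * int (card (orbit F x)))"
    by (simp only:)
  then show ?thesis by (intro exI[of _ j]) (simp add: algebra_simps)
qed

lemma rot_spt:
  assumes x: "x \<in> signed_labels \<mu> n"
  shows "rot (B.spt x u) = B'.spt x u"
proof -
  let ?M = "of_nat (card (orbit F x)) :: complex" and ?a = "of_nat (B'.k (b (orbit F x))) :: complex"
  have M: "?M \<noteq> 0" using B.m_pos[OF x] by (simp add: B.m_def)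
  obtain j :: int where j: "of_nat (B'.k x) = of_nat (B.k x) + ?a + of_int j * ?M"
    using k_shift[OF x] by blast
  have "shift (orbit F x) * B.pos x u =
      exp (- (2 * of_real pi * \<i> * ?a / ?M) + - (2 * of_real pi * \<i> * (of_nat (B.k x) + u) / ?M))"
    unfolding exp_add using B.face_in[OF x] by (simp add: shift_def B.pos_def B.m_def)
  also have "\<dots> = B'.pos x u"
    unfolding B'.pos_def B'.m_def exp_eq j
    using M by (intro exI[of _ j]) (simp add: field_simps)
  finally show ?thesis by (simp add: rot_def B.spt_def B'.spt_def)
qed

lemma norm_shift: "norm (shift Q) = 1"
  by (simp add: shift_def Re_divide_of_nat)

lemma rot_Rg: "(p, q) \<in> B.Rg \<Longrightarrow> (rot p, rot q) \<in> B'.Rg"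
proof -
  assume "(p, q) \<in> B.Rg"
  then obtain x u where x: "x \<in> signed_labels \<mu> n" "0 \<le> u" "u \<le> 1" "p = B.spt x (of_real u)"
    "q = B.spt (neg x) (of_real (1 - u))"
    by (auto simp: B.Rg_def)
  then show "(rot p, rot q) \<in> B'.Rg"
    using B'.RgI[OF x(1-3)] rot_spt[of x] rot_spt[of "neg x"] by simp
qed

lemma rot_glue: "(p, q) \<in> B.Rg\<^sup>* \<Longrightarrow> (rot p, rot q) \<in> B'.Rg\<^sup>*"
  by (induction rule: rtrancl_induct) (auto intro: rtrancl_into_rtrancl rot_Rg)

lemma inj_rot: "rot p = rot q \<Longrightarrow> p = q"
proof -
  have "shift Q \<noteq> 0" for Q using norm_shift[of Q] by auto
  then show "rot p = rot q \<Longrightarrow> p = q" by (auto simp: rot_def prod_eq_iff)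
qed

lemma rot_glue_inv:
  assumes "(rot p, r) \<in> B'.Rg\<^sup>*"
  shows "\<exists>q. r = rot q \<and> (p, q) \<in> B.Rg\<^sup>*"
  using assms
proof (induction rule: rtrancl_induct)
  case (step r s)
  then obtain q where q: "r = rot q" "(p, q) \<in> B.Rg\<^sup>*" by blast
  obtain x u where x: "x \<in> signed_labels \<mu> n" "0 \<le> u" "u \<le> 1" "r = B'.spt x (of_real u)"
    "s = B'.spt (neg x) (of_real (1 - u))"
    using step.hyps(2) by (auto simp: B'.Rg_def)
  have "q = B.spt x (of_real u)" using q(1) x(4) rot_spt[OF x(1)] inj_rot by metis
  then have "(q, B.spt (neg x) (of_real (1 - u))) \<in> B.Rg" using B.RgI[OF x(1-3)] by simp
  moreover have "s = rot (B.spt (neg x) (of_real (1 - u)))" using rot_spt[of "neg x"] x(1,5) by simp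
  ultimately show ?case using rtrancl_into_rtrancl[OF q(2)] by blast
qed blast

text \<open>Points of the glued surfaces are classes of glued points, so rotating all members
  of a class gives the corresponding class.\<close>

definition H :: "point \<Rightarrow> point" where
  "H = image rot"

lemma H_pr: "H (B.pr p) = B'.pr (rot p)"
  unfolding H_def proj_def B.glue_eq B'.glue_eq using rot_glue rot_glue_inv by blast

lemma H_pt: "x \<in> signed_labels \<mu> n \<Longrightarrow> H (B.pt x u) = B'.pt x u"
  by (simp add: B.pt_def B'.pt_def H_pr rot_spt)

lemma continuous_H: "continuous_map B.X B'.X H"
proof (rule continuous_compose_quotient_map[OF B.quotient_map_pr])
  have "continuous_map B.Y B'.Y rot"
    unfolding continuous_map_def
  proof (intro conjI allI impI)
    show "rot \<in> topspace B.Y \<rightarrow> topspace B'.Y"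
      by (auto simp: B.topspace_Y B'.topspace_Y rot_def norm_mult norm_shift)
    fix U assume U: "openin B'.Y U"
    show "openin B.Y {p \<in> topspace B.Y. rot p \<in> U}"
      unfolding B.openin_Y
    proof (intro conjI ballI)
      fix Q assume Q: "Q \<in> faces \<mu> n C"
      have "openin (top_of_set (cball 0 1)) {z. (Q, z) \<in> U}" using U Q unfolding B'.openin_Y by blast
      moreover have "continuous_map (top_of_set (cball 0 1)) (top_of_set (cball 0 1)) (\<lambda>z. shift Q * z)"
        by (auto simp: norm_mult norm_shift intro!: continuous_intros)
      ultimately have "openin (top_of_set (cball 0 1))
          {z \<in> topspace (top_of_set (cball 0 1)). shift Q * z \<in> {z. (Q, z) \<in> U}}"
        by (rule openin_continuous_map_preimage[rotated])
      then show "openin (top_of_set (cball 0 1)) {z. (Q, z) \<in> {p \<in> topspace B.Y. rot p \<in> U}}"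
        using Q by (simp add: B.topspace_Y rot_def)
    qed (auto simp: B.topspace_Y)
  qed
  then have "continuous_map B.Y B'.X (B'.pr \<circ> rot)"
    by (rule continuous_map_compose[OF _ B'.continuous_pr])
  then show "continuous_map B.Y B'.X (H \<circ> B.pr)" by (simp add: o_def H_pr)
qed

text \<open>Rotations are holomorphic, so pulling back by \<open>H\<close> preserves holomorphy inside the polygons.\<close>

lemma H_conf_chart:
  assumes "B'.conf_chart V h" "inj_on H (topspace B.X)"
  shows "B.conf_chart {p \<in> topspace B.X. H p \<in> V} (\<lambda>p. h (H p))"
proof -
  let ?U = "{p \<in> topspace B.X. H p \<in> V}"
  have V: "openin B'.X V" "continuous_map (subtopology B'.X V) euclidean h" "inj_on h V"
    "\<And>Q. Q \<in> faces \<mu> n C \<Longrightarrow> (\<lambda>z. h (B'.pr (Q, z))) holomorphic_on {z \<in> ball 0 1. B'.pr (Q, z) \<in> V}"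
    using assms(1) by (auto simp: B'.conf_chart_def B'.conf_fun_def)
  have "openin B.X ?U" by (rule openin_continuous_map_preimage[OF continuous_H V(1)])
  moreover have "continuous_map (subtopology B.X ?U) euclidean (\<lambda>p. h (H p))"
  proof -
    have "continuous_map (subtopology B.X ?U) (subtopology B'.X V) H"
      unfolding continuous_map_in_subtopology
    proof
      show "continuous_map (subtopology B.X ?U) B'.X H"
        by (rule continuous_map_from_subtopology[OF continuous_H])
      show "H \<in> topspace (subtopology B.X ?U) \<rightarrow> V" by simp
    qed
    from continuous_map_compose[OF this V(2)] show ?thesis by (simp add: o_def)
  qed
  moreover have "inj_on (\<lambda>p. h (H p)) ?U"
  proof (rule inj_onI)
    fix p q assume p: "p \<in> ?U" and q: "q \<in> ?U" and "h (H p) = h (H q)"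
    then have "H p = H q" using inj_onD[OF V(3)] by simp
    then show "p = q" using inj_onD[OF assms(2)] p q by simp
  qed
  moreover have "(\<lambda>z. h (H (B.pr (Q, z)))) holomorphic_on {z \<in> ball 0 1. B.pr (Q, z) \<in> ?U}"
    if Q: "Q \<in> faces \<mu> n C" for Q
  proof -
    have "(\<lambda>z. h (B'.pr (Q, shift Q * z))) holomorphic_on {z \<in> ball 0 1. B.pr (Q, z) \<in> ?U}"
      by (rule holomorphic_on_compose_gen[OF _ V(4)[OF Q], unfolded o_def])
        (auto simp: norm_mult norm_shift H_pr rot_def intro!: holomorphic_intros)
    then show ?thesis by (simp add: H_pr rot_def)
  qed
  ultimately show ?thesis unfolding B.conf_chart_def B.conf_fun_def by (intro conjI ballI)
qed

end

sublocale rebased \<subseteq> R: rebased \<mu> n C b' b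
  by unfold_locales

context rebased
begin

lemma rot_rot: "fst p \<in> faces \<mu> n C \<Longrightarrow> R.rot (rot p) = p"
proof -
  assume "fst p \<in> faces \<mu> n C"
  then obtain x where x: "x \<in> signed_labels \<mu> n" "fst p = orbit F x" by (auto simp: faces_def)
  have "R.rot (rot (B.spt x 0)) = B.spt x 0" using rot_spt[OF x(1)] R.rot_spt[OF x(1)] by simp
  then have "R.shift (orbit F x) * (shift (orbit F x) * B.pos x 0) = B.pos x 0"
    by (simp add: rot_def R.rot_def B.spt_def)
  moreover have "B.pos x 0 \<noteq> 0" by (simp add: B.pos_def)
  ultimately have "R.shift (orbit F x) * shift (orbit F x) = 1" by simp
  then show "R.rot (rot p) = p" by (simp add: rot_def R.rot_def x(2)[symmetric] prod_eq_iff mult.assoc[symmetric])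
qed

lemma H_H: "p \<in> topspace B.X \<Longrightarrow> R.H (H p) = p"
proof -
  assume "p \<in> topspace B.X"
  then obtain q where q: "q \<in> faces \<mu> n C \<times> cball 0 1" "p = B.pr q" by (auto simp: B.topspace_X)
  then show "R.H (H p) = p" by (auto simp: H_pr R.H_pr rot_rot)
qed

lemma inj_H: "inj_on H (topspace B.X)"
  using H_H by (rule inj_on_inverseI)

end

context rebased
begin

lemma homeomorphic_H: "homeomorphic_map B.X B'.X H"
proof -
  have "homeomorphic_maps B.X B'.X H R.H"
    unfolding homeomorphic_maps_def using continuous_H R.continuous_H H_H R.H_H by blast
  then show ?thesis using homeomorphic_map_maps by blast
qed

end

section \<open>Uniqueness of the reconstructed diagram\<close>

locale two_immersed = I: immersed \<mu> n C b A d + I': immersed \<mu> n C b' A' d'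
  for \<mu> n C b A d b' A' d'
begin

sublocale rebased \<mu> n C b b'
  by unfold_locales

lemma H_path: "c \<in> {1..\<mu>} \<Longrightarrow> H (I.path c s) = I'.path c s"
  unfolding I.path_def I'.path_def by (rule H_pt[OF I.lab_SL(1)])

text \<open>The parameter at which the second immersion has reached the same point of the circuit.\<close>

definition r :: "nat \<Rightarrow> real \<Rightarrow> real" where
  "r c t = I'.T c (I.G c t)"

lemma G_r: "c \<in> {1..\<mu>} \<Longrightarrow> I'.G c (r c t) = I.G c t"
  by (simp add: r_def)

lemma H_d: "c \<in> {1..\<mu>} \<Longrightarrow> H (d (c, cis t)) = d' (c, cis (r c t))"
  by (simp add: I.d_G I'.d_G G_r H_path)

lemma r_period: "c \<in> {1..\<mu>} \<Longrightarrow> r c (t + 2 * pi) = r c t + 2 * pi"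
  using I.G_period_int[of c t 1] I'.T_period[of c "I.G c t"] by (simp add: r_def)

lemma r_mono: "c \<in> {1..\<mu>} \<Longrightarrow> strict_mono (r c)"
  unfolding r_def by (rule strict_monoI) (use strict_monoD[OF I.G_mono] strict_monoD[OF I'.T_mono] in blast)

lemma r_continuous: "c \<in> {1..\<mu>} \<Longrightarrow> continuous_on S (r c)"
proof -
  assume c: "c \<in> {1..\<mu>}"
  have "surj (r c)"
  proof (rule surjI)
    show "r c (I.T c (I'.G c t)) = t" for t using c by (simp add: r_def)
  qed
  then show "continuous_on S (r c)" by (rule strict_mono_surj_continuous[OF r_mono[OF c]])
qed

text \<open>The same real coordinate along the circuit is regular for both immersions, and \<open>r\<close> matches
  its values.\<close>

lemma r_local:
  assumes c: "c \<in> {1..\<mu>}"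
  shows "\<exists>S. open S \<and> t0 \<in> S \<and> smooth_on (r c) S \<and> (\<forall>t\<in>S. \<exists>D>0. (r c has_real_derivative D) (at t))"
proof -
  let ?s = "I.G c t0"
  let ?\<alpha> = "\<lambda>t. loc_coord ?s (I.G c t)" and ?\<beta> = "\<lambda>t. loc_coord ?s (I'.G c t)"
  let ?S = "{t. I.G c t \<in> loc_int ?s}" and ?V = "{t. I'.G c t \<in> loc_int ?s}"
  note a = I.coord_regular[OF c, of ?s] and a' = I'.coord_regular[OF c, of ?s]
  note \<alpha> = regular_curve_of_real[OF a] and \<beta> = regular_curve_of_real[OF a']
  have sub: "r c ` ?S \<subseteq> ?V" using G_r[OF c] by auto
  have eq: "?\<beta> (r c t) = ?\<alpha> t" for t using G_r[OF c] by simp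
  note R = reparametrization_smooth[OF a(1) a'(1) sub eq r_continuous[OF c] \<alpha>(1) \<beta>(1) \<beta>(2)]
  have "\<exists>D>0. (r c has_real_derivative D) (at t)" if t: "t \<in> ?S" for t
  proof -
    define D where "D = vector_derivative ?\<alpha> (at t) / vector_derivative ?\<beta> (at (r c t))"
    have D: "(r c has_real_derivative D) (at t)" unfolding D_def by (rule R(2)[OF _ t])
    have "r c t \<in> ?V" using sub t by blast
    then have "D \<noteq> 0" using \<alpha>(2)[OF t] \<beta>(2) by (simp add: D_def)
    moreover have "- D \<le> 0"
      by (rule strict_antimono_derivative_nonpos[OF DERIV_minus[OF D] open_UNIV UNIV_I])
        (use strict_monoD[OF r_mono[OF c]] in simp)
    ultimately show ?thesis using D by (intro exI[of _ D]) simp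
  qed
  moreover have "smooth_on (r c) ?S" by (rule R(1))
  moreover have "t0 \<in> ?S" using loc_int(2) by simp
  ultimately show ?thesis using a(1) by blast
qed

lemma r_smooth: "c \<in> {1..\<mu>} \<Longrightarrow> smooth_on (r c) UNIV"
  by (rule smooth_on_local) (use r_local in blast)

lemma r_deriv: "c \<in> {1..\<mu>} \<Longrightarrow> 0 < deriv (r c) t"
proof -
  assume c: "c \<in> {1..\<mu>}"
  obtain D where "0 < D" "(r c has_real_derivative D) (at t)" using r_local[OF c, of t] by blast
  then show "0 < deriv (r c) t" by (simp add: DERIV_imp_deriv)
qed

lemma H_oriented_smooth:
  assumes "(U, \<phi>) \<in> A" "(V, \<psi>) \<in> A'"
  shows "oriented_smooth_on (\<psi> \<circ> H \<circ> inv_into U \<phi>) (\<phi> ` {x \<in> U. H x \<in> V})"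
proof -
  have ch: "I.conf_chart U \<phi>" by (rule I.smoothing_conf_chart[OF I.smoothing assms(1)])
  have ch': "I.conf_chart {p \<in> topspace I.X. H p \<in> V} (\<lambda>p. \<psi> (H p))"
    by (rule H_conf_chart[OF I'.smoothing_conf_chart[OF I'.smoothing assms(2)] inj_H])
  have "U \<inter> {p \<in> topspace I.X. H p \<in> V} = {x \<in> U. H x \<in> V}" using I.conf_chartD(4)[OF ch] by blast
  with I.conf_oriented_smooth[OF ch ch'] show ?thesis by (simp add: o_def)
qed

lemma diagrams_equivalent:
  assumes D: "surf D = I.X" "atlas D = A" "imm D = d"
    "\<forall>l\<in>labels \<mu> n. edge D l = edge_path \<mu> n C b l ` {0<..<1}"
    "\<forall>x\<in>signed_labels \<mu> n. csign D (end_point \<mu> n C b x) = color (vertex_of C x)"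
    and D': "surf D' = I'.X" "atlas D' = A'" "imm D' = d'"
    "\<forall>l\<in>labels \<mu> n. edge D' l = edge_path \<mu> n C b' l ` {0<..<1}"
    "\<forall>x\<in>signed_labels \<mu> n. csign D' (end_point \<mu> n C b' x) = color (vertex_of C x)"
  shows "diagram_equiv \<mu> n D D'"
  unfolding diagram_equiv_def D(1-3) D'(1-3)
proof (intro exI[of _ H] conjI ballI)
  show "homeomorphic_map I.X I'.X H" by (rule homeomorphic_H)
  show "case \<kappa> of (U, \<phi>) \<Rightarrow> \<forall>(V, \<psi>)\<in>A'. oriented_smooth_on (\<psi> \<circ> H \<circ> inv_into U \<phi>) (\<phi> ` {x \<in> U. H x \<in> V})"
    if "\<kappa> \<in> A" for \<kappa>
    using that H_oriented_smooth by (cases \<kappa>) auto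
  show "\<exists>r. smooth_on r UNIV \<and> (\<forall>t. 0 < deriv r t) \<and> (\<forall>t. r (t + 2 * pi) = r t + 2 * pi) \<and>
      (\<forall>t. H (d (c, cis t)) = d' (c, cis (r t)))" if "c \<in> {1..\<mu>}" for c
    using r_smooth[OF that] r_deriv[OF that] r_period[OF that] H_d[OF that] by blast
  show "H ` edge D l = edge D' l" if l: "l \<in> labels \<mu> n" for l
  proof -
    have "Plus l \<in> signed_labels \<mu> n" using l by (simp add: signed_labels_iff)
    from H_pt[OF this] show ?thesis
      using D(4) D'(4) l by (simp add: I.edge_path_eq I'.edge_path_eq image_image)
  qed
  fix q assume "q \<in> crossings \<mu> d"
  then obtain x where x: "x \<in> signed_labels \<mu> n" "q = I.pt x 1" unfolding I.crossings_eq by blast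
  show "csign D' (H q) = csign D q"
    using D(5) D'(5) x H_pt[OF x(1), of 1] by (simp add: I.end_point_eq I'.end_point_eq)
qed

end

context immersed
begin

lemma diagram:
  assumes D: "surf D = X" "atlas D = A" "imm D = d"
    "\<forall>l\<in>L. edge D l = edge_path \<mu> n C b l ` {0<..<1}"
    "\<forall>x\<in>SL. csign D (end_point \<mu> n C b x) = color (vertex_of C x)"
  shows "labeled_link_diagram \<mu> n D"
    and "crossings \<mu> (imm D) = end_point \<mu> n C b ` SL"
    and "respects_cyclic_order \<mu> n C b D"
proof -
  have color: "color (vertex_of C x) \<in> {1, - 1}" if x: "x \<in> SL" for x
  proof -
    obtain q j where "q \<in># C" "location C x = (q, j)" using SL_cases[OF x] by metis
    then show ?thesis using sign_pattern[of q] by (auto simp: vertex_of_def color_def)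
  qed
  show cr: "crossings \<mu> (imm D) = end_point \<mu> n C b ` SL"
    unfolding D(3) crossings_eq by (rule image_cong) (simp_all add: end_point_eq)
  show "labeled_link_diagram \<mu> n D"
    unfolding labeled_link_diagram_def cr
  proof (intro conjI ballI)
    show "closed_oriented_surface (surf D) (atlas D)"
      using smoothing compact_X by (simp add: D closed_oriented_surface_def smoothing_def)
    show "edge_labeling \<mu> n (imm D) (edge D)" unfolding D(3) by (rule edge_labeling[OF D(4)])
    fix q assume "q \<in> end_point \<mu> n C b ` SL"
    then obtain x where x: "x \<in> SL" "q = end_point \<mu> n C b x" by blast
    then have sg: "csign D q \<in> {1, - 1}" using D(5) color[OF x(1)] by simp
    then show "csign D q \<in> {1, - 1}" .
    show "\<exists>!p. p \<in> topspace (circles \<mu>) \<and> imm D p = q \<and> over_strand \<mu> D p"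
      using over_strand_unique[OF D(3,2) x(1)] sg unfolding x(2) end_point_eq[OF x(1)] by blast
  qed (use immersion transverse in \<open>simp_all add: D\<close>)
  show "respects_cyclic_order \<mu> n C b D"
    unfolding respects_cyclic_order_def D(2,3)
  proof (intro ballI allI impI)
    fix x \<theta> \<theta>' \<kappa> assume x: "x \<in> SL" "at_end \<mu> n C b d x \<theta>" "at_end \<mu> n C b d (turn C 1 x) \<theta>'" "\<kappa> \<in> A"
    obtain U \<phi> where \<kappa>: "\<kappa> = (U, \<phi>)" by (cases \<kappa>)
    have "conf_chart U \<phi>" using smoothing_conf_chart[OF smoothing] x(4) \<kappa> by simp
    from cyclic_order[OF x(1-3) this]
    show "case \<kappa> of (U, \<phi>) \<Rightarrow> end_point \<mu> n C b x \<in> U \<longrightarrow>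
        0 < det2 (outward \<phi> d x \<theta>) (outward \<phi> d (turn C 1 x) \<theta>')"
      unfolding \<kappa> by (simp add: end_point_eq[OF x(1)])
  qed
qed

end

theorem proposition11:
  fixes \<mu> :: nat and n :: "nat \<Rightarrow> nat" and C :: "quad multiset"
  assumes "pd_code \<mu> n C"
  shows
    "(\<forall>x\<in>signed_labels \<mu> n. \<exists>!p. fst p \<in># C \<and> snd p < 4 \<and> ends (fst p) ! snd p = x) \<and>
     bij_betw (face_succ C) (signed_labels \<mu> n) (signed_labels \<mu> n) \<and>
     (\<forall>l\<in>labels \<mu> n. turn C 2 (Plus l) \<in> Minus ` labels \<mu> n) \<and>
     (\<forall>c\<in>{1..\<mu>}. orbit (next_edge C) (c, 1) = {c} \<times> {1..n c}) \<and>
     (\<forall>q\<in>#C. sign_pattern q \<in> {[True, False, False, True], [True, True, False, False]}) \<and>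
     (\<exists>b. base_choice \<mu> n C b) \<and>
     (\<forall>b. base_choice \<mu> n C b \<longrightarrow>
        graph_embedded \<mu> n C b \<and> (\<exists>D. reconstruction \<mu> n C b D)) \<and>
     (\<forall>b D. reconstruction \<mu> n C b D \<longrightarrow>
        labeled_link_diagram \<mu> n D \<and>
        crossings \<mu> (imm D) = end_point \<mu> n C b ` signed_labels \<mu> n \<and>
        respects_cyclic_order \<mu> n C b D) \<and>
     (\<forall>b b' D D'. reconstruction \<mu> n C b D \<longrightarrow> reconstruction \<mu> n C b' D' \<longrightarrow>
        diagram_equiv \<mu> n D D')"
proof -
  interpret pd \<mu> n C by unfold_locales (rule assms)
  have immersed: "immersed \<mu> n C b (atlas D) (imm D)" if "reconstruction \<mu> n C b D" for b D
    using that unfolding reconstruction_def by unfold_locales auto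
  show ?thesis
  proof (intro conjI ballI allI impI)
    show "\<exists>!p. fst p \<in># C \<and> snd p < 4 \<and> ends (fst p) ! snd p = x" if "x \<in> SL" for x
      by (rule location_ex1[OF that])
    show "bij_betw f SL SL" by (rule bij_f)
    show "turn C 2 (Plus l) \<in> Minus ` L" if "l \<in> L" for l
      using turn2_Plus[OF that] next_label_in[OF that] by simp
    show "orbit (next_edge C) (c, 1) = {c} \<times> {1..n c}" if "c \<in> {1..\<mu>}" for c
      by (rule orbit_next_edge[OF that])
    show "sign_pattern q \<in> {[True, False, False, True], [True, True, False, False]}" if "q \<in># C" for q
      by (rule sign_pattern[OF that])
    show "\<exists>b. base_choice \<mu> n C b" by (rule base_choice_exists)
  next
    fix b assume "base_choice \<mu> n C b"
    then interpret pdb \<mu> n C b by unfold_locales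
    show "graph_embedded \<mu> n C b" by (rule graph_embedded)
    show "\<exists>D. reconstruction \<mu> n C b D" by (rule reconstruction_exists)
  next
    fix b D assume r: "reconstruction \<mu> n C b D"
    interpret immersed \<mu> n C b "atlas D" "imm D" by (rule immersed[OF r])
    show "labeled_link_diagram \<mu> n D" "crossings \<mu> (imm D) = end_point \<mu> n C b ` SL"
      "respects_cyclic_order \<mu> n C b D"
      by (rule diagram; use r in \<open>simp add: reconstruction_def\<close>)+
  next
    fix b b' D D' assume r: "reconstruction \<mu> n C b D" "reconstruction \<mu> n C b' D'"
    interpret two_immersed \<mu> n C b "atlas D" "imm D" b' "atlas D'" "imm D'"
      using immersed r by (simp add: two_immersed_def)
    show "diagram_equiv \<mu> n D D'"
      by (rule diagrams_equivalent; use r in \<open>simp add: reconstruction_def\<close>)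
  qed
qed

end
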